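(* Let $\mu\in\Delta_m$, $\nu\in\Delta_n$ have positive entries, $C\in\mathbb R^{m\times n}$, and $(f^0,g^0)\in\mathbb R^m\times\mathbb R^n$. For each $\tau>0$ let $(\pi^k)_k$ be the primal Sinkhorn iterates with regularization $\tau$ initialized at $(f^0,g^0)$. Let $0=t_0<t_1<\dots<t_L<t_{L+1}=\infty$ and $(\mathcal E^\ell)_{0\le\ell\le L}$ be the phase transition times and edge sets of the cold Sinkhorn dynamics initialized at $(f_0[g^0],g_0[f_0[g^0]])$. Then for every $0\le\ell\le L$ and every $t$ with $t_\ell<t<t_{\ell+1}$, as $\tau\to0$, $$\big(\pi^{2\lfloor t/\tau\rfloor+2},\ \pi^{2\lfloor t/\tau\rfloor+3}\big)\to\big(\bar\pi^\ell_{\mathrm{even}},\ \bar\pi^\ell_{\mathrm{odd}}\big),$$ where $\bar\pi^\ell_{\mathrm{even}}=Q^*_0(\mu,\nu,\mathcal E^\ell,C)$ and $\bar\pi^\ell_{\mathrm{odd}}=P^*_0(\mu,\nu,\mathcal E^\ell,C)$ (extended by $0$ outside $\mathcal E^\ell$).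
   Context: $\Delta_N$ is the probability simplex in $\mathbb R^N$; $H(p|q)=\sum_I p_I\log(p_I/q_I)$ is relative entropy (with $0\log0=0$); $(\mu\otimes\nu)_{ij}=\mu_i\nu_j$. **Sinkhorn algorithm.** For $\tau>0$, $f_\tau[g]_i=-\tau\log\sum_j e^{(-C_{ij}+g_j)/\tau}\nu_j$ and $g_\tau[f]_j=-\tau\log\sum_i e^{(-C_{ij}+f_i)/\tau}\mu_i$. From $(f^0,g^0)$: for $k\ge0$ even, $f^{k+1}=f_\tau[g^k]$, $g^{k+1}=g^k$; for $k$ odd, $f^{k+1}=f^k$, $g^{k+1}=g_\tau[f^k]$. The primal iterates are $\pi^k_{ij}=e^{(-C_{ij}+f^k_i+g^k_j)/\tau}\mu_i\nu_j$ for $k\ge1$. **Dual OT polytope.** $\mathcal F=\{(f,g)\in\mathbb R^m\times\mathbb R^n:\ f_i+g_j\le C_{ij}\ \forall i,j\}$; $\partial\mathcal F$ is its Pareto frontier: the set of $(f,g)\in\mathcal F$ such that the only $(f',g')\in\mathcal F$ with $f'_i\ge f_i$ and $g'_j\ge g_j$ for all $i,j$ is $(f,g)$ itself. Also $f_0[g]_i=\min_j (C_{ij}-g_j)$ and $g_0[f]_j=\min_i (C_{ij}-f_i)$; always $(f_0[g],g_0[f_0[g]])\in\partial\mathcal F$. **The objects attached to an edge set.** For $\mathcal E\subset\{1,\dots,m\}\times\{1,\dots,n\}$, $\Delta_{\mathcal E}$ is the set of probability distributions on $\mathcal E$; for $\pi\in\Delta_{\mathcal E}$, $(X_\sharp\pi)_i=\sum_{j:(i,j)\in\mathcal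 E}\pi_{ij}$ and $(Y_\sharp\pi)_j=\sum_{i:(i,j)\in\mathcal E}\pi_{ij}$. If the bipartite graph on $\{1,\dots,m\}\sqcup\{1,\dots,n\}$ with edge set $\mathcal E$ has no isolated vertex, let $\mu^*(\mathcal E)$ be the minimizer of $H(\bar\mu|\mu)$ over $\bar\mu$ such that there is $Q\in\Delta_{\mathcal E}$ with $X_\sharp Q=\bar\mu$, $Y_\sharp Q=\nu$; let $\nu^*(\mathcal E)$ be the minimizer of $H(\bar\nu|\nu)$ over $\bar\nu$ such that there is $P\in\Delta_{\mathcal E}$ with $X_\sharp P=\mu$, $Y_\sharp P=\bar\nu$; and $v^*(\mathcal E)_i=\log(\mu_i/\mu^*_i(\mathcal E))$, $w^*(\mathcal E)_j=\log(\nu_j/\nu^*_j(\mathcal E))$. For $\tau>0$, let $$Q^*_\tau(\mu,\nu,\mathcal E,C)=\operatorname*{argmin}_{Q\in\Delta_{\mathcal E}:\ X_\sharp Q=\mu^*(\mathcal E),\ Y_\sharp Q=\nu}\ \sum_{(i,j)\in\mathcal E}C_{ij}Q_{ij}+\tau H(Q|\mu\otimes\nu),$$ $$P^*_\tau(\mu,\nu,\mathcal E,C)=\operatorname*{argmin}_{P\in\Delta_{\mathcal E}:\ X_\sharp P=\mu,\ Y_\sharp P=\nu^*(\mathcal E)}\ \sum_{(i,j)\in\mathcal E}C_{ij}P_{ij}+\tau H(P|\mu\otimes\nu),$$ and $Q^*_0=\lim_{\tau\to0}Q^*_\tau$, $P^*_0=\lim_{\tau\to0}P^*_\tau$ (these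 limits exist). **Cold Sinkhorn dynamics.** For $(\bar f^0,\bar g^0)\in\partial\mathcal F$, it is the continuous curve with $f(0)=\bar f^0$, $g(0)=\bar g^0$ and $\frac{d}{dt}f(t)=\bar v^\ell$, $\frac{d}{dt}g(t)=\bar w^\ell$ for $t\in[t_\ell,t_{\ell+1})$, $\ell\le L$, where $(t_\ell,\bar v^\ell,\bar w^\ell,\mathcal E^\ell)_{\ell\le L}$ is defined recursively: $t_0=0$, $\mathcal E^0=\{(i,j):\bar f^0_i+\bar g^0_j-C_{ij}=0\}$, $\bar v^0=v^*(\mathcal E^0)$, $\bar w^0=w^*(\mathcal E^0)$; and for $\ell\ge0$, $$t_{\ell+1}=\inf\Big\{t\ge t_\ell:\ \max_{(i,j)\notin\mathcal E^\ell} f_i(t_\ell)+g_j(t_\ell)+(t-t_\ell)(\bar v^\ell_i+\bar w^\ell_j)-C_{ij}\ge0\Big\}.$$ If $t_{\ell+1}<\infty$, then $\mathcal E^{\ell+1}=\{(i,j): f_i(t_\ell)+g_j(t_\ell)+(t_{\ell+1}-t_\ell)(\bar v^\ell_i+\bar w^\ell_j)-C_{ij}=0\}$, $\bar v^{\ell+1}=v^*(\mathcal E^{\ell+1})$, $\bar w^{\ell+1}=w^*(\mathcal E^{\ell+1})$. If $t_{\ell+1}=\infty$, then $L=\ell$ and the sequence stops. Set $t_{L+1}=\infty$. (All the sets $\mathcal E^\ell$ arising have no isolated vertex, and $L$ is finite.) *)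

theory Defs
  imports "HOL-Analysis.Analysis"
begin

text \<open>The index sets \<open>{1..m}\<close> and \<open>{1..n}\<close> are finite types \<open>'m\<close> and \<open>'n\<close>. An \<open>m \<times> n\<close> matrix is a
  vector indexed by pairs, so that the simplex and the relative entropy apply to couplings
  and to marginals alike.\<close>

definition prob_simplex :: "(real ^ 'i) set" where
  "prob_simplex = {p. (\<forall>i. 0 \<le> p $ i) \<and> (\<Sum>i\<in>UNIV. p $ i) = 1}"

text \<open>Only used for \<open>q\<close> with positive entries. The summand vanishes when \<open>p $ i = 0\<close>, which is the
  convention \<open>0 log 0 = 0\<close>.\<close>

definition rel_entropy :: "real ^ 'i \<Rightarrow> real ^ 'i \<Rightarrow> real" where
  "rel_entropy p q = (\<Sum>i\<in>UNIV. p $ i * ln (p $ i / q $ i))"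

definition tensor :: "real ^ 'm::finite \<Rightarrow> real ^ 'n::finite \<Rightarrow> real ^ ('m \<times> 'n)" where
  "tensor \<mu> \<nu> = (\<chi> p. \<mu> $ fst p * \<nu> $ snd p)"


subsection \<open>Sinkhorn algorithm\<close>

definition f_reg ::
  "real ^ 'm::finite \<Rightarrow> real ^ 'n::finite \<Rightarrow> real ^ ('m \<times> 'n) \<Rightarrow> real \<Rightarrow> real ^ 'n \<Rightarrow> real ^ 'm" where
  "f_reg \<mu> \<nu> C \<tau> g = (\<chi> i. - \<tau> * ln (\<Sum>j\<in>UNIV. exp ((- C $ (i, j) + g $ j) / \<tau>) * \<nu> $ j))"

definition g_reg ::
  "real ^ 'm::finite \<Rightarrow> real ^ 'n::finite \<Rightarrow> real ^ ('m \<times> 'n) \<Rightarrow> real \<Rightarrow> real ^ 'm \<Rightarrow> real ^ 'n" where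
  "g_reg \<mu> \<nu> C \<tau> f = (\<chi> j. - \<tau> * ln (\<Sum>i\<in>UNIV. exp ((- C $ (i, j) + f $ i) / \<tau>) * \<mu> $ i))"

primrec sinkhorn_dual ::
  "real ^ 'm::finite \<Rightarrow> real ^ 'n::finite \<Rightarrow> real ^ ('m \<times> 'n) \<Rightarrow> real \<Rightarrow> real ^ 'm \<Rightarrow> real ^ 'n
    \<Rightarrow> nat \<Rightarrow> (real ^ 'm) \<times> (real ^ 'n)" where
  "sinkhorn_dual \<mu> \<nu> C \<tau> f0 g0 0 = (f0, g0)"
| "sinkhorn_dual \<mu> \<nu> C \<tau> f0 g0 (Suc k) =
    (case sinkhorn_dual \<mu> \<nu> C \<tau> f0 g0 k of (f, g) \<Rightarrow>
      if even k then (f_reg \<mu> \<nu> C \<tau> g, g) else (f, g_reg \<mu> \<nu> C \<tau> f))"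

definition sinkhorn_primal ::
  "real ^ 'm::finite \<Rightarrow> real ^ 'n::finite \<Rightarrow> real ^ ('m \<times> 'n) \<Rightarrow> real \<Rightarrow> real ^ 'm \<Rightarrow> real ^ 'n
    \<Rightarrow> nat \<Rightarrow> real ^ ('m \<times> 'n)" where
  "sinkhorn_primal \<mu> \<nu> C \<tau> f0 g0 k =
    (case sinkhorn_dual \<mu> \<nu> C \<tau> f0 g0 k of (f, g) \<Rightarrow>
      (\<chi> p. exp ((- C $ p + f $ fst p + g $ snd p) / \<tau>) * \<mu> $ fst p * \<nu> $ snd p))"


subsection \<open>Dual optimal transport polytope\<close>

definition dual_polytope ::
  "real ^ ('m::finite \<times> 'n::finite) \<Rightarrow> ((real ^ 'm) \<times> (real ^ 'n)) set" where
  "dual_polytope C = {(f, g). \<forall>i j. f $ i + g $ j \<le> C $ (i, j)}"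

definition pareto_frontier ::
  "real ^ ('m::finite \<times> 'n::finite) \<Rightarrow> ((real ^ 'm) \<times> (real ^ 'n)) set" where
  "pareto_frontier C = {(f, g). (f, g) \<in> dual_polytope C \<and>
    (\<forall>f' g'. (f', g') \<in> dual_polytope C \<and> (\<forall>i. f $ i \<le> f' $ i) \<and> (\<forall>j. g $ j \<le> g' $ j)
      \<longrightarrow> (f', g') = (f, g))}"

definition f_zero :: "real ^ ('m::finite \<times> 'n::finite) \<Rightarrow> real ^ 'n \<Rightarrow> real ^ 'm" where
  "f_zero C g = (\<chi> i. MIN j. C $ (i, j) - g $ j)"

definition g_zero :: "real ^ ('m::finite \<times> 'n::finite) \<Rightarrow> real ^ 'm \<Rightarrow> real ^ 'n" where
  "g_zero C f = (\<chi> j. MIN i. C $ (i, j) - f $ i)"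

lemma f_zero_g_zero_in_pareto_frontier:
  fixes C :: "real ^ ('m::finite \<times> 'n::finite)"
  shows "(f_zero C g, g_zero C (f_zero C g)) \<in> pareto_frontier C"
proof -
  define f where "f = f_zero C g"
  define h where "h = g_zero C f"
  have f_le: "f $ i \<le> C $ (i, j) - g $ j" for i j
    unfolding f_def f_zero_def by (auto intro!: Min_le)
  have h_le: "h $ j \<le> C $ (i, j) - f $ i" for i j
    unfolding h_def g_zero_def by (auto intro!: Min_le)
  have f_att: "\<exists>j. f $ i = C $ (i, j) - g $ j" for i
    using Min_in[of "range (\<lambda>j. C $ (i, j) - g $ j)"]
    by (simp add: f_def f_zero_def image_iff)
  have h_att: "\<exists>i. h $ j = C $ (i, j) - f $ i" for j
    using Min_in[of "range (\<lambda>i. C $ (i, j) - f $ i)"]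
    by (simp add: h_def g_zero_def image_iff)
  have g_le_h: "g $ j \<le> h $ j" for j
    using h_att[of j] f_le[of _ j] by (metis add.commute le_diff_eq)
  have "f' = f \<and> h' = h"
    if feas: "\<And>i j. f' $ i + h' $ j \<le> C $ (i, j)"
      and ge_f: "\<And>i. f $ i \<le> f' $ i" and ge_h: "\<And>j. h $ j \<le> h' $ j" for f' h'
  proof (intro conjI; subst vec_eq_iff; intro allI)
    fix i
    obtain j where "f $ i = C $ (i, j) - g $ j" using f_att by blast
    with feas[of i j] ge_f[of i] ge_h[of j] g_le_h[of j] show "f' $ i = f $ i" by linarith
  next
    fix j
    obtain i where "h $ j = C $ (i, j) - f $ i" using h_att by blast
    with feas[of i j] ge_f[of i] ge_h[of j] show "h' $ j = h $ j" by linarith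
  qed
  moreover have "f $ i + h $ j \<le> C $ (i, j)" for i j
    using h_le[of j i] by linarith
  ultimately show ?thesis
    unfolding pareto_frontier_def dual_polytope_def f_def[symmetric] h_def[symmetric] by auto
qed


subsection \<open>Objects attached to an edge set\<close>

text \<open>Distributions on \<open>E\<close> are represented by their extension by zero outside \<open>E\<close>, so that the
  marginals may sum over all indices.\<close>

definition edge_simplex :: "('m::finite \<times> 'n::finite) set \<Rightarrow> (real ^ ('m \<times> 'n)) set" where
  "edge_simplex E = {P \<in> prob_simplex. \<forall>p. p \<notin> E \<longrightarrow> P $ p = 0}"

definition marginal_X :: "real ^ ('m::finite \<times> 'n::finite) \<Rightarrow> real ^ 'm" where
  "marginal_X P = (\<chi> i. \<Sum>j\<in>UNIV. P $ (i, j))"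

definition marginal_Y :: "real ^ ('m::finite \<times> 'n::finite) \<Rightarrow> real ^ 'n" where
  "marginal_Y P = (\<chi> j. \<Sum>i\<in>UNIV. P $ (i, j))"

text \<open>The minimizers below exist and are unique when \<open>\<mu>\<close> and \<open>\<nu>\<close> are positive and no vertex of the
  bipartite graph \<open>E\<close> is isolated; the definitions are only meaningful in that case.\<close>

definition mu_star ::
  "real ^ 'm::finite \<Rightarrow> real ^ 'n::finite \<Rightarrow> ('m \<times> 'n) set \<Rightarrow> real ^ 'm" where
  "mu_star \<mu> \<nu> E = arg_min (\<lambda>\<mu>'. rel_entropy \<mu>' \<mu>)
    (\<lambda>\<mu>'. \<exists>Q\<in>edge_simplex E. marginal_X Q = \<mu>' \<and> marginal_Y Q = \<nu>)"

definition nu_star ::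
  "real ^ 'm::finite \<Rightarrow> real ^ 'n::finite \<Rightarrow> ('m \<times> 'n) set \<Rightarrow> real ^ 'n" where
  "nu_star \<mu> \<nu> E = arg_min (\<lambda>\<nu>'. rel_entropy \<nu>' \<nu>)
    (\<lambda>\<nu>'. \<exists>P\<in>edge_simplex E. marginal_X P = \<mu> \<and> marginal_Y P = \<nu>')"

definition v_star ::
  "real ^ 'm::finite \<Rightarrow> real ^ 'n::finite \<Rightarrow> ('m \<times> 'n) set \<Rightarrow> real ^ 'm" where
  "v_star \<mu> \<nu> E = (\<chi> i. ln (\<mu> $ i / mu_star \<mu> \<nu> E $ i))"

definition w_star ::
  "real ^ 'm::finite \<Rightarrow> real ^ 'n::finite \<Rightarrow> ('m \<times> 'n) set \<Rightarrow> real ^ 'n" where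
  "w_star \<mu> \<nu> E = (\<chi> j. ln (\<nu> $ j / nu_star \<mu> \<nu> E $ j))"

definition ent_cost ::
  "real ^ 'm::finite \<Rightarrow> real ^ 'n::finite \<Rightarrow> ('m \<times> 'n) set \<Rightarrow> real ^ ('m \<times> 'n) \<Rightarrow> real
    \<Rightarrow> real ^ ('m \<times> 'n) \<Rightarrow> real" where
  "ent_cost \<mu> \<nu> E C \<tau> P = (\<Sum>p\<in>E. C $ p * P $ p) + \<tau> * rel_entropy P (tensor \<mu> \<nu>)"

definition Q_star ::
  "real ^ 'm::finite \<Rightarrow> real ^ 'n::finite \<Rightarrow> ('m \<times> 'n) set \<Rightarrow> real ^ ('m \<times> 'n) \<Rightarrow> real
    \<Rightarrow> real ^ ('m \<times> 'n)" where
  "Q_star \<mu> \<nu> E C \<tau> = arg_min (ent_cost \<mu> \<nu> E C \<tau>)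
    (\<lambda>Q. Q \<in> edge_simplex E \<and> marginal_X Q = mu_star \<mu> \<nu> E \<and> marginal_Y Q = \<nu>)"

definition P_star ::
  "real ^ 'm::finite \<Rightarrow> real ^ 'n::finite \<Rightarrow> ('m \<times> 'n) set \<Rightarrow> real ^ ('m \<times> 'n) \<Rightarrow> real
    \<Rightarrow> real ^ ('m \<times> 'n)" where
  "P_star \<mu> \<nu> E C \<tau> = arg_min (ent_cost \<mu> \<nu> E C \<tau>)
    (\<lambda>P. P \<in> edge_simplex E \<and> marginal_X P = \<mu> \<and> marginal_Y P = nu_star \<mu> \<nu> E)"

definition Q_star_zero ::
  "real ^ 'm::finite \<Rightarrow> real ^ 'n::finite \<Rightarrow> ('m \<times> 'n) set \<Rightarrow> real ^ ('m \<times> 'n)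
    \<Rightarrow> real ^ ('m \<times> 'n)" where
  "Q_star_zero \<mu> \<nu> E C = Lim (at_right 0) (Q_star \<mu> \<nu> E C)"

definition P_star_zero ::
  "real ^ 'm::finite \<Rightarrow> real ^ 'n::finite \<Rightarrow> ('m \<times> 'n) set \<Rightarrow> real ^ ('m \<times> 'n)
    \<Rightarrow> real ^ ('m \<times> 'n)" where
  "P_star_zero \<mu> \<nu> E C = Lim (at_right 0) (P_star \<mu> \<nu> E C)"


subsection \<open>Cold Sinkhorn dynamics\<close>

text \<open>Phase \<open>l\<close> is recorded by \<open>t\<^sub>l\<close>, the potentials \<open>f(t\<^sub>l)\<close> and \<open>g(t\<^sub>l)\<close>, and the edge set \<open>E\<^sup>l\<close>;
  the velocities are \<open>v_star \<mu> \<nu> E\<^sup>l\<close> and \<open>w_star \<mu> \<nu> E\<^sup>l\<close>.\<close>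

record ('m, 'n) phase =
  phase_time :: real
  phase_f :: "real ^ 'm"
  phase_g :: "real ^ 'n"
  phase_edges :: "('m \<times> 'n) set"

definition tight_edges ::
  "real ^ ('m::finite \<times> 'n::finite) \<Rightarrow> real ^ 'm \<Rightarrow> real ^ 'n \<Rightarrow> ('m \<times> 'n) set" where
  "tight_edges C f g = {(i, j). f $ i + g $ j - C $ (i, j) = 0}"

text \<open>The time \<open>t\<^sub>l\<^sub>+\<^sub>1\<close> at which a phase ends. The maximum over the complement of the edge set is taken
  in the extended reals, so it is \<open>-\<infinity>\<close> when all edges are present; the infimum of the empty
  set is \<open>\<infinity>\<close>.\<close>

definition phase_end ::
  "real ^ 'm::finite \<Rightarrow> real ^ 'n::finite \<Rightarrow> real ^ ('m \<times> 'n) \<Rightarrow> ('m, 'n) phase \<Rightarrow> ereal" where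
  "phase_end \<mu> \<nu> C s =
    (let v = v_star \<mu> \<nu> (phase_edges s); w = w_star \<mu> \<nu> (phase_edges s) in
      Inf (ereal ` {t. phase_time s \<le> t \<and>
        (SUP (i, j)\<in>- phase_edges s.
           ereal (phase_f s $ i + phase_g s $ j + (t - phase_time s) * (v $ i + w $ j) - C $ (i, j)))
          \<ge> 0}))"

definition next_phase ::
  "real ^ 'm::finite \<Rightarrow> real ^ 'n::finite \<Rightarrow> real ^ ('m \<times> 'n) \<Rightarrow> ('m, 'n) phase
    \<Rightarrow> ('m, 'n) phase" where
  "next_phase \<mu> \<nu> C s =
    (let t' = real_of_ereal (phase_end \<mu> \<nu> C s);
         f' = phase_f s + (t' - phase_time s) *\<^sub>R v_star \<mu> \<nu> (phase_edges s);
         g' = phase_g s + (t' - phase_time s) *\<^sub>R w_star \<mu> \<nu> (phase_edges s)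
     in \<lparr>phase_time = t', phase_f = f', phase_g = g', phase_edges = tight_edges C f' g'\<rparr>)"

text \<open>The phases \<open>l = 0, \<dots>, L\<close> of the dynamics started at a point \<open>(f, g)\<close> of the Pareto frontier;
  the value is \<open>None\<close> exactly for \<open>l > L\<close>.\<close>

primrec cold_phase ::
  "real ^ 'm::finite \<Rightarrow> real ^ 'n::finite \<Rightarrow> real ^ ('m \<times> 'n) \<Rightarrow> real ^ 'm \<Rightarrow> real ^ 'n
    \<Rightarrow> nat \<Rightarrow> ('m, 'n) phase option" where
  "cold_phase \<mu> \<nu> C f g 0 =
    Some \<lparr>phase_time = 0, phase_f = f, phase_g = g, phase_edges = tight_edges C f g\<rparr>"
| "cold_phase \<mu> \<nu> C f g (Suc l) =
    (case cold_phase \<mu> \<nu> C f g l of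
       None \<Rightarrow> None
     | Some s \<Rightarrow> if phase_end \<mu> \<nu> C s = \<infinity> then None else Some (next_phase \<mu> \<nu> C s))"

end

theory Submission
  imports Defs
begin

text \<open>Write \<open>F\<^sub>k\<close> for the row potential \<open>f\<close> of Sinkhorn step \<open>2 k + 1\<close>. One has \<open>F\<^sub>k\<^sub>+\<^sub>1 = T F\<^sub>k\<close>, where \<open>T\<close> is a
  composition of two soft minima. Each of them reverses the order and turns the addition of a constant
  into its subtraction, so \<open>T\<close> does not increase the sup norm. To follow \<open>F\<^sub>k\<close> over the order of \<open>1 / \<tau>\<close>
  iterations in a phase it is therefore enough to exhibit a curve that \<open>T\<close> reproduces with an error of
  \<open>\<epsilon> \<tau>\<close> per step (\<open>comparison_principle\<close>).

  In a phase with edge set \<open>E\<close> that starts at \<open>(f, g)\<close> the curve is \<open>f + s v + \<tau> \<phi>\<close>, together with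
  \<open>g + s w + \<tau> \<psi>\<close>. The optimality conditions for \<open>\<mu>\<^sup>*\<close> (\<open>phase_certificate\<close>) say that \<open>v\<^sub>i + w\<^sub>j \<le> 0\<close> on
  \<open>E\<close>, with equality on the support of every optimal coupling, and that \<open>\<nu>\<^sup>*\<close> and \<open>w\<close> are
  determined by the same data. Hence the Gibbs matrix of the curve keeps its entries on the edges
  with equality, which stay tight, while the other entries stay small. The curve is consistent up to \<open>\<epsilon> \<tau>\<close> if the correctors
  \<open>(\<phi>, \<psi>)\<close> scale \<open>\<mu> \<otimes> \<nu>\<close> on \<open>E\<close> to a matrix with marginals close to \<open>(\<mu>\<^sup>*, \<nu>)\<close>
  (\<open>corrector_consistency\<close>). Exact scalings need not exist, because every feasible coupling may vanish
  on some edges, but approximate ones always do (\<open>approximate_scaling\<close>), and they suffice. So the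
  potentials converge to the cold dynamics (\<open>phase_convergence\<close>), and since \<open>F\<^sub>k\<close> is Lipschitz in
  \<open>k \<tau>\<close> uniformly in \<open>\<tau>\<close>, the convergence passes to the start of the next phase.

  The plans depend on the potentials at scale \<open>\<tau>\<close>, so their convergence needs more. By data processing
  the relative entropy of the row marginal with respect to \<open>\<mu>\<close> never increases along the plans of even
  index (\<open>sinkhorn_entropy_decrease\<close>). The relative entropies of \<open>\<mu>\<^sup>*\<close> with respect to these row
  marginals sum to the difference between an increment of the potentials and its leading order, so their
  average over the elapsed part of the phase tends to zero, and some earlier plan of the phase has a row marginal
  close to \<open>\<mu>\<^sup>*\<close>. Thus at time \<open>t\<close> the entropy of the row marginal is at most that of \<open>\<mu>\<^sup>*\<close> up to
  \<open>o(1)\<close>. Entries off \<open>E\<close> vanish, so a cluster point is feasible in the problem that defines \<open>\<mu>\<^sup>*\<close>, and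
  strict minimality forces its row marginal to be \<open>\<mu>\<^sup>*\<close>.

  Finally, a limit of positive matrices that on \<open>E\<close> are diagonal scalings of \<open>\<mu> \<otimes> \<nu>\<close> is the unique
  minimizer of the relative entropy among couplings on \<open>E\<close> with its marginals
  (\<open>product_form_limit_min_gap\<close>). As \<open>C = f + g\<close> on \<open>E\<close>, the transport cost is constant on such
  couplings, so \<open>Q\<^sup>*\<^sub>\<tau>\<close> is this minimizer for every \<open>\<tau>\<close>, and so is its limit. The plans of odd index
  arise from those of even index by rescaling rows, in the limit by the factors \<open>exp v\<^sub>i\<close>, which turns the
  marginals \<open>(\<mu>\<^sup>*, \<nu>)\<close> into \<open>(\<mu>, \<nu>\<^sup>*)\<close>.\<close>

section \<open>Relative entropy and the Hellinger distance\<close>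

text \<open>This is \<open>ln z \<le> z - 1\<close> at \<open>z = sqrt (y / x)\<close>. The squared difference makes it quantitative: summed
  up, it bounds the Hellinger distance by the relative entropy, which replaces every appeal to
  strict convexity below.\<close>

lemma entropy_summand_ge:
  fixes x y :: real
  assumes "0 \<le> x" "0 < y"
  shows "x - y + (sqrt x - sqrt y)\<^sup>2 \<le> x * ln (x / y)"
proof (cases "x = 0")
  case True
  then show ?thesis using assms by simp
next
  case False
  then have x: "0 < x" using assms by simp
  have "ln (sqrt (y / x)) \<le> sqrt (y / x) - 1"
    using x assms by (intro ln_le_minus_one) simp
  then have "2 - 2 * sqrt (y / x) \<le> ln (x / y)"
    using x assms by (simp add: ln_sqrt ln_div)
  then have "x * (2 - 2 * sqrt (y / x)) \<le> x * ln (x / y)"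
    using x by (intro mult_left_mono) auto
  moreover have "x * sqrt (y / x) = sqrt x * sqrt y"
  proof -
    have "x * sqrt (y / x) = (x / sqrt x) * sqrt y" by (simp add: real_sqrt_divide)
    then show ?thesis using x by (simp add: real_div_sqrt)
  qed
  moreover have "x - y + (sqrt x - sqrt y)\<^sup>2 = 2 * x - 2 * (sqrt x * sqrt y)"
    using x assms by (simp add: power2_diff)
  ultimately show ?thesis by (simp add: algebra_simps)
qed

lemma entropy_summand_ge_diff:
  fixes x y :: real
  assumes "0 \<le> x" "0 < y"
  shows "x - y \<le> x * ln (x / y)"
  using entropy_summand_ge[OF assms] zero_le_power2[of "sqrt x - sqrt y"] by linarith

lemma rel_entropy_ge_hellinger:
  assumes "\<And>i. 0 \<le> p $ i" "\<And>i. 0 < q $ i" "(\<Sum>i\<in>UNIV. p $ i) = (\<Sum>i\<in>UNIV. q $ i)"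
  shows "(\<Sum>i\<in>UNIV. (sqrt (p $ i) - sqrt (q $ i))\<^sup>2) \<le> rel_entropy p q"
proof -
  have "(\<Sum>i\<in>UNIV. (sqrt (p $ i) - sqrt (q $ i))\<^sup>2)
      = (\<Sum>i\<in>UNIV. p $ i - q $ i + (sqrt (p $ i) - sqrt (q $ i))\<^sup>2)"
    using assms(3) by (simp add: sum.distrib sum_subtractf)
  also have "\<dots> \<le> rel_entropy p q"
    unfolding rel_entropy_def by (intro sum_mono entropy_summand_ge assms)
  finally show ?thesis .
qed

lemma hellinger_zero_iff:
  fixes p q :: "real ^ 'i::finite"
  assumes "\<And>i. 0 \<le> p $ i" "\<And>i. 0 \<le> q $ i"
  shows "(\<Sum>i\<in>UNIV. (sqrt (p $ i) - sqrt (q $ i))\<^sup>2) \<le> 0 \<longleftrightarrow> p = q"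
proof -
  have "(\<Sum>i\<in>UNIV. (sqrt (p $ i) - sqrt (q $ i))\<^sup>2) \<le> 0
    \<longleftrightarrow> (\<Sum>i\<in>UNIV. (sqrt (p $ i) - sqrt (q $ i))\<^sup>2) = 0"
    by (simp add: order_antisym_conv sum_nonneg)
  also have "\<dots> \<longleftrightarrow> p = q"
    using assms by (subst sum_nonneg_eq_0_iff) (auto simp: vec_eq_iff)
  finally show ?thesis .
qed

text \<open>The summandwise bound \<open>x - y \<le> x ln (x / y)\<close>, applied after \<open>b\<close> is rescaled to the total mass of
  \<open>a\<close>.\<close>

lemma log_sum_inequality:
  fixes a b :: "'i \<Rightarrow> real"
  assumes "finite A" "A \<noteq> {}" "\<And>i. i \<in> A \<Longrightarrow> 0 \<le> a i" "\<And>i. i \<in> A \<Longrightarrow> 0 < b i"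
  shows "sum a A * ln (sum a A / sum b A) \<le> (\<Sum>i\<in>A. a i * ln (a i / b i))"
proof (cases "sum a A = 0")
  case True
  then have "\<forall>i\<in>A. a i = 0" using assms by (subst (asm) sum_nonneg_eq_0_iff) auto
  then show ?thesis by simp
next
  case False
  then have a: "0 < sum a A" using assms(3) by (simp add: order_less_le sum_nonneg)
  have b: "0 < sum b A" using assms by (intro sum_pos) auto
  define r where "r = sum a A / sum b A"
  have r: "0 < r" using a b by (simp add: r_def)
  have "sum a A = (\<Sum>i\<in>A. b i * r)"
    unfolding sum_distrib_right[symmetric] using b by (simp add: r_def)
  then have "0 = (\<Sum>i\<in>A. a i - b i * r)"
    by (simp add: sum_subtractf)
  also have "\<dots> \<le> (\<Sum>i\<in>A. a i * ln (a i / (b i * r)))"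
    using assms r by (intro sum_mono entropy_summand_ge_diff) auto
  also have "\<dots> = (\<Sum>i\<in>A. a i * ln (a i / b i) - a i * ln r)"
  proof (rule sum.cong[OF refl])
    fix i assume "i \<in> A"
    then show "a i * ln (a i / (b i * r)) = a i * ln (a i / b i) - a i * ln r"
      using assms(3)[of i] assms(4)[of i] r
      by (cases "a i = 0") (auto simp: ln_div ln_mult algebra_simps)
  qed
  also have "\<dots> = (\<Sum>i\<in>A. a i * ln (a i / b i)) - sum a A * ln r"
    by (simp add: sum_subtractf sum_distrib_right)
  finally show ?thesis by (simp add: r_def)
qed

text \<open>In this form convergence follows from a vanishing relative entropy \<open>H(p|X)\<close> even though \<open>X\<close> may
  approach the boundary of the simplex.\<close>

lemma tendsto_of_hellinger:
  fixes X :: "'x \<Rightarrow> real ^ 'i::finite"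
  assumes nonneg: "\<And>x i. 0 \<le> X x $ i" "\<And>i. 0 \<le> p $ i"
    and le: "\<forall>\<^sub>F x in F. (\<Sum>i\<in>UNIV. (sqrt (p $ i) - sqrt (X x $ i))\<^sup>2) \<le> A x"
    and A: "(A \<longlongrightarrow> 0) F"
  shows "(X \<longlongrightarrow> p) F"
proof (rule vec_tendstoI)
  fix i
  have "((\<lambda>x. (sqrt (p $ i) - sqrt (X x $ i))\<^sup>2) \<longlongrightarrow> 0) F"
  proof (rule tendsto_sandwich[OF _ _ tendsto_const A])
    show "\<forall>\<^sub>F x in F. (sqrt (p $ i) - sqrt (X x $ i))\<^sup>2 \<le> A x"
      using le
    proof eventually_elim
      case (elim x)
      have "(sqrt (p $ i) - sqrt (X x $ i))\<^sup>2 \<le> (\<Sum>i\<in>UNIV. (sqrt (p $ i) - sqrt (X x $ i))\<^sup>2)"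
        by (rule member_le_sum[of i UNIV "\<lambda>i. (sqrt (p $ i) - sqrt (X x $ i))\<^sup>2"]) auto
      then show ?case using elim by linarith
    qed
  qed simp
  then have "((\<lambda>x. sqrt ((sqrt (p $ i) - sqrt (X x $ i))\<^sup>2)) \<longlongrightarrow> sqrt 0) F" by (rule tendsto_real_sqrt)
  then have "((\<lambda>x. sqrt (p $ i) - sqrt (X x $ i)) \<longlongrightarrow> 0) F"
    by (simp add: tendsto_rabs_zero_iff)
  then have "((\<lambda>x. (sqrt (p $ i) - (sqrt (p $ i) - sqrt (X x $ i)))\<^sup>2) \<longlongrightarrow> (sqrt (p $ i) - 0)\<^sup>2) F"
    by (intro tendsto_intros)
  then show "((\<lambda>x. X x $ i) \<longlongrightarrow> p $ i) F" using nonneg by simp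
qed

section \<open>Couplings and their marginals\<close>

lemma sum_UNIV_prod: "(\<Sum>p\<in>UNIV. h p) = (\<Sum>i\<in>UNIV. \<Sum>j\<in>UNIV. h (i, j))"
  for h :: "'m::finite \<times> 'n::finite \<Rightarrow> 'b::comm_monoid_add"
  by (simp add: sum.cartesian_product flip: UNIV_Times_UNIV)

lemma sum_UNIV_prod': "(\<Sum>p\<in>UNIV. h p) = (\<Sum>j\<in>UNIV. \<Sum>i\<in>UNIV. h (i, j))"
  for h :: "'m::finite \<times> 'n::finite \<Rightarrow> 'b::comm_monoid_add"
  by (subst sum.swap) (rule sum_UNIV_prod)

lemma sum_mult_marginal_X:
  "(\<Sum>p\<in>UNIV. P $ p * h (fst p)) = (\<Sum>i\<in>UNIV. marginal_X P $ i * h i)"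
  by (simp add: sum_UNIV_prod marginal_X_def sum_distrib_right)

lemma sum_mult_marginal_Y:
  "(\<Sum>p\<in>UNIV. P $ p * h (snd p)) = (\<Sum>j\<in>UNIV. marginal_Y P $ j * h j)"
  by (simp add: sum_UNIV_prod' marginal_Y_def sum_distrib_right)

lemma sum_marginal_X: "(\<Sum>i\<in>UNIV. marginal_X P $ i) = (\<Sum>p\<in>UNIV. P $ p)"
  using sum_mult_marginal_X[of P "\<lambda>_. 1"] by simp

lemma sum_marginal_Y: "(\<Sum>j\<in>UNIV. marginal_Y P $ j) = (\<Sum>p\<in>UNIV. P $ p)"
  using sum_mult_marginal_Y[of P "\<lambda>_. 1"] by simp

lemma marginal_X_pos: "(\<And>p. 0 < P $ p) \<Longrightarrow> 0 < marginal_X P $ i"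
  by (simp add: marginal_X_def sum_pos)

lemma marginal_Y_pos: "(\<And>p. 0 < P $ p) \<Longrightarrow> 0 < marginal_Y P $ j"
  by (simp add: marginal_Y_def sum_pos)

text \<open>Data processing: forgetting the column does not increase the relative entropy.\<close>

lemma rel_entropy_marginal_X_le:
  assumes "\<And>p. 0 \<le> P $ p" "\<And>p. 0 < R $ p"
  shows "rel_entropy (marginal_X P) (marginal_X R) \<le> rel_entropy P R"
  unfolding rel_entropy_def sum_UNIV_prod marginal_X_def vec_lambda_beta
  by (intro sum_mono log_sum_inequality assms) auto

lemma rel_entropy_marginal_Y_le:
  assumes "\<And>p. 0 \<le> P $ p" "\<And>p. 0 < R $ p"
  shows "rel_entropy (marginal_Y P) (marginal_Y R) \<le> rel_entropy P R"
  unfolding rel_entropy_def sum_UNIV_prod' marginal_Y_def vec_lambda_beta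
  by (intro sum_mono log_sum_inequality assms) auto

lemma prob_component_le_1: "p \<in> prob_simplex \<Longrightarrow> p $ i \<le> 1"
  unfolding prob_simplex_def using member_le_sum[of i UNIV "\<lambda>i. p $ i"] by auto

lemma abs_marginal_diff_le:
  "\<bar>marginal_X P $ i - marginal_X R $ i\<bar> \<le> (\<Sum>p\<in>UNIV. \<bar>P $ p - R $ p\<bar>)"
  "\<bar>marginal_Y P $ j - marginal_Y R $ j\<bar> \<le> (\<Sum>p\<in>UNIV. \<bar>P $ p - R $ p\<bar>)"
proof -
  have "\<bar>marginal_X P $ i - marginal_X R $ i\<bar> \<le> (\<Sum>j\<in>UNIV. \<bar>P $ (i, j) - R $ (i, j)\<bar>)"
    unfolding marginal_X_def by (simp add: sum_abs flip: sum_subtractf)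
  also have "\<dots> \<le> (\<Sum>i\<in>UNIV. \<Sum>j\<in>UNIV. \<bar>P $ (i, j) - R $ (i, j)\<bar>)"
    by (rule member_le_sum[of i UNIV "\<lambda>i. \<Sum>j\<in>UNIV. \<bar>P $ (i, j) - R $ (i, j)\<bar>"])
      (auto intro: sum_nonneg)
  finally show "\<bar>marginal_X P $ i - marginal_X R $ i\<bar> \<le> (\<Sum>p\<in>UNIV. \<bar>P $ p - R $ p\<bar>)"
    by (simp add: sum_UNIV_prod)
  have "\<bar>marginal_Y P $ j - marginal_Y R $ j\<bar> \<le> (\<Sum>i\<in>UNIV. \<bar>P $ (i, j) - R $ (i, j)\<bar>)"
    unfolding marginal_Y_def by (simp add: sum_abs flip: sum_subtractf)
  also have "\<dots> \<le> (\<Sum>j\<in>UNIV. \<Sum>i\<in>UNIV. \<bar>P $ (i, j) - R $ (i, j)\<bar>)"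
    by (rule member_le_sum[of j UNIV "\<lambda>j. \<Sum>i\<in>UNIV. \<bar>P $ (i, j) - R $ (i, j)\<bar>"])
      (auto intro: sum_nonneg)
  finally show "\<bar>marginal_Y P $ j - marginal_Y R $ j\<bar> \<le> (\<Sum>p\<in>UNIV. \<bar>P $ p - R $ p\<bar>)"
    by (simp add: sum_UNIV_prod')
qed

text \<open>A convex function lies above its tangent at \<open>y\<close>. The point \<open>x\<close> may be the boundary point \<open>0\<close>, where
  the function has no derivative.\<close>

lemma entropy_summand_ge_tangent:
  fixes x y c :: real
  assumes "0 \<le> x" "0 < y" "0 < c"
  shows "y * ln (y / c) + (x - y) * (1 + ln (y / c)) \<le> x * ln (x / c)"
proof -
  have "x * ln (x / c) = x * ln (x / y) + x * ln (y / c)"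
    using assms by (cases "x = 0") (auto simp: ln_div algebra_simps)
  then show ?thesis
    using entropy_summand_ge_diff[OF assms(1,2)] by (simp add: algebra_simps)
qed

text \<open>The hypothesis on the two sums is the first-order optimality condition for \<open>q\<close>; by the three-point
  identity for relative entropies it turns into minimality with a gap, hence strict minimality.\<close>

lemma rel_entropy_min_gap:
  fixes p q \<mu> :: "real ^ 'i::finite"
  assumes p: "p \<in> prob_simplex" and q: "q \<in> prob_simplex" "\<And>i. 0 < q $ i" and \<mu>: "\<And>i. 0 < \<mu> $ i"
    and var: "(\<Sum>i\<in>UNIV. q $ i * ln (q $ i / \<mu> $ i)) \<le> (\<Sum>i\<in>UNIV. p $ i * ln (q $ i / \<mu> $ i))"
  shows "rel_entropy q \<mu> + (\<Sum>i\<in>UNIV. (sqrt (p $ i) - sqrt (q $ i))\<^sup>2) \<le> rel_entropy p \<mu>"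
proof -
  have "rel_entropy p \<mu> = rel_entropy p q + (\<Sum>i\<in>UNIV. p $ i * ln (q $ i / \<mu> $ i))"
    unfolding rel_entropy_def sum.distrib[symmetric]
  proof (rule sum.cong[OF refl])
    fix i
    have "0 \<le> p $ i" using p by (simp add: prob_simplex_def)
    then show "p $ i * ln (p $ i / \<mu> $ i) = p $ i * ln (p $ i / q $ i) + p $ i * ln (q $ i / \<mu> $ i)"
      using q(2)[of i] \<mu>[of i] by (cases "p $ i = 0") (auto simp: ln_div algebra_simps)
  qed
  moreover have "(\<Sum>i\<in>UNIV. (sqrt (p $ i) - sqrt (q $ i))\<^sup>2) \<le> rel_entropy p q"
    using p q by (intro rel_entropy_ge_hellinger) (auto simp: prob_simplex_def)
  ultimately show ?thesis using var by (simp add: rel_entropy_def)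
qed

lemma arg_min_eqI:
  fixes f :: "'a \<Rightarrow> real"
  assumes "P x" "\<And>y. P y \<Longrightarrow> y \<noteq> x \<Longrightarrow> f x < f y"
  shows "arg_min f P = x"
  by (rule arg_minI[of P x]) (use assms in \<open>force+\<close>)

text \<open>At \<open>0\<close> the convention \<open>0 log 0 = 0\<close> agrees with the limit of \<open>x log x\<close>.\<close>

lemma continuous_on_entropy_summand:
  fixes c :: real
  assumes "0 < c"
  shows "continuous_on {0..} (\<lambda>x. x * ln (x / c))"
proof -
  have "((\<lambda>x. x * ln (x / c)) \<longlongrightarrow> x * ln (x / c)) (at x within {0..})" if "0 \<le> x" for x
  proof (cases "x = 0")
    case True
    have "((\<lambda>x::real. - (ln (inverse x) / inverse x) - x * ln c) \<longlongrightarrow> - 0 - 0 * ln c) (at_right 0)"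
      by (intro tendsto_intros filterlim_compose[OF ln_x_over_x_tendsto_0]
          filterlim_inverse_at_top_right)
    then have "((\<lambda>x::real. - (ln (inverse x) / inverse x) - x * ln c) \<longlongrightarrow> 0) (at_right 0)"
      by simp
    moreover have "\<forall>\<^sub>F x in at_right 0. - (ln (inverse x) / inverse x) - x * ln c = x * ln (x / c)"
      using assms by (auto simp: eventually_at_filter ln_div ln_inverse field_simps)
    ultimately have "((\<lambda>x. x * ln (x / c)) \<longlongrightarrow> 0) (at_right 0)"
      by (rule Lim_transform_eventually)
    then show ?thesis using True by (simp add: at_within_Ici_at_right)
  next
    case False
    then show ?thesis using that assms by (intro tendsto_intros) auto
  qed
  then show ?thesis by (simp add: continuous_on_def)
qed

lemma continuous_on_rel_entropy:
  assumes "\<And>i. 0 < \<mu> $ i"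
  shows "continuous_on {p. \<forall>i. 0 \<le> p $ i} (\<lambda>p. rel_entropy p \<mu>)"
  unfolding rel_entropy_def
proof (intro continuous_on_sum)
  fix i
  show "continuous_on {p. \<forall>i. 0 \<le> p $ i} (\<lambda>p. p $ i * ln (p $ i / \<mu> $ i))"
    by (rule continuous_on_compose2[OF continuous_on_entropy_summand[OF assms[of i]]])
      (auto intro!: continuous_intros)
qed

lemma continuous_marginal_X: "continuous_on A marginal_X"
  unfolding marginal_X_def by (intro continuous_intros)

lemma continuous_marginal_Y: "continuous_on A marginal_Y"
  unfolding marginal_Y_def by (intro continuous_intros)

lemma compact_prob_simplex: "compact (prob_simplex :: (real ^ 'i::finite) set)"
proof -
  have "closed (prob_simplex :: (real ^ 'i) set)"
    unfolding prob_simplex_def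
    by (intro closed_Collect_conj closed_Collect_all closed_Collect_le closed_Collect_eq
        continuous_intros)
  moreover have "norm p \<le> 1" if "p \<in> prob_simplex" for p :: "real ^ 'i"
    using norm_le_l1_cart[of p] that by (simp add: prob_simplex_def)
  ultimately show ?thesis by (auto simp: compact_eq_bounded_closed bounded_iff)
qed

lemma closed_edge_simplex:
  fixes E :: "('m::finite \<times> 'n::finite) set"
  shows "closed (edge_simplex E)"
proof -
  have eq: "edge_simplex E = prob_simplex \<inter> {P. \<forall>p. p \<notin> E \<longrightarrow> P $ p = 0}"
    by (auto simp: edge_simplex_def)
  have "closed {P :: real ^ ('m \<times> 'n). \<forall>p. p \<notin> E \<longrightarrow> P $ p = 0}"
    by (intro closed_Collect_all closed_Collect_imp closed_Collect_eq continuous_intros open_Collect_const)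
  then show ?thesis
    unfolding eq by (rule closed_Int[OF compact_imp_closed[OF compact_prob_simplex]])
qed

lemma edge_simplexD:
  assumes "Q \<in> edge_simplex E"
  shows "0 \<le> Q $ p" "p \<notin> E \<Longrightarrow> Q $ p = 0" "(\<Sum>p\<in>UNIV. Q $ p) = 1"
  using assms unfolding edge_simplex_def prob_simplex_def by blast+

lemma marginal_X_prob: "P \<in> prob_simplex \<Longrightarrow> marginal_X P \<in> prob_simplex"
  by (auto simp: prob_simplex_def sum_marginal_X) (simp add: marginal_X_def sum_nonneg)

lemma marginal_Y_prob: "P \<in> prob_simplex \<Longrightarrow> marginal_Y P \<in> prob_simplex"
  by (auto simp: prob_simplex_def sum_marginal_Y) (simp add: marginal_Y_def sum_nonneg)

section \<open>Optimality conditions for the velocities of a phase\<close>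

lemma ex_entropy_minimizer:
  fixes \<mu> :: "real ^ 'm::finite" and \<nu> :: "real ^ 'n::finite"
  assumes \<mu>: "\<And>i. 0 < \<mu> $ i" and \<nu>: "\<nu> \<in> prob_simplex" and E: "\<And>j. \<exists>i. (i, j) \<in> E"
  obtains Q where "Q \<in> edge_simplex E" "marginal_Y Q = \<nu>"
    "\<And>Q'. Q' \<in> edge_simplex E \<Longrightarrow> marginal_Y Q' = \<nu>
      \<Longrightarrow> rel_entropy (marginal_X Q) \<mu> \<le> rel_entropy (marginal_X Q') \<mu>"
proof -
  let ?S = "edge_simplex E \<inter> {Q. marginal_Y Q = \<nu>}"
  have "closed ?S"
    by (intro closed_Int closed_edge_simplex closed_Collect_eq continuous_marginal_Y continuous_intros)
  then have "compact (prob_simplex \<inter> ?S)" by (intro compact_Int_closed compact_prob_simplex)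
  moreover have "prob_simplex \<inter> ?S = ?S" by (auto simp: edge_simplex_def)
  ultimately have "compact ?S" by simp
  moreover have "?S \<noteq> {}"
  proof -
    obtain h where h: "\<And>j. (h j, j) \<in> E" using E by metis
    define Q where "Q = (\<chi> p. if fst p = h (snd p) then \<nu> $ snd p else 0)"
    have Y: "marginal_Y Q = \<nu>" by (simp add: vec_eq_iff marginal_Y_def Q_def)
    moreover have "Q \<in> edge_simplex E"
      using \<nu> h sum_marginal_Y[of Q]
      by (auto simp: edge_simplex_def prob_simplex_def Y) (auto simp: Q_def)
    ultimately show ?thesis by auto
  qed
  moreover have "continuous_on ?S (\<lambda>Q. rel_entropy (marginal_X Q) \<mu>)"
    by (rule continuous_on_compose2[OF continuous_on_rel_entropy[OF \<mu>] continuous_marginal_X])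
      (auto simp: marginal_X_def edge_simplexD intro!: sum_nonneg)
  ultimately obtain Q where "Q \<in> ?S"
    "\<forall>Q'\<in>?S. rel_entropy (marginal_X Q) \<mu> \<le> rel_entropy (marginal_X Q') \<mu>"
    using continuous_attains_inf by blast
  then show ?thesis by (intro that[of Q]) auto
qed

lemma marginal_X_add_scale: "marginal_X (P + s *\<^sub>R (R - S)) = marginal_X P + s *\<^sub>R (marginal_X R - marginal_X S)"
  by (simp add: vec_eq_iff marginal_X_def sum.distrib sum_subtractf flip: sum_distrib_left)

lemma marginal_Y_add_scale: "marginal_Y (P + s *\<^sub>R (R - S)) = marginal_Y P + s *\<^sub>R (marginal_Y R - marginal_Y S)"
  by (simp add: vec_eq_iff marginal_Y_def sum.distrib sum_subtractf flip: sum_distrib_left)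

lemma marginal_X_axis: "marginal_X (axis (i, j) 1) = axis i 1"
  by (auto simp: vec_eq_iff marginal_X_def axis_def)

lemma marginal_Y_axis: "marginal_Y (axis (i, j) 1) = axis j 1"
  by (auto simp: vec_eq_iff marginal_Y_def axis_def)

text \<open>First-order optimality: moving mass within column \<open>j\<close> from row \<open>i\<close> to row \<open>k\<close> keeps the column
  marginal, so at a minimizer it cannot pay off. The density of the row marginal is thus minimal at the
  rows that a column actually uses.\<close>

lemma entropy_minimizer_exchange:
  fixes \<mu> :: "real ^ 'm::finite" and \<nu> :: "real ^ 'n::finite"
  assumes \<mu>: "\<And>i. 0 < \<mu> $ i" and Q: "Q \<in> edge_simplex E" "marginal_Y Q = \<nu>"
    and min: "\<And>Q'. Q' \<in> edge_simplex E \<Longrightarrow> marginal_Y Q' = \<nu>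
      \<Longrightarrow> rel_entropy (marginal_X Q) \<mu> \<le> rel_entropy (marginal_X Q') \<mu>"
    and ij: "0 < Q $ (i, j)" and kj: "(k, j) \<in> E"
  shows "marginal_X Q $ i / \<mu> $ i \<le> marginal_X Q $ k / \<mu> $ k"
proof (cases "k = i")
  case False
  define m where "m = marginal_X Q"
  have m_nonneg: "0 \<le> m $ a" for a
    using Q(1) by (simp add: m_def marginal_X_def sum_nonneg edge_simplexD)
  have m_ge: "Q $ (i, j) \<le> m $ i"
    unfolding m_def marginal_X_def using Q(1)
    by (auto intro!: member_le_sum[of j UNIV "\<lambda>j. Q $ (i, j)"] simp: edge_simplexD)
  have step: "(m $ i - s) / \<mu> $ i \<le> (m $ k + s) / \<mu> $ k" if s: "0 < s" "s < Q $ (i, j)" for s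
  proof -
    \<comment> \<open>The tangents are taken at the perturbed point, where both densities are positive, so that no
      positivity of the minimizer is presupposed.\<close>
    define Q' where "Q' = Q + s *\<^sub>R (axis (k, j) 1 - axis (i, j) 1)"
    define m' where "m' = m + s *\<^sub>R (axis k 1 - axis i 1)"
    have X: "marginal_X Q' = m'"
      by (simp add: Q'_def marginal_X_add_scale marginal_X_axis m_def m'_def)
    have Y: "marginal_Y Q' = \<nu>"
      by (simp add: Q'_def marginal_Y_add_scale marginal_Y_axis Q)
    have "(i, j) \<in> E" using edge_simplexD(2)[OF Q(1), of "(i, j)"] ij by force
    then have "Q' \<in> edge_simplex E"
      using edge_simplexD[OF Q(1)] s kj sum_marginal_Y[of Q'] sum_marginal_Y[of Q]
      unfolding edge_simplex_def prob_simplex_def Y Q(2)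
      by (auto simp: Q'_def axis_def)
    then have "rel_entropy m \<mu> \<le> rel_entropy m' \<mu>" using min[of Q'] X Y by (simp add: m_def)
    moreover define h where "h a x = x * ln (x / \<mu> $ a)" for a x
    have split: "rel_entropy p \<mu> = h i (p $ i) + h k (p $ k) + (\<Sum>a\<in>-{i, k}. h a (p $ a))" for p
    proof -
      have "rel_entropy p \<mu> = (\<Sum>a\<in>{i, k}. h a (p $ a)) + (\<Sum>a\<in>-{i, k}. h a (p $ a))"
        unfolding rel_entropy_def h_def by (subst sum.union_disjoint[symmetric]) auto
      then show ?thesis using False by simp
    qed
    moreover have "(\<Sum>a\<in>-{i, k}. h a (m' $ a)) = (\<Sum>a\<in>-{i, k}. h a (m $ a))"
      by (rule sum.cong) (auto simp: m'_def axis_def)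
    moreover have "m' $ i = m $ i - s" "m' $ k = m $ k + s"
      using False by (auto simp: m'_def axis_def)
    ultimately have "h i (m $ i) + h k (m $ k) \<le> h i (m $ i - s) + h k (m $ k + s)" by simp
    moreover have "h i (m $ i - s) + s * (1 + ln ((m $ i - s) / \<mu> $ i)) \<le> h i (m $ i)"
      using entropy_summand_ge_tangent[of "m $ i" "m $ i - s" "\<mu> $ i"] m_nonneg \<mu> m_ge s
      by (simp add: h_def)
    moreover have "h k (m $ k + s) - s * (1 + ln ((m $ k + s) / \<mu> $ k)) \<le> h k (m $ k)"
      using entropy_summand_ge_tangent[of "m $ k" "m $ k + s" "\<mu> $ k"] m_nonneg[of k] \<mu> s
      by (simp add: h_def)
    ultimately have "s * (ln ((m $ i - s) / \<mu> $ i) - ln ((m $ k + s) / \<mu> $ k)) \<le> 0"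
      by (simp add: algebra_simps)
    then have "ln ((m $ i - s) / \<mu> $ i) \<le> ln ((m $ k + s) / \<mu> $ k)"
      using s by (simp add: mult_le_0_iff)
    then show ?thesis using m_ge m_nonneg[of k] \<mu> s by (subst (asm) ln_le_cancel_iff) auto
  qed
  have "((\<lambda>s. (m $ i - s) / \<mu> $ i) \<longlongrightarrow> (m $ i - 0) / \<mu> $ i) (at_right 0)"
    using \<mu>[of i] by (intro tendsto_intros) auto
  moreover have "((\<lambda>s. (m $ k + s) / \<mu> $ k) \<longlongrightarrow> (m $ k + 0) / \<mu> $ k) (at_right 0)"
    using \<mu>[of k] by (intro tendsto_intros) auto
  moreover have "\<forall>\<^sub>F s in at_right 0. (m $ i - s) / \<mu> $ i \<le> (m $ k + s) / \<mu> $ k"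
    using eventually_at_right[of 0 "Q $ (i, j)"] ij step by blast
  ultimately have "(m $ i - 0) / \<mu> $ i \<le> (m $ k + 0) / \<mu> $ k"
    by (intro tendsto_le[OF _ _ _]) auto
  then show ?thesis by (simp add: m_def)
qed simp

text \<open>On the support of \<open>Q\<close> the exchange inequalities make \<open>v\<^sub>i\<close> the maximum of \<open>v\<close> over the neighbours of
  column \<open>j\<close>, so \<open>w\<^sub>j = - max v\<^sub>i\<close> is complementary to \<open>v\<close>. This pair proves the minimality of
  \<open>\<mu>\<^sup>*\<close>; read in the other direction, with \<open>Q\<close> rescaled by \<open>exp v\<^sub>i\<close>, it also proves that
  \<open>\<nu>\<^sup>* = \<nu> exp (- w)\<close>. The last conclusion identifies the row marginal of a limit of plans.\<close>

lemma phase_certificate: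
  fixes \<mu> :: "real ^ 'm::finite" and \<nu> :: "real ^ 'n::finite"
  assumes \<mu>: "\<mu> \<in> prob_simplex" "\<And>i. 0 < \<mu> $ i"
    and \<nu>: "\<nu> \<in> prob_simplex" "\<And>j. 0 < \<nu> $ j"
    and EX: "\<And>i. \<exists>j. (i, j) \<in> E" and EY: "\<And>j. \<exists>i. (i, j) \<in> E"
  obtains Q where "Q \<in> edge_simplex E" "marginal_X Q = mu_star \<mu> \<nu> E" "marginal_Y Q = \<nu>"
    "\<And>i. 0 < mu_star \<mu> \<nu> E $ i" "\<And>j. nu_star \<mu> \<nu> E $ j = \<nu> $ j * exp (- w_star \<mu> \<nu> E $ j)"
    "\<And>i j. (i, j) \<in> E \<Longrightarrow> v_star \<mu> \<nu> E $ i + w_star \<mu> \<nu> E $ j \<le> 0"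
    "\<And>i j. 0 < Q $ (i, j) \<Longrightarrow> v_star \<mu> \<nu> E $ i + w_star \<mu> \<nu> E $ j = 0"
    "\<And>Q'. Q' \<in> edge_simplex E \<Longrightarrow> marginal_Y Q' = \<nu> \<Longrightarrow>
      rel_entropy (mu_star \<mu> \<nu> E) \<mu>
        + (\<Sum>i\<in>UNIV. (sqrt (marginal_X Q' $ i) - sqrt (mu_star \<mu> \<nu> E $ i))\<^sup>2)
      \<le> rel_entropy (marginal_X Q') \<mu>"
proof -
  obtain Q where Q: "Q \<in> edge_simplex E" "marginal_Y Q = \<nu>"
    and Qmin: "\<And>Q'. Q' \<in> edge_simplex E \<Longrightarrow> marginal_Y Q' = \<nu>
      \<Longrightarrow> rel_entropy (marginal_X Q) \<mu> \<le> rel_entropy (marginal_X Q') \<mu>"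
    using ex_entropy_minimizer[OF \<mu>(2) \<nu>(1) EY] by metis
  note Qs = edge_simplexD[OF Q(1)]
  define m where "m = marginal_X Q"
  have exchange: "m $ i / \<mu> $ i \<le> m $ k / \<mu> $ k" if "0 < Q $ (i, j)" "(k, j) \<in> E" for i j k
    unfolding m_def by (rule entropy_minimizer_exchange[OF \<mu>(2) Q _ that]) (rule Qmin)
  have mprob: "m \<in> prob_simplex"
    using Q(1) by (auto simp: m_def edge_simplex_def intro: marginal_X_prob)
  have mpos: "0 < m $ i" for i
  proof -
    obtain j where j: "(i, j) \<in> E" using EX by blast
    have "0 < (\<Sum>a\<in>UNIV. Q $ (a, j))" using Q(2) \<nu>(2)[of j] by (auto simp: marginal_Y_def)
    then obtain a where a: "0 < Q $ (a, j)" by (meson not_less sum_nonpos)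
    \<comment> \<open>Some row \<open>a\<close> feeds column \<open>j\<close>, and row \<open>i\<close> has at least its density.\<close>
    have "Q $ (a, j) \<le> m $ a"
      unfolding m_def marginal_X_def
      by (auto intro!: member_le_sum[of j UNIV "\<lambda>j. Q $ (a, j)"] simp: Qs)
    then have "0 < m $ a / \<mu> $ a" using a \<mu>(2)[of a] by simp
    also have "\<dots> \<le> m $ i / \<mu> $ i" using a j by (rule exchange)
    finally show ?thesis using \<mu>(2)[of i] by (simp add: zero_less_divide_iff)
  qed
  define v where "v = (\<chi> i. ln (\<mu> $ i / m $ i))"
  define w where "w = (\<chi> j. - Max ((\<lambda>i. v $ i) ` {i. (i, j) \<in> E}))"
  have vw: "v $ i + w $ j \<le> 0" if "(i, j) \<in> E" for i j
    using that by (auto simp: w_def)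
  have vwQ: "v $ i + w $ j = 0" if "0 < Q $ (i, j)" for i j
  proof -
    have "v $ k \<le> v $ i" if "(k, j) \<in> E" for k
    proof -
      have "\<mu> $ k / m $ k \<le> \<mu> $ i / m $ i"
        using exchange[OF \<open>0 < Q $ (i, j)\<close> that] mpos[of i] mpos[of k] \<mu>(2)[of i] \<mu>(2)[of k]
        by (simp add: field_simps)
      then show ?thesis using mpos \<mu>(2) by (simp add: v_def)
    qed
    moreover have "(i, j) \<in> E" using Qs(2)[of "(i, j)"] that by force
    ultimately have "Max ((\<lambda>i. v $ i) ` {i. (i, j) \<in> E}) = v $ i"
      by (intro Max_eqI) auto
    then show ?thesis by (simp add: w_def)
  qed
  have vm: "ln (m $ i / \<mu> $ i) = - v $ i" for i
    using mpos \<mu>(2) by (simp add: v_def ln_div)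
  have Qvw: "(\<Sum>p\<in>UNIV. Q $ p * - v $ fst p) = (\<Sum>p\<in>UNIV. Q $ p * w $ snd p)"
  proof (rule sum.cong[OF refl])
    fix p
    show "Q $ p * - v $ fst p = Q $ p * w $ snd p"
      using vwQ[of "fst p" "snd p"] Qs(1)[of p] by (cases "Q $ p = 0") (auto simp: add_eq_0_iff)
  qed
  have gap: "rel_entropy m \<mu> + (\<Sum>i\<in>UNIV. (sqrt (marginal_X Q' $ i) - sqrt (m $ i))\<^sup>2)
      \<le> rel_entropy (marginal_X Q') \<mu>"
    if Q': "Q' \<in> edge_simplex E" "marginal_Y Q' = \<nu>" for Q'
  proof (rule rel_entropy_min_gap[OF _ mprob mpos \<mu>(2)])
    show "marginal_X Q' \<in> prob_simplex"
      using Q' by (auto simp: edge_simplex_def intro: marginal_X_prob)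
    have "(\<Sum>i\<in>UNIV. m $ i * - v $ i) = (\<Sum>j\<in>UNIV. \<nu> $ j * w $ j)"
      using Qvw sum_mult_marginal_X[of Q "\<lambda>i. - v $ i"] sum_mult_marginal_Y[of Q "\<lambda>j. w $ j"]
      by (simp add: m_def Q(2))
    also have "\<dots> = (\<Sum>p\<in>UNIV. Q' $ p * w $ snd p)"
      using sum_mult_marginal_Y[of Q' "\<lambda>j. w $ j"] Q' by simp
    also have "\<dots> \<le> (\<Sum>p\<in>UNIV. Q' $ p * - v $ fst p)"
    proof (rule sum_mono)
      fix p
      show "Q' $ p * w $ snd p \<le> Q' $ p * - v $ fst p"
        using vw[of "fst p" "snd p"] edge_simplexD(1,2)[OF Q'(1), of p]
          mult_left_mono[of "w $ snd p" "- v $ fst p" "Q' $ p"]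
        by (cases "p \<in> E") auto
    qed
    also have "\<dots> = (\<Sum>i\<in>UNIV. marginal_X Q' $ i * - v $ i)"
      by (rule sum_mult_marginal_X)
    finally show "(\<Sum>i\<in>UNIV. m $ i * ln (m $ i / \<mu> $ i))
        \<le> (\<Sum>i\<in>UNIV. marginal_X Q' $ i * ln (m $ i / \<mu> $ i))"
      by (simp add: vm)
  qed
  have m_eq: "mu_star \<mu> \<nu> E = m"
    unfolding mu_star_def
  proof (rule arg_min_eqI)
    show "\<exists>Q\<in>edge_simplex E. marginal_X Q = m \<and> marginal_Y Q = \<nu>"
      using Q by (auto simp: m_def)
  next
    fix m' assume "\<exists>Q\<in>edge_simplex E. marginal_X Q = m' \<and> marginal_Y Q = \<nu>" and "m' \<noteq> m"
    then obtain Q' where Q': "Q' \<in> edge_simplex E" "marginal_X Q' = m'" "marginal_Y Q' = \<nu>" by auto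
    then have "m' \<in> prob_simplex" using marginal_X_prob by (auto simp: edge_simplex_def)
    then show "rel_entropy m \<mu> < rel_entropy m' \<mu>"
      using gap[OF Q'(1,3)] hellinger_zero_iff[of m' m] mpos \<open>m' \<noteq> m\<close> Q'(2)
      by (force simp: prob_simplex_def less_imp_le)
  qed
  define n where "n = (\<chi> j. \<nu> $ j * exp (- w $ j))"
  define P where "P = (\<chi> p. Q $ p * exp (v $ fst p))"
  have P_eq: "P $ p = Q $ p * exp (- w $ snd p)" for p
    using vwQ[of "fst p" "snd p"] Qs(1)[of p]
    by (cases "Q $ p = 0") (auto simp: P_def eq_neg_iff_add_eq_0)
  have PX: "marginal_X P = \<mu>"
  proof -
    have "marginal_X P $ i = m $ i * exp (v $ i)" for i
      by (simp add: marginal_X_def P_def m_def sum_distrib_right)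
    then show ?thesis using mpos \<mu>(2) by (simp add: vec_eq_iff v_def less_imp_neq[symmetric])
  qed
  have PY: "marginal_Y P = n"
    using Q(2) by (auto simp: vec_eq_iff marginal_Y_def P_eq n_def simp flip: sum_distrib_right)
  have PE: "P \<in> edge_simplex E"
    using Qs \<mu>(1) sum_marginal_X[of P]
    by (auto simp: edge_simplex_def prob_simplex_def PX) (auto simp: P_def)
  have npos: "0 < n $ j" for j using \<nu>(2) by (simp add: n_def)
  have nprob: "n \<in> prob_simplex"
    using PE PY marginal_Y_prob[of P] by (auto simp: edge_simplex_def)
  have wn: "ln (n $ j / \<nu> $ j) = - w $ j" for j
    using \<nu>(2)[of j] by (simp add: n_def)
  have n_eq: "nu_star \<mu> \<nu> E = n"
    unfolding nu_star_def
  proof (rule arg_min_eqI)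
    show "\<exists>P\<in>edge_simplex E. marginal_X P = \<mu> \<and> marginal_Y P = n"
      using PE PX PY by auto
  next
    fix n' assume "\<exists>P\<in>edge_simplex E. marginal_X P = \<mu> \<and> marginal_Y P = n'" and "n' \<noteq> n"
    then obtain P' where P': "P' \<in> edge_simplex E" "marginal_X P' = \<mu>" "marginal_Y P' = n'" by auto
    then have n': "n' \<in> prob_simplex" using marginal_Y_prob by (auto simp: edge_simplex_def)
    have "(\<Sum>j\<in>UNIV. n $ j * - w $ j) = (\<Sum>p\<in>UNIV. P $ p * - w $ snd p)"
      using sum_mult_marginal_Y[of P "\<lambda>j. - w $ j"] PY by simp
    also have "\<dots> = (\<Sum>p\<in>UNIV. P $ p * v $ fst p)"
    proof (rule sum.cong[OF refl])
      fix p
      show "P $ p * - w $ snd p = P $ p * v $ fst p"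
        using vwQ[of "fst p" "snd p"] Qs(1)[of p] by (cases "Q $ p = 0") (auto simp: P_def add_eq_0_iff)
    qed
    also have "\<dots> = (\<Sum>i\<in>UNIV. \<mu> $ i * v $ i)"
      using sum_mult_marginal_X[of P "\<lambda>i. v $ i"] PX by simp
    also have "\<dots> = (\<Sum>p\<in>UNIV. P' $ p * v $ fst p)"
      using sum_mult_marginal_X[of P' "\<lambda>i. v $ i"] P' by simp
    also have "\<dots> \<le> (\<Sum>p\<in>UNIV. P' $ p * - w $ snd p)"
    proof (rule sum_mono)
      fix p
      show "P' $ p * v $ fst p \<le> P' $ p * - w $ snd p"
        using vw[of "fst p" "snd p"] edge_simplexD(1,2)[OF P'(1), of p]
          mult_left_mono[of "v $ fst p" "- w $ snd p" "P' $ p"]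
        by (cases "p \<in> E") auto
    qed
    also have "\<dots> = (\<Sum>j\<in>UNIV. n' $ j * - w $ j)"
      using sum_mult_marginal_Y[of P' "\<lambda>j. - w $ j"] P' by simp
    finally have "rel_entropy n \<nu> + (\<Sum>j\<in>UNIV. (sqrt (n' $ j) - sqrt (n $ j))\<^sup>2) \<le> rel_entropy n' \<nu>"
      by (intro rel_entropy_min_gap n' nprob npos \<nu>(2)) (simp add: wn)
    then show "rel_entropy n \<nu> < rel_entropy n' \<nu>"
      using hellinger_zero_iff[of n' n] npos \<open>n' \<noteq> n\<close> n'
      by (force simp: prob_simplex_def less_imp_le)
  qed
  have v_eq: "v_star \<mu> \<nu> E = v" by (simp add: v_star_def m_eq v_def)
  have w_eq: "w_star \<mu> \<nu> E = w"
    using \<nu>(2) by (auto simp: w_star_def n_eq vec_eq_iff n_def exp_minus inverse_eq_divide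
        less_imp_neq[symmetric])
  show ?thesis
    by (rule that[of Q]) (use Q mpos vw vwQ gap in \<open>auto simp: m_eq n_eq v_eq w_eq m_def[symmetric] n_def\<close>)
qed

section \<open>Approximate matrix scaling\<close>

text \<open>The diagonal scaling of the restriction of \<open>K\<close> to \<open>E\<close>.\<close>

definition scaled_kernel ::
  "('m::finite \<times> 'n::finite) set \<Rightarrow> real ^ ('m \<times> 'n) \<Rightarrow> real ^ 'm \<Rightarrow> real ^ 'n \<Rightarrow> real ^ ('m \<times> 'n)" where
  "scaled_kernel E K \<phi> \<psi> = (\<chi> p. if p \<in> E then exp (\<phi> $ fst p + \<psi> $ snd p) * K $ p else 0)"

text \<open>The expression is the increment of the functional minimized in \<open>approximate_scaling\<close> along a
  coordinate direction; it vanishes at \<open>t = 0\<close>, so its derivative does.\<close>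

lemma stationary_of_nonneg:
  fixes a b c \<eta> :: real
  assumes "\<And>t. 0 \<le> (exp t - 1) * a - t * b + \<eta> * (2 * t * c + t\<^sup>2)"
  shows "a - b = - (2 * \<eta> * c)"
proof -
  have "((\<lambda>t. (exp t - 1) * a - t * b + \<eta> * (2 * t * c + t\<^sup>2)) has_real_derivative
      (a - b + 2 * \<eta> * c)) (at 0)"
    by (auto intro!: derivative_eq_intros simp: algebra_simps)
  then have "a - b + 2 * \<eta> * c = 0"
    by (rule DERIV_local_min[where d = 1]) (use assms in auto)
  then show ?thesis by simp
qed

lemma norm_add_axis_power2:
  fixes x :: "real ^ 'i::finite"
  shows "(norm (x + t *\<^sub>R axis i 1))\<^sup>2 = (norm x)\<^sup>2 + (2 * t * x $ i + t\<^sup>2)"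
  unfolding power2_norm_eq_inner
  by (simp add: inner_add_left inner_add_right inner_commute[of "axis i 1" x] inner_axis
      power2_eq_square algebra_simps)

lemma sum_mult_add_axis:
  fixes q x :: "real ^ 'i::finite"
  shows "(\<Sum>a\<in>UNIV. q $ a * (x + t *\<^sub>R axis i 1) $ a) = (\<Sum>a\<in>UNIV. q $ a * x $ a) + t * q $ i"
proof -
  have "q $ a * (x + t *\<^sub>R axis i 1) $ a = q $ a * x $ a + (if a = i then t * q $ i else 0)" for a
    by (simp add: axis_def algebra_simps)
  then show ?thesis by (simp add: sum.distrib)
qed

lemma sum_scaled_kernel_shift_X:
  "(\<Sum>p\<in>UNIV. scaled_kernel E K (\<phi> + t *\<^sub>R axis i 1) \<psi> $ p)
    = (\<Sum>p\<in>UNIV. scaled_kernel E K \<phi> \<psi> $ p) + (exp t - 1) * marginal_X (scaled_kernel E K \<phi> \<psi>) $ i"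
proof -
  let ?R = "scaled_kernel E K \<phi> \<psi>"
  have "scaled_kernel E K (\<phi> + t *\<^sub>R axis i 1) \<psi> $ p
      = ?R $ p + ?R $ p * (if fst p = i then exp t - 1 else 0)" for p
    by (simp add: scaled_kernel_def axis_def exp_add algebra_simps)
  moreover have "(\<Sum>p\<in>UNIV. ?R $ p * (if fst p = i then exp t - 1 else 0))
      = (exp t - 1) * marginal_X ?R $ i"
    using sum_mult_marginal_X[of ?R "\<lambda>a. if a = i then exp t - 1 else 0"]
    by (simp add: if_distrib mult.commute cong: if_cong)
  ultimately show ?thesis by (simp only: sum.distrib)
qed

lemma sum_scaled_kernel_shift_Y:
  "(\<Sum>p\<in>UNIV. scaled_kernel E K \<phi> (\<psi> + t *\<^sub>R axis j 1) $ p)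
    = (\<Sum>p\<in>UNIV. scaled_kernel E K \<phi> \<psi> $ p) + (exp t - 1) * marginal_Y (scaled_kernel E K \<phi> \<psi>) $ j"
proof -
  let ?R = "scaled_kernel E K \<phi> \<psi>"
  have "scaled_kernel E K \<phi> (\<psi> + t *\<^sub>R axis j 1) $ p
      = ?R $ p + ?R $ p * (if snd p = j then exp t - 1 else 0)" for p
    by (simp add: scaled_kernel_def axis_def exp_add algebra_simps)
  moreover have "(\<Sum>p\<in>UNIV. ?R $ p * (if snd p = j then exp t - 1 else 0))
      = (exp t - 1) * marginal_Y ?R $ j"
    using sum_mult_marginal_Y[of ?R "\<lambda>a. if a = j then exp t - 1 else 0"]
    by (simp add: if_distrib mult.commute cong: if_cong)
  ultimately show ?thesis by (simp only: sum.distrib)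
qed

text \<open>The dual functional of the scaling problem, the total mass of the scaled kernel minus
  \<open>\<Sum>X\<^sub>i \<phi>\<^sub>i + \<Sum>Y\<^sub>j \<psi>\<^sub>j\<close> for the marginals \<open>(X, Y)\<close> of \<open>Q\<close>, is bounded below because \<open>Q\<close> lives
  on \<open>E\<close>. When \<open>Q\<close> vanishes on part of \<open>E\<close> its infimum need not be attained, so a small
  quadratic penalty \<open>\<eta>\<close> is added. The error of the marginals at the minimizer is the gradient
  of the penalty, which is of order \<open>sqrt \<eta>\<close>.\<close>

lemma approximate_scaling:
  fixes Q K :: "real ^ ('m::finite \<times> 'n::finite)"
  assumes Q: "\<And>p. 0 \<le> Q $ p" "\<And>p. p \<notin> E \<Longrightarrow> Q $ p = 0" and K: "\<And>p. 0 < K $ p" and \<epsilon>: "0 < \<epsilon>"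
  obtains \<phi> \<psi> where
    "\<And>i. \<bar>marginal_X (scaled_kernel E K \<phi> \<psi>) $ i - marginal_X Q $ i\<bar> \<le> \<epsilon>"
    "\<And>j. \<bar>marginal_Y (scaled_kernel E K \<phi> \<psi>) $ j - marginal_Y Q $ j\<bar> \<le> \<epsilon>"
proof -
  define S where "S \<phi> \<psi> = (\<Sum>p\<in>UNIV. scaled_kernel E K \<phi> \<psi> $ p)" for \<phi> \<psi>
  define B where "B = (\<Sum>p\<in>UNIV. \<bar>Q $ p - Q $ p * ln (Q $ p / K $ p)\<bar>)"
  \<comment> \<open>An upper bound for \<open>\<eta> |x|\<^sup>2\<close> at the minimizer that does not depend on \<open>\<eta>\<close>.\<close>
  define Z where "Z = S 0 0 + B"
  have Z: "0 \<le> Z"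
    using K by (auto simp: Z_def S_def B_def scaled_kernel_def less_imp_le intro!: add_nonneg_nonneg sum_nonneg)
  define \<eta> where "\<eta> = \<epsilon>\<^sup>2 / (4 * (Z + 1))"
  have \<eta>: "0 < \<eta>" "4 * \<eta> * Z \<le> \<epsilon>\<^sup>2"
    using Z \<epsilon> by (auto simp: \<eta>_def field_simps)
  define J where "J x = S (fst x) (snd x) - (\<Sum>i\<in>UNIV. marginal_X Q $ i * fst x $ i)
    - (\<Sum>j\<in>UNIV. marginal_Y Q $ j * snd x $ j) + \<eta> * ((norm (fst x))\<^sup>2 + (norm (snd x))\<^sup>2)" for x
  have J_ge: "\<eta> * (norm x)\<^sup>2 - B \<le> J x" for x
  proof -
    obtain \<phi> \<psi> where x: "x = (\<phi>, \<psi>)" by (cases x)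
    have "- B \<le> (\<Sum>p\<in>UNIV. scaled_kernel E K \<phi> \<psi> $ p - Q $ p * \<phi> $ fst p - Q $ p * \<psi> $ snd p)"
      unfolding B_def sum_negf[symmetric]
    proof (rule sum_mono)
      fix p
      show "- \<bar>Q $ p - Q $ p * ln (Q $ p / K $ p)\<bar>
        \<le> scaled_kernel E K \<phi> \<psi> $ p - Q $ p * \<phi> $ fst p - Q $ p * \<psi> $ snd p"
      proof (cases "Q $ p = 0")
        case True
        then show ?thesis using K[of p] by (simp add: scaled_kernel_def)
      next
        case False
        then have p: "p \<in> E" "0 < Q $ p" using Q(1)[of p] Q(2)[of p] by auto
        let ?r = "exp (\<phi> $ fst p + \<psi> $ snd p) * K $ p"
        have "Q $ p - ?r \<le> Q $ p * ln (Q $ p / ?r)"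
          using p K by (intro entropy_summand_ge_diff) auto
        also have "ln (Q $ p / ?r) = ln (Q $ p / K $ p) - (\<phi> $ fst p + \<psi> $ snd p)"
          using p K[of p] by (simp add: ln_div ln_mult)
        finally show ?thesis using p by (simp add: scaled_kernel_def algebra_simps)
      qed
    qed
    also have "\<dots> = S \<phi> \<psi> - (\<Sum>i\<in>UNIV. marginal_X Q $ i * \<phi> $ i) - (\<Sum>j\<in>UNIV. marginal_Y Q $ j * \<psi> $ j)"
      by (simp add: sum_subtractf S_def sum_mult_marginal_X[of Q "\<lambda>i. \<phi> $ i"]
          sum_mult_marginal_Y[of Q "\<lambda>j. \<psi> $ j"])
    finally show ?thesis by (simp add: J_def x norm_prod_def)
  qed
  have J0: "J 0 = S 0 0" by (simp add: J_def)
  obtain x where x: "\<And>y. J x \<le> J y"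
  proof -
    define r where "r = sqrt (Z / \<eta>)"
    have r: "0 \<le> r" "\<eta> * r\<^sup>2 = Z" using Z \<eta> by (auto simp: r_def)
    have "continuous_on (cball 0 r) (\<lambda>x. scaled_kernel E K (fst x) (snd x) $ p)" for p
      by (cases "p \<in> E") (auto simp: scaled_kernel_def intro!: continuous_intros)
    then have "continuous_on (cball 0 r) (\<lambda>x. S (fst x) (snd x))"
      unfolding S_def by (rule continuous_on_sum)
    then have "continuous_on (cball 0 r) J"
      unfolding J_def by (intro continuous_intros)
    then obtain x where x: "\<forall>y\<in>cball 0 r. J x \<le> J y"
      using continuous_attains_inf[of "cball 0 r" J] r by auto
    have "J x \<le> J y" if "r < norm y" for y
    proof -
      have "J x \<le> S 0 0" using x r by (auto simp flip: J0)
      moreover have "\<eta> * r\<^sup>2 \<le> \<eta> * (norm y)\<^sup>2" using that r \<eta> by (intro mult_left_mono power_mono) auto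
      ultimately show ?thesis using J_ge[of y] r by (simp add: Z_def)
    qed
    then show ?thesis using x by (intro that[of x]) (meson mem_cball_0 not_less)
  qed
  obtain \<phi> \<psi> where x_eq: "x = (\<phi>, \<psi>)" by (cases x)
  have small: "\<bar>2 * \<eta> * c\<bar> \<le> \<epsilon>" if "\<bar>c\<bar> \<le> norm x" for c
  proof -
    have "c\<^sup>2 \<le> (norm x)\<^sup>2" using that by (metis abs_ge_zero power2_abs power_mono)
    have "(2 * \<eta> * c)\<^sup>2 = 4 * \<eta> * (\<eta> * c\<^sup>2)" by (simp add: power2_eq_square)
    also have "\<dots> \<le> 4 * \<eta> * (\<eta> * (norm x)\<^sup>2)"
      using \<open>c\<^sup>2 \<le> (norm x)\<^sup>2\<close> \<eta> by (intro mult_left_mono) auto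
    also have "\<dots> \<le> 4 * \<eta> * Z"
      using J_ge[of x] x[of 0] J0 \<eta> by (intro mult_left_mono) (auto simp: Z_def)
    also have "\<dots> \<le> \<epsilon>\<^sup>2" by (rule \<eta>)
    finally show ?thesis using \<epsilon> by (simp add: abs_le_square_iff[symmetric])
  qed
  show ?thesis
  proof (rule that[of \<phi> \<psi>])
    fix i
    have "0 \<le> (exp t - 1) * marginal_X (scaled_kernel E K \<phi> \<psi>) $ i - t * marginal_X Q $ i
        + \<eta> * (2 * t * \<phi> $ i + t\<^sup>2)" for t
    proof -
      have "(\<Sum>a\<in>UNIV. marginal_X Q $ a * (\<phi> + t *\<^sub>R axis i 1) $ a)
        = (\<Sum>a\<in>UNIV. marginal_X Q $ a * \<phi> $ a) + t * marginal_X Q $ i"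
        by (rule sum_mult_add_axis)
      then show ?thesis
        using x[of "(\<phi> + t *\<^sub>R axis i 1, \<psi>)"]
        unfolding x_eq J_def S_def fst_conv snd_conv sum_scaled_kernel_shift_X norm_add_axis_power2
        by (simp add: algebra_simps)
    qed
    then have "marginal_X (scaled_kernel E K \<phi> \<psi>) $ i - marginal_X Q $ i = - (2 * \<eta> * \<phi> $ i)"
      by (rule stationary_of_nonneg)
    moreover have "\<bar>\<phi> $ i\<bar> \<le> norm x"
      using component_le_norm_cart[of \<phi> i] norm_fst_le[of \<phi> \<psi>] by (simp add: x_eq)
    ultimately show "\<bar>marginal_X (scaled_kernel E K \<phi> \<psi>) $ i - marginal_X Q $ i\<bar> \<le> \<epsilon>"
      using small by simp
  next
    fix j
    have "0 \<le> (exp t - 1) * marginal_Y (scaled_kernel E K \<phi> \<psi>) $ j - t * marginal_Y Q $ j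
        + \<eta> * (2 * t * \<psi> $ j + t\<^sup>2)" for t
    proof -
      have "(\<Sum>a\<in>UNIV. marginal_Y Q $ a * (\<psi> + t *\<^sub>R axis j 1) $ a)
        = (\<Sum>a\<in>UNIV. marginal_Y Q $ a * \<psi> $ a) + t * marginal_Y Q $ j"
        by (rule sum_mult_add_axis)
      then show ?thesis
        using x[of "(\<phi>, \<psi> + t *\<^sub>R axis j 1)"]
        unfolding x_eq J_def S_def fst_conv snd_conv sum_scaled_kernel_shift_Y norm_add_axis_power2
        by (simp add: algebra_simps)
    qed
    then have "marginal_Y (scaled_kernel E K \<phi> \<psi>) $ j - marginal_Y Q $ j = - (2 * \<eta> * \<psi> $ j)"
      by (rule stationary_of_nonneg)
    moreover have "\<bar>\<psi> $ j\<bar> \<le> norm x"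
      using component_le_norm_cart[of \<psi> j] norm_snd_le[of \<psi> \<phi>] by (simp add: x_eq)
    ultimately show "\<bar>marginal_Y (scaled_kernel E K \<phi> \<psi>) $ j - marginal_Y Q $ j\<bar> \<le> \<epsilon>"
      using small by simp
  qed
qed

section \<open>Sinkhorn iterates\<close>

text \<open>Two applications of data processing to consecutive plans. Rescaling rows costs
  \<open>H(P|P') = H(X P|\<mu>)\<close> and dominates the divergence of the column marginals; this one equals
  \<open>H(P''|P')\<close>, which dominates the divergence of the row marginals.\<close>

lemma sinkhorn_entropy_decrease:
  fixes P P' P'' :: "real ^ ('m::finite \<times> 'n::finite)"
  assumes P: "\<And>p. 0 < P $ p" and \<mu>: "\<And>i. 0 < \<mu> $ i" and \<nu>: "\<And>j. 0 < \<nu> $ j"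
    and Y: "marginal_Y P = \<nu>"
    and P': "\<And>i j. P' $ (i, j) = P $ (i, j) * (\<mu> $ i / marginal_X P $ i)"
    and P'': "\<And>i j. P'' $ (i, j) = P' $ (i, j) * (\<nu> $ j / marginal_Y P' $ j)"
  shows "rel_entropy (marginal_X P'') \<mu> \<le> rel_entropy (marginal_X P) \<mu>"
proof -
  have XP: "0 < marginal_X P $ i" for i using P by (rule marginal_X_pos)
  have P'pos: "0 < P' $ p" for p using P'[of "fst p" "snd p"] P XP \<mu> by simp
  have YP': "0 < marginal_Y P' $ j" for j using P'pos by (rule marginal_Y_pos)
  have P''pos: "0 < P'' $ p" for p using P''[of "fst p" "snd p"] P'pos YP' \<nu> by simp
  have XP': "marginal_X P' = \<mu>"
    using XP by (simp add: vec_eq_iff marginal_X_def P' sum_pos less_imp_neq[symmetric]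
        flip: sum_distrib_right sum_divide_distrib)
  have YP'': "marginal_Y P'' = \<nu>"
    using YP' by (simp add: vec_eq_iff marginal_Y_def P'' sum_pos less_imp_neq[symmetric]
        flip: sum_distrib_right sum_divide_distrib)
  have "rel_entropy (marginal_X P'') \<mu> \<le> rel_entropy P'' P'"
    using rel_entropy_marginal_X_le[of P'' P'] P''pos P'pos XP' by (simp add: less_imp_le)
  also have "\<dots> = (\<Sum>p\<in>UNIV. P'' $ p * ln (\<nu> $ snd p / marginal_Y P' $ snd p))"
    unfolding rel_entropy_def
  proof (rule sum.cong[OF refl])
    fix p
    show "P'' $ p * ln (P'' $ p / P' $ p) = P'' $ p * ln (\<nu> $ snd p / marginal_Y P' $ snd p)"
      using P''[of "fst p" "snd p"] P'pos[of p] by simp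
  qed
  also have "\<dots> = rel_entropy \<nu> (marginal_Y P')"
    using sum_mult_marginal_Y[of P'' "\<lambda>j. ln (\<nu> $ j / marginal_Y P' $ j)"]
    by (simp add: rel_entropy_def YP'')
  also have "\<dots> \<le> rel_entropy P P'"
    using rel_entropy_marginal_Y_le[of P P'] P P'pos Y by (simp add: less_imp_le)
  also have "\<dots> = (\<Sum>p\<in>UNIV. P $ p * ln (marginal_X P $ fst p / \<mu> $ fst p))"
    unfolding rel_entropy_def
  proof (rule sum.cong[OF refl])
    fix p
    show "P $ p * ln (P $ p / P' $ p) = P $ p * ln (marginal_X P $ fst p / \<mu> $ fst p)"
      using P'[of "fst p" "snd p"] P[of p] by simp
  qed
  also have "\<dots> = rel_entropy (marginal_X P) \<mu>"
    using sum_mult_marginal_X[of P "\<lambda>i. ln (marginal_X P $ i / \<mu> $ i)"]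
    by (simp add: rel_entropy_def)
  finally show ?thesis .
qed

locale sinkhorn =
  fixes \<mu> :: "real ^ 'm::finite" and \<nu> :: "real ^ 'n::finite" and C :: "real ^ ('m \<times> 'n)"
  assumes \<mu>_prob: "\<mu> \<in> prob_simplex" and \<mu>_pos: "0 < \<mu> $ i"
    and \<nu>_prob: "\<nu> \<in> prob_simplex" and \<nu>_pos: "0 < \<nu> $ j"
begin

text \<open>At a pair of dual iterates this is the primal iterate; it is used for other potentials as well.\<close>

definition gibbs :: "real \<Rightarrow> real ^ 'm \<Rightarrow> real ^ 'n \<Rightarrow> real ^ ('m \<times> 'n)" where
  "gibbs \<tau> f g = (\<chi> p. exp ((- C $ p + f $ fst p + g $ snd p) / \<tau>) * \<mu> $ fst p * \<nu> $ snd p)"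

abbreviation "Fr \<equiv> f_reg \<mu> \<nu> C"
abbreviation "Gr \<equiv> g_reg \<mu> \<nu> C"

text \<open>The row potential after step \<open>2 k + 1\<close>, hence also after step \<open>2 k + 2\<close>.\<close>

primrec row_potential :: "real \<Rightarrow> real ^ 'n \<Rightarrow> nat \<Rightarrow> real ^ 'm" where
  "row_potential \<tau> g0 0 = Fr \<tau> g0"
| "row_potential \<tau> g0 (Suc k) = Fr \<tau> (Gr \<tau> (row_potential \<tau> g0 k))"

lemma gibbs_pos: "0 < gibbs \<tau> f g $ p"
  by (simp add: gibbs_def \<mu>_pos \<nu>_pos)

lemma marginal_gibbs_pos: "0 < marginal_X (gibbs \<tau> f g) $ i" "0 < marginal_Y (gibbs \<tau> f g) $ j"
  by (intro marginal_X_pos marginal_Y_pos gibbs_pos)+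

text \<open>The potential \<open>g\<close> on the right is arbitrary: a Sinkhorn update corrects any guess by the mismatch of
  its marginal. Taking \<open>g\<close> to be the previous iterate gives the increments of the algorithm, taking it
  to be a trial solution gives the consistency error.\<close>

lemma g_reg_eq:
  assumes "0 < \<tau>"
  shows "Gr \<tau> f $ j = g $ j - \<tau> * ln (marginal_Y (gibbs \<tau> f g) $ j / \<nu> $ j)"
proof -
  define S where "S = (\<Sum>i\<in>UNIV. exp ((- C $ (i, j) + f $ i) / \<tau>) * \<mu> $ i)"
  have S: "0 < S" unfolding S_def by (intro sum_pos) (auto simp: \<mu>_pos)
  have "exp ((- C $ (i, j) + f $ i + g $ j) / \<tau>) = exp (g $ j / \<tau>) * exp ((- C $ (i, j) + f $ i) / \<tau>)" for i
    using assms by (simp add: field_simps flip: exp_add)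
  then have "marginal_Y (gibbs \<tau> f g) $ j = exp (g $ j / \<tau>) * \<nu> $ j * S"
    by (simp add: marginal_Y_def gibbs_def S_def sum_distrib_left mult_ac)
  then have "ln (marginal_Y (gibbs \<tau> f g) $ j / \<nu> $ j) = g $ j / \<tau> + ln S"
    using S \<nu>_pos[of j] by (simp add: ln_mult)
  moreover have "Gr \<tau> f $ j = - \<tau> * ln S" by (simp only: g_reg_def S_def vec_lambda_beta)
  ultimately show ?thesis using assms by (simp add: algebra_simps)
qed

lemma f_reg_eq:
  assumes "0 < \<tau>"
  shows "Fr \<tau> g $ i = f $ i - \<tau> * ln (marginal_X (gibbs \<tau> f g) $ i / \<mu> $ i)"
proof -
  define S where "S = (\<Sum>j\<in>UNIV. exp ((- C $ (i, j) + g $ j) / \<tau>) * \<nu> $ j)"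
  have S: "0 < S" unfolding S_def by (intro sum_pos) (auto simp: \<nu>_pos)
  have "exp ((- C $ (i, j) + f $ i + g $ j) / \<tau>) = exp (f $ i / \<tau>) * exp ((- C $ (i, j) + g $ j) / \<tau>)" for j
    using assms by (simp add: field_simps flip: exp_add)
  then have "marginal_X (gibbs \<tau> f g) $ i = exp (f $ i / \<tau>) * \<mu> $ i * S"
    by (simp add: marginal_X_def gibbs_def S_def sum_distrib_left mult_ac)
  then have "ln (marginal_X (gibbs \<tau> f g) $ i / \<mu> $ i) = f $ i / \<tau> + ln S"
    using S \<mu>_pos[of i] by (simp add: ln_mult)
  moreover have "Fr \<tau> g $ i = - \<tau> * ln S" by (simp only: f_reg_def S_def vec_lambda_beta)
  ultimately show ?thesis using assms by (simp add: algebra_simps)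
qed

lemma gibbs_g_reg:
  assumes "0 < \<tau>"
  shows "gibbs \<tau> f (Gr \<tau> f) $ (i, j) = gibbs \<tau> f g $ (i, j) * (\<nu> $ j / marginal_Y (gibbs \<tau> f g) $ j)"
proof -
  have "(- C $ (i, j) + f $ i + Gr \<tau> f $ j) / \<tau>
      = (- C $ (i, j) + f $ i + g $ j) / \<tau> - ln (marginal_Y (gibbs \<tau> f g) $ j / \<nu> $ j)"
    using assms by (simp add: g_reg_eq[OF assms, of f j g] field_simps)
  then show ?thesis
    using marginal_gibbs_pos(2)[of \<tau> f g j] \<nu>_pos[of j] by (simp add: gibbs_def[of _ f] exp_diff)
qed

lemma gibbs_f_reg:
  assumes "0 < \<tau>"
  shows "gibbs \<tau> (Fr \<tau> g) g $ (i, j) = gibbs \<tau> f g $ (i, j) * (\<mu> $ i / marginal_X (gibbs \<tau> f g) $ i)"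
proof -
  have "(- C $ (i, j) + Fr \<tau> g $ i + g $ j) / \<tau>
      = (- C $ (i, j) + f $ i + g $ j) / \<tau> - ln (marginal_X (gibbs \<tau> f g) $ i / \<mu> $ i)"
    using assms by (simp add: f_reg_eq[OF assms, of g i f] field_simps)
  then show ?thesis
    using marginal_gibbs_pos(1)[of \<tau> f g i] \<mu>_pos[of i] by (simp add: gibbs_def[of _ _ g] exp_diff)
qed

lemma marginal_Y_gibbs_g_reg:
  assumes "0 < \<tau>"
  shows "marginal_Y (gibbs \<tau> f (Gr \<tau> f)) = \<nu>"
proof -
  have "marginal_Y (gibbs \<tau> f (Gr \<tau> f)) $ j
      = marginal_Y (gibbs \<tau> f 0) $ j * (\<nu> $ j / marginal_Y (gibbs \<tau> f 0) $ j)" for j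
    unfolding marginal_Y_def[of "gibbs \<tau> f (Gr \<tau> f)"] vec_lambda_beta gibbs_g_reg[OF assms, of f _ _ 0]
      sum_distrib_right[symmetric]
    by (simp add: marginal_Y_def)
  then show ?thesis using marginal_gibbs_pos(2)[of \<tau> f 0] by (simp add: vec_eq_iff less_imp_neq[symmetric])
qed

lemma marginal_X_gibbs_f_reg:
  assumes "0 < \<tau>"
  shows "marginal_X (gibbs \<tau> (Fr \<tau> g) g) = \<mu>"
proof -
  have "marginal_X (gibbs \<tau> (Fr \<tau> g) g) $ i
      = marginal_X (gibbs \<tau> 0 g) $ i * (\<mu> $ i / marginal_X (gibbs \<tau> 0 g) $ i)" for i
    unfolding marginal_X_def[of "gibbs \<tau> (Fr \<tau> g) g"] vec_lambda_beta gibbs_f_reg[OF assms, of g _ _ 0]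
      sum_distrib_right[symmetric]
    by (simp add: marginal_X_def)
  then show ?thesis using marginal_gibbs_pos(1)[of \<tau> 0 g] by (simp add: vec_eq_iff less_imp_neq[symmetric])
qed

lemma g_reg_antimono:
  assumes \<tau>: "0 < \<tau>" and le: "\<And>i. f $ i \<le> f' $ i + c"
  shows "Gr \<tau> f' $ j \<le> Gr \<tau> f $ j + c"
proof -
  define S where "S f = (\<Sum>i\<in>UNIV. exp ((- C $ (i, j) + f $ i) / \<tau>) * \<mu> $ i)" for f :: "real ^ 'm"
  have S: "0 < S f" for f unfolding S_def by (intro sum_pos) (auto simp: \<mu>_pos)
  have "S f \<le> (\<Sum>i\<in>UNIV. exp (c / \<tau> + (- C $ (i, j) + f' $ i) / \<tau>) * \<mu> $ i)"
    unfolding S_def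
  proof (intro sum_mono mult_right_mono)
    fix i
    show "exp ((- C $ (i, j) + f $ i) / \<tau>) \<le> exp (c / \<tau> + (- C $ (i, j) + f' $ i) / \<tau>)"
      using \<tau> le[of i] by (simp add: field_simps)
  qed (simp add: \<mu>_pos less_imp_le)
  also have "\<dots> = exp (c / \<tau>) * S f'"
    by (simp add: S_def exp_add sum_distrib_left mult.assoc)
  finally have "ln (S f) \<le> ln (exp (c / \<tau>) * S f')" using S by simp
  also have "\<dots> = c / \<tau> + ln (S f')" using S[of f'] by (simp add: ln_mult)
  finally have "\<tau> * ln (S f) \<le> \<tau> * (c / \<tau> + ln (S f'))" using \<tau> by simp
  moreover have "Gr \<tau> f $ j = - \<tau> * ln (S f)" for f by (simp only: g_reg_def S_def vec_lambda_beta)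
  ultimately show ?thesis using \<tau> by (simp add: algebra_simps)
qed

lemma f_reg_antimono:
  assumes \<tau>: "0 < \<tau>" and le: "\<And>j. g $ j \<le> g' $ j + c"
  shows "Fr \<tau> g' $ i \<le> Fr \<tau> g $ i + c"
proof -
  define S where "S g = (\<Sum>j\<in>UNIV. exp ((- C $ (i, j) + g $ j) / \<tau>) * \<nu> $ j)" for g :: "real ^ 'n"
  have S: "0 < S g" for g unfolding S_def by (intro sum_pos) (auto simp: \<nu>_pos)
  have "S g \<le> (\<Sum>j\<in>UNIV. exp (c / \<tau> + (- C $ (i, j) + g' $ j) / \<tau>) * \<nu> $ j)"
    unfolding S_def
  proof (intro sum_mono mult_right_mono)
    fix j
    show "exp ((- C $ (i, j) + g $ j) / \<tau>) \<le> exp (c / \<tau> + (- C $ (i, j) + g' $ j) / \<tau>)"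
      using \<tau> le[of j] by (simp add: field_simps)
  qed (simp add: \<nu>_pos less_imp_le)
  also have "\<dots> = exp (c / \<tau>) * S g'"
    by (simp add: S_def exp_add sum_distrib_left mult.assoc)
  finally have "ln (S g) \<le> ln (exp (c / \<tau>) * S g')" using S by simp
  also have "\<dots> = c / \<tau> + ln (S g')" using S[of g'] by (simp add: ln_mult)
  finally have "\<tau> * ln (S g) \<le> \<tau> * (c / \<tau> + ln (S g'))" using \<tau> by simp
  moreover have "Fr \<tau> g $ i = - \<tau> * ln (S g)" for g by (simp only: f_reg_def S_def vec_lambda_beta)
  ultimately show ?thesis using \<tau> by (simp add: algebra_simps)
qed

text \<open>An order-reversing map that turns the addition of a constant into its subtraction does not increase
  the sup norm.\<close>

lemma g_reg_nonexpansive: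
  assumes "0 < \<tau>" "\<And>i. \<bar>f $ i - f' $ i\<bar> \<le> c"
  shows "\<bar>Gr \<tau> f $ j - Gr \<tau> f' $ j\<bar> \<le> c"
proof -
  have "f $ i \<le> f' $ i + c" "f' $ i \<le> f $ i + c" for i using assms(2)[of i] by (auto simp: abs_le_iff)
  then have "Gr \<tau> f' $ j \<le> Gr \<tau> f $ j + c" "Gr \<tau> f $ j \<le> Gr \<tau> f' $ j + c"
    using g_reg_antimono[OF assms(1)] by blast+
  then show ?thesis by (simp add: abs_le_iff)
qed

lemma f_reg_nonexpansive:
  assumes "0 < \<tau>" "\<And>j. \<bar>g $ j - g' $ j\<bar> \<le> c"
  shows "\<bar>Fr \<tau> g $ i - Fr \<tau> g' $ i\<bar> \<le> c"
proof -
  have "g $ j \<le> g' $ j + c" "g' $ j \<le> g $ j + c" for j using assms(2)[of j] by (auto simp: abs_le_iff)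
  then have "Fr \<tau> g' $ i \<le> Fr \<tau> g $ i + c" "Fr \<tau> g $ i \<le> Fr \<tau> g' $ i + c"
    using f_reg_antimono[OF assms(1)] by blast+
  then show ?thesis by (simp add: abs_le_iff)
qed

lemma sinkhorn_dual_even:
  "sinkhorn_dual \<mu> \<nu> C \<tau> f0 g0 (2 * k + 2) = (row_potential \<tau> g0 k, Gr \<tau> (row_potential \<tau> g0 k))"
proof (induction k)
  case 0
  have "(2::nat) * 0 + 2 = Suc (Suc 0)" by simp
  then show ?case by (simp only: sinkhorn_dual.simps row_potential.simps) simp
next
  case (Suc k)
  have "2 * Suc k + 2 = Suc (Suc (2 * k + 2))" by simp
  then show ?case by (simp only: sinkhorn_dual.simps row_potential.simps Suc.IH) simp
qed

lemma sinkhorn_primal_even: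
  "sinkhorn_primal \<mu> \<nu> C \<tau> f0 g0 (2 * k + 2)
    = gibbs \<tau> (row_potential \<tau> g0 k) (Gr \<tau> (row_potential \<tau> g0 k))"
  unfolding sinkhorn_primal_def sinkhorn_dual_even by (simp add: gibbs_def)

lemma sinkhorn_primal_odd:
  "sinkhorn_primal \<mu> \<nu> C \<tau> f0 g0 (2 * k + 3)
    = gibbs \<tau> (row_potential \<tau> g0 (Suc k)) (Gr \<tau> (row_potential \<tau> g0 k))"
proof -
  have eq: "2 * k + 3 = Suc (2 * k + 2)" by simp
  have "sinkhorn_dual \<mu> \<nu> C \<tau> f0 g0 (2 * k + 3)
      = (row_potential \<tau> g0 (Suc k), Gr \<tau> (row_potential \<tau> g0 k))"
    unfolding eq sinkhorn_dual.simps sinkhorn_dual_even by simp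
  then show ?thesis by (simp add: sinkhorn_primal_def gibbs_def)
qed

abbreviation even_plan :: "real \<Rightarrow> real ^ 'n \<Rightarrow> nat \<Rightarrow> real ^ ('m \<times> 'n)" where
  "even_plan \<tau> g0 k \<equiv> gibbs \<tau> (row_potential \<tau> g0 k) (Gr \<tau> (row_potential \<tau> g0 k))"

abbreviation odd_plan :: "real \<Rightarrow> real ^ 'n \<Rightarrow> nat \<Rightarrow> real ^ ('m \<times> 'n)" where
  "odd_plan \<tau> g0 k \<equiv> gibbs \<tau> (row_potential \<tau> g0 (Suc k)) (Gr \<tau> (row_potential \<tau> g0 k))"

lemma even_plan_prob: "0 < \<tau> \<Longrightarrow> even_plan \<tau> g0 k \<in> prob_simplex"
  using sum_marginal_Y[of "even_plan \<tau> g0 k"] \<nu>_prob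
  by (simp add: prob_simplex_def marginal_Y_gibbs_g_reg gibbs_pos less_imp_le)

lemma odd_plan_prob: "0 < \<tau> \<Longrightarrow> odd_plan \<tau> g0 k \<in> prob_simplex"
  using sum_marginal_X[of "odd_plan \<tau> g0 k"] \<mu>_prob
  by (simp add: prob_simplex_def marginal_X_gibbs_f_reg gibbs_pos less_imp_le)

lemma row_potential_Suc:
  assumes "0 < \<tau>"
  shows "row_potential \<tau> g0 (Suc k) $ i
    = row_potential \<tau> g0 k $ i - \<tau> * ln (marginal_X (even_plan \<tau> g0 k) $ i / \<mu> $ i)"
  by (simp add: f_reg_eq[OF assms, of _ i "row_potential \<tau> g0 k"])

lemma odd_plan_eq:
  assumes "0 < \<tau>"
  shows "odd_plan \<tau> g0 k $ (i, j) = even_plan \<tau> g0 k $ (i, j) * (\<mu> $ i / marginal_X (even_plan \<tau> g0 k) $ i)"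
  using gibbs_f_reg[OF assms] by simp

text \<open>The main monotone quantity of the algorithm; it transports information on the row marginal from some
  unspecified earlier step of a phase to the step of interest.\<close>

lemma row_entropy_antimono:
  assumes "0 < \<tau>" "k \<le> l"
  shows "rel_entropy (marginal_X (even_plan \<tau> g0 l)) \<mu> \<le> rel_entropy (marginal_X (even_plan \<tau> g0 k)) \<mu>"
  using assms(2)
proof (induction rule: dec_induct)
  case (step l)
  have "rel_entropy (marginal_X (even_plan \<tau> g0 (Suc l))) \<mu> \<le> rel_entropy (marginal_X (even_plan \<tau> g0 l)) \<mu>"
    by (rule sinkhorn_entropy_decrease[OF gibbs_pos \<mu>_pos \<nu>_pos marginal_Y_gibbs_g_reg[OF assms(1)]
          odd_plan_eq[OF assms(1)] gibbs_g_reg[OF assms(1)]])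
  then show ?case using step by simp
qed simp

text \<open>An upper bound for the sup-norm distance that the row potential travels per unit of time \<open>k \<tau>\<close>.\<close>

definition speed :: real where
  "speed = (\<Sum>i\<in>UNIV. - ln (\<mu> $ i)) + (\<Sum>j\<in>UNIV. - ln (\<nu> $ j))"

lemma speed_ge: "- ln (\<mu> $ i) \<le> speed" "- ln (\<nu> $ j) \<le> speed" "0 \<le> speed"
proof -
  have \<mu>: "0 \<le> - ln (\<mu> $ i)" for i using prob_component_le_1[OF \<mu>_prob] \<mu>_pos[of i] by simp
  have \<nu>: "0 \<le> - ln (\<nu> $ j)" for j using prob_component_le_1[OF \<nu>_prob] \<nu>_pos[of j] by simp
  have "- ln (\<mu> $ i) \<le> (\<Sum>i\<in>UNIV. - ln (\<mu> $ i))"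
    using \<mu> by (intro member_le_sum[of i UNIV "\<lambda>i. - ln (\<mu> $ i)"]) auto
  moreover have "- ln (\<nu> $ j) \<le> (\<Sum>j\<in>UNIV. - ln (\<nu> $ j))"
    using \<nu> by (intro member_le_sum[of j UNIV "\<lambda>j. - ln (\<nu> $ j)"]) auto
  moreover have "0 \<le> (\<Sum>i\<in>UNIV. - ln (\<mu> $ i))" "0 \<le> (\<Sum>j\<in>UNIV. - ln (\<nu> $ j))"
    using \<mu> \<nu> by (auto intro!: sum_nonneg simp del: neg_0_le_iff_le)
  ultimately show "- ln (\<mu> $ i) \<le> speed" "- ln (\<nu> $ j) \<le> speed" "0 \<le> speed"
    unfolding speed_def by linarith+
qed

text \<open>Both bounds come from the fact that the entries of a marginal are at most \<open>1\<close>. Later steps are no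
  longer, because the iteration is nonexpansive.\<close>

lemma row_potential_first_step:
  assumes \<tau>: "0 < \<tau>"
  shows "\<bar>row_potential \<tau> g0 1 $ i - row_potential \<tau> g0 0 $ i\<bar> \<le> speed * \<tau>"
proof -
  have "marginal_X (even_plan \<tau> g0 0) $ i \<le> 1"
    by (intro prob_component_le_1 marginal_X_prob even_plan_prob \<tau>)
  moreover have "0 < marginal_X (even_plan \<tau> g0 0) $ i" by (rule marginal_gibbs_pos)
  ultimately have "ln (marginal_X (even_plan \<tau> g0 0) $ i / \<mu> $ i) \<le> - ln (\<mu> $ i)"
    using \<mu>_pos[of i] by (simp add: ln_div)
  then have "\<tau> * ln (marginal_X (even_plan \<tau> g0 0) $ i / \<mu> $ i) \<le> \<tau> * speed"
    using \<tau> speed_ge(1)[of i] by (intro mult_left_mono) auto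
  then have "row_potential \<tau> g0 0 $ i - speed * \<tau> \<le> row_potential \<tau> g0 1 $ i"
    using row_potential_Suc[OF \<tau>, of g0 0 i] by (simp add: mult.commute)
  moreover have "row_potential \<tau> g0 1 $ i \<le> row_potential \<tau> g0 0 $ i + speed * \<tau>"
  proof -
    have "g0 $ j \<le> Gr \<tau> (Fr \<tau> g0) $ j + speed * \<tau>" for j
    proof -
      let ?G = "gibbs \<tau> (Fr \<tau> g0) g0"
      have "?G \<in> prob_simplex"
        using sum_marginal_X[of ?G] \<mu>_prob
        by (simp add: prob_simplex_def marginal_X_gibbs_f_reg[OF \<tau>] gibbs_pos less_imp_le)
      then have "marginal_Y ?G $ j \<le> 1" by (intro prob_component_le_1 marginal_Y_prob)
      moreover have "0 < marginal_Y ?G $ j" by (rule marginal_gibbs_pos)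
      ultimately have "ln (marginal_Y ?G $ j / \<nu> $ j) \<le> - ln (\<nu> $ j)"
        using \<nu>_pos[of j] by (simp add: ln_div)
      then have "\<tau> * ln (marginal_Y ?G $ j / \<nu> $ j) \<le> \<tau> * speed"
        using \<tau> speed_ge(2)[of j] by (intro mult_left_mono) auto
      then show ?thesis by (simp add: g_reg_eq[OF \<tau>, of "Fr \<tau> g0" j g0] mult.commute)
    qed
    then show ?thesis using f_reg_antimono[OF \<tau>, of g0 "Gr \<tau> (Fr \<tau> g0)" "speed * \<tau>" i] by simp
  qed
  ultimately show ?thesis by (simp add: abs_le_iff)
qed

lemma row_potential_step:
  assumes \<tau>: "0 < \<tau>"
  shows "\<bar>row_potential \<tau> g0 (Suc k) $ i - row_potential \<tau> g0 k $ i\<bar> \<le> speed * \<tau>"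
proof (induction k arbitrary: i)
  case 0
  then show ?case using row_potential_first_step[OF \<tau>] by simp
next
  case (Suc k)
  have "\<bar>Fr \<tau> (Gr \<tau> (row_potential \<tau> g0 (Suc k))) $ i - Fr \<tau> (Gr \<tau> (row_potential \<tau> g0 k)) $ i\<bar> \<le> speed * \<tau>"
    by (intro f_reg_nonexpansive[OF \<tau>] g_reg_nonexpansive[OF \<tau>] Suc)
  then show ?case by simp
qed

lemma row_potential_lipschitz:
  assumes \<tau>: "0 < \<tau>"
  shows "\<bar>row_potential \<tau> g0 (k + n) $ i - row_potential \<tau> g0 k $ i\<bar> \<le> real n * (speed * \<tau>)"
proof (induction n)
  case (Suc n)
  have "\<bar>row_potential \<tau> g0 (k + Suc n) $ i - row_potential \<tau> g0 (k + n) $ i\<bar> \<le> speed * \<tau>"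
    using row_potential_step[OF \<tau>, of g0 "k + n" i] by simp
  moreover have "real (Suc n) * (speed * \<tau>) = real n * (speed * \<tau>) + speed * \<tau>" by (simp add: algebra_simps)
  ultimately show ?case using Suc by linarith
qed simp

text \<open>A soft minimum with a weight \<open>\<nu>\<^sub>j\<close> at the minimizing column differs from the minimum by at most
  \<open>- \<tau> ln \<nu>\<^sub>j\<close>.\<close>

lemma row_potential_0_tendsto:
  "((\<lambda>\<tau>. row_potential \<tau> g0 0) \<longlongrightarrow> f_zero C g0) (at_right 0)"
proof (rule vec_tendstoI)
  fix i
  define h where "h = f_zero C g0"
  have h_le: "h $ i + g0 $ j \<le> C $ (i, j)" for i j
  proof -
    have "h $ i \<le> C $ (i, j) - g0 $ j" unfolding h_def f_zero_def by (auto intro!: Min_le)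
    then show ?thesis by simp
  qed
  obtain j where j: "h $ i = C $ (i, j) - g0 $ j"
    using Min_in[of "range (\<lambda>j. C $ (i, j) - g0 $ j)"] by (auto simp: h_def f_zero_def image_iff)
  have bound: "norm (row_potential \<tau> g0 0 $ i - h $ i) \<le> \<tau> * (- ln (\<nu> $ j))" if \<tau>: "0 < \<tau>" for \<tau>
  proof -
    let ?G = "gibbs \<tau> h g0"
    have G_le: "?G $ (i, k) \<le> \<mu> $ i * \<nu> $ k" for k
    proof -
      have "exp ((- C $ (i, k) + h $ i + g0 $ k) / \<tau>) \<le> 1"
        using h_le[of i k] \<tau> by (simp add: divide_nonpos_pos)
      then have "exp ((- C $ (i, k) + h $ i + g0 $ k) / \<tau>) * (\<mu> $ i * \<nu> $ k) \<le> 1 * (\<mu> $ i * \<nu> $ k)"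
        using \<mu>_pos[of i] \<nu>_pos[of k] by (intro mult_right_mono) auto
      then show ?thesis by (simp add: gibbs_def mult.assoc)
    qed
    have "marginal_X ?G $ i \<le> (\<Sum>k\<in>UNIV. \<mu> $ i * \<nu> $ k)"
      unfolding marginal_X_def by (simp add: sum_mono G_le)
    also have "\<dots> = \<mu> $ i" using \<nu>_prob by (simp add: prob_simplex_def flip: sum_distrib_left)
    finally have up: "marginal_X ?G $ i \<le> \<mu> $ i" .
    have "?G $ (i, j) \<le> marginal_X ?G $ i"
      unfolding marginal_X_def vec_lambda_beta
      by (rule member_le_sum[of j UNIV "\<lambda>j. ?G $ (i, j)"]) (auto simp: gibbs_pos less_imp_le)
    moreover have "?G $ (i, j) = \<mu> $ i * \<nu> $ j" using j by (simp add: gibbs_def)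
    ultimately have low: "\<nu> $ j \<le> marginal_X ?G $ i / \<mu> $ i" using \<mu>_pos[of i] by (simp add: field_simps)
    have "ln (\<nu> $ j) \<le> ln (marginal_X ?G $ i / \<mu> $ i)"
      using low marginal_gibbs_pos(1)[of \<tau> h g0 i] \<mu>_pos[of i] \<nu>_pos[of j] by simp
    moreover have "ln (marginal_X ?G $ i / \<mu> $ i) \<le> 0"
      using up marginal_gibbs_pos(1)[of \<tau> h g0 i] \<mu>_pos[of i] by simp
    ultimately have "\<bar>ln (marginal_X ?G $ i / \<mu> $ i)\<bar> \<le> - ln (\<nu> $ j)" by simp
    then have "\<tau> * \<bar>ln (marginal_X ?G $ i / \<mu> $ i)\<bar> \<le> \<tau> * (- ln (\<nu> $ j))"
      using \<tau> by (intro mult_left_mono) auto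
    then show ?thesis
      using \<tau> by (simp add: f_reg_eq[OF \<tau>, of g0 i h] abs_mult)
  qed
  have "((\<lambda>\<tau>. row_potential \<tau> g0 0 $ i - h $ i) \<longlongrightarrow> 0) (at_right 0)"
  proof (rule Lim_null_comparison)
    show "\<forall>\<^sub>F \<tau> in at_right 0. norm (row_potential \<tau> g0 0 $ i - h $ i) \<le> \<tau> * (- ln (\<nu> $ j))"
      using eventually_at_right_less[of "0::real"] by eventually_elim (rule bound)
    show "((\<lambda>\<tau>. \<tau> * (- ln (\<nu> $ j))) \<longlongrightarrow> 0) (at_right 0)"
      by (rule tendsto_mult_left_zero) simp
  qed
  then show "((\<lambda>\<tau>. row_potential \<tau> g0 0 $ i) \<longlongrightarrow> f_zero C g0 $ i) (at_right 0)"
    unfolding h_def by (rule LIM_zero_cancel)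
qed

end

section \<open>Potentials during one phase\<close>

lemma ln_ratio_small:
  fixes a \<epsilon> :: real
  assumes "0 < a" "0 < \<epsilon>"
  shows "\<forall>\<^sub>F d in at_right 0. \<forall>x. \<bar>x - a\<bar> \<le> d \<longrightarrow> \<bar>ln (x / a)\<bar> \<le> \<epsilon>"
proof -
  have "\<bar>ln (x / a)\<bar> \<le> \<epsilon>" if d: "d < a * (1 - exp (- \<epsilon>))" "\<bar>x - a\<bar> \<le> d" for d x
  proof -
    have "1 - \<epsilon> \<le> exp (- \<epsilon>)" "1 + \<epsilon> \<le> exp \<epsilon>"
      using exp_ge_add_one_self[of "- \<epsilon>"] exp_ge_add_one_self[of \<epsilon>] by auto
    then have "a * (1 + (1 - exp (- \<epsilon>))) \<le> a * exp \<epsilon>" using assms by (intro mult_left_mono) linarith+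
    then have x: "a * exp (- \<epsilon>) \<le> x" "x \<le> a * exp \<epsilon>"
      using d by (auto simp: algebra_simps abs_le_iff)
    have "0 < a * exp (- \<epsilon>)" using assms by simp
    then have "0 < x" using x(1) by linarith
    then have "0 < x / a" using assms by simp
    moreover have "exp (- \<epsilon>) \<le> x / a" "x / a \<le> exp \<epsilon>" using x assms by (auto simp: field_simps)
    ultimately have "ln (exp (- \<epsilon>)) \<le> ln (x / a)" "ln (x / a) \<le> ln (exp \<epsilon>)"
      by (auto simp del: ln_exp)
    then show ?thesis by (simp add: abs_le_iff)
  qed
  moreover have "0 < a * (1 - exp (- \<epsilon>))" using assms by simp
  ultimately show ?thesis
    using eventually_at_right[of 0 "a * (1 - exp (- \<epsilon>))"] by blast
qed

lemma tendsto_exp_neg_divide: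
  fixes c :: real
  assumes "c < 0"
  shows "((\<lambda>\<tau>. exp (c / \<tau>)) \<longlongrightarrow> 0) (at_right 0)"
proof -
  have "LIM \<tau> at_right 0. c * inverse \<tau> :> at_bot"
    using assms by (intro filterlim_tendsto_neg_mult_at_bot[OF tendsto_const] filterlim_inverse_at_top_right)
  then show ?thesis
    using filterlim_compose[OF exp_at_bot] by (simp add: divide_inverse)
qed

lemma nat_floor_divide:
  fixes t \<tau> :: real
  assumes "0 \<le> t" "0 < \<tau>"
  shows "real (nat \<lfloor>t / \<tau>\<rfloor>) * \<tau> \<le> t" "t < real (nat \<lfloor>t / \<tau>\<rfloor>) * \<tau> + \<tau>"
proof -
  have k: "real (nat \<lfloor>t / \<tau>\<rfloor>) = of_int \<lfloor>t / \<tau>\<rfloor>" using assms by simp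
  have "of_int \<lfloor>t / \<tau>\<rfloor> * \<tau> \<le> t / \<tau> * \<tau>" "t / \<tau> * \<tau> < (of_int \<lfloor>t / \<tau>\<rfloor> + 1) * \<tau>"
    using assms(2) by (intro mult_right_mono mult_strict_right_mono; linarith)+
  then show "real (nat \<lfloor>t / \<tau>\<rfloor>) * \<tau> \<le> t" "t < real (nat \<lfloor>t / \<tau>\<rfloor>) * \<tau> + \<tau>"
    unfolding k using assms(2) by (simp_all add: distrib_right)
qed

text \<open>The state at the start of a phase: a dual feasible point at which every row and every column has a
  tight constraint, which is what makes the velocities well defined.\<close>

locale sinkhorn_phase = sinkhorn \<mu> \<nu> C
  for \<mu> :: "real ^ 'm::finite" and \<nu> :: "real ^ 'n::finite" and C +
  fixes f :: "real ^ 'm" and g :: "real ^ 'n"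
  assumes feasible: "f $ i + g $ j \<le> C $ (i, j)"
    and tight_row: "\<exists>j. (i, j) \<in> tight_edges C f g"
    and tight_col: "\<exists>i. (i, j) \<in> tight_edges C f g"
begin

definition "E = tight_edges C f g"
definition "v = v_star \<mu> \<nu> E"
definition "w = w_star \<mu> \<nu> E"
definition "\<mu>s = mu_star \<mu> \<nu> E"
definition "\<nu>s = nu_star \<mu> \<nu> E"

text \<open>The violation of the constraint \<open>p\<close> after time \<open>s\<close> of motion with velocities \<open>(v, w)\<close>; negative
  means slack.\<close>

definition excess :: "real \<Rightarrow> 'm \<times> 'n \<Rightarrow> real" where
  "excess s p = f $ fst p + g $ snd p - C $ p + s * (v $ fst p + w $ snd p)"

lemma certificate:
  obtains Q where "Q \<in> edge_simplex E" "marginal_X Q = \<mu>s" "marginal_Y Q = \<nu>"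
    "\<And>i j. 0 < Q $ (i, j) \<Longrightarrow> v $ i + w $ j = 0"
  by (rule phase_certificate[of \<mu> \<nu> E])
    (use \<mu>_prob \<nu>_prob \<mu>_pos \<nu>_pos tight_row tight_col in
      \<open>auto simp: v_def w_def \<mu>s_def simp flip: E_def\<close>)

lemma \<mu>s_pos: "0 < \<mu>s $ i"
  and \<nu>s_eq: "\<nu>s $ j = \<nu> $ j * exp (- w $ j)"
  and vw_le: "p \<in> E \<Longrightarrow> v $ fst p + w $ snd p \<le> 0"
  and \<mu>s_gap: "Q' \<in> edge_simplex E \<Longrightarrow> marginal_Y Q' = \<nu> \<Longrightarrow>
      rel_entropy \<mu>s \<mu> + (\<Sum>i\<in>UNIV. (sqrt (marginal_X Q' $ i) - sqrt (\<mu>s $ i))\<^sup>2)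
      \<le> rel_entropy (marginal_X Q') \<mu>"
  by (rule phase_certificate[of \<mu> \<nu> E];
      use \<mu>_prob \<nu>_prob \<mu>_pos \<nu>_pos tight_row tight_col in
      \<open>auto simp: v_def w_def \<mu>s_def \<nu>s_def simp flip: E_def\<close>)+

lemma v_eq: "v $ i = ln (\<mu> $ i / \<mu>s $ i)"
  by (simp add: v_def v_star_def \<mu>s_def)

lemma \<mu>s_prob: "\<mu>s \<in> prob_simplex"
  using certificate marginal_X_prob by (metis (no_types, lifting) edge_simplex_def mem_Collect_eq)

lemma excess_edge: "p \<in> E \<Longrightarrow> excess s p = s * (v $ fst p + w $ snd p)"
  by (auto simp: E_def tight_edges_def excess_def)

lemma excess_off_edge: "p \<notin> E \<Longrightarrow> excess 0 p < 0"
  using feasible[of "fst p" "snd p"] by (cases p) (auto simp: E_def tight_edges_def excess_def)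

text \<open>Along the corrected curve the Gibbs matrix is the scaled kernel of the correctors, damped by the
  constraints that are slack.\<close>

lemma gibbs_drift:
  assumes "0 < \<tau>"
  shows "gibbs \<tau> (f + s *\<^sub>R v + \<tau> *\<^sub>R \<phi>) (g + s *\<^sub>R w + \<tau> *\<^sub>R \<psi>) $ p
    = exp (excess s p / \<tau>) * (exp (\<phi> $ fst p + \<psi> $ snd p) * tensor \<mu> \<nu> $ p)"
proof -
  have "(- C $ p + (f + s *\<^sub>R v + \<tau> *\<^sub>R \<phi>) $ fst p + (g + s *\<^sub>R w + \<tau> *\<^sub>R \<psi>) $ snd p) / \<tau>
    = excess s p / \<tau> + (\<phi> $ fst p + \<psi> $ snd p)"
    using assms by (simp add: excess_def field_simps)
  then show ?thesis by (simp add: gibbs_def tensor_def exp_add)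
qed

lemma excess_le_max:
  assumes "0 \<le> s" "s \<le> T"
  shows "excess s p \<le> max (excess 0 p) (excess T p)"
proof (cases "0 \<le> v $ fst p + w $ snd p")
  case True
  then have "s * (v $ fst p + w $ snd p) \<le> T * (v $ fst p + w $ snd p)"
    using assms by (intro mult_right_mono)
  then show ?thesis by (simp add: excess_def)
next
  case False
  then have "s * (v $ fst p + w $ snd p) \<le> 0" using assms by (simp add: mult_nonneg_nonpos)
  then show ?thesis by (simp add: excess_def)
qed

text \<open>The approximate scaling \<open>R\<close> on \<open>E\<close> has almost the right marginals, and the Gibbs matrix of the curve
  differs from it only on edges with \<open>v\<^sub>i + w\<^sub>j < 0\<close>, where its entries lie between \<open>0\<close> and those of
  \<open>R\<close>, and off \<open>E\<close>, where they are exponentially small. On the former edges \<open>R\<close> is small itself: the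
  sum of \<open>R\<^sub>i\<^sub>j (v\<^sub>i + w\<^sub>j)\<close> depends only on the marginals of \<open>R\<close> and vanishes at the exact marginals,
  while its terms all have the same sign. This covers all times of the phase uniformly, including the
  first few steps, during which the edges that open up are not yet damped.\<close>

lemma corrector_consistency:
  assumes T: "0 \<le> T" "\<And>p. p \<notin> E \<Longrightarrow> excess T p < 0" and \<epsilon>: "0 < \<epsilon>"
  obtains \<phi> \<psi> where "\<forall>\<^sub>F \<tau> in at_right 0. \<forall>s\<in>{0..T}.
    (\<forall>i. \<bar>ln (marginal_X (gibbs \<tau> (f + s *\<^sub>R v + \<tau> *\<^sub>R \<phi>) (g + s *\<^sub>R w + \<tau> *\<^sub>R \<psi>)) $ i / \<mu>s $ i)\<bar> \<le> \<epsilon>) \<and>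
    (\<forall>j. \<bar>ln (marginal_Y (gibbs \<tau> (f + s *\<^sub>R v + \<tau> *\<^sub>R \<phi>) (g + s *\<^sub>R w + \<tau> *\<^sub>R \<psi>)) $ j / \<nu> $ j)\<bar> \<le> \<epsilon>)"
proof -
  have "\<forall>\<^sub>F d in at_right (0::real). (\<forall>i x. \<bar>x - \<mu>s $ i\<bar> \<le> d \<longrightarrow> \<bar>ln (x / \<mu>s $ i)\<bar> \<le> \<epsilon>)
      \<and> (\<forall>j x. \<bar>x - \<nu> $ j\<bar> \<le> d \<longrightarrow> \<bar>ln (x / \<nu> $ j)\<bar> \<le> \<epsilon>) \<and> 0 < d"
    by (intro eventually_conj eventually_all_finite ln_ratio_small \<mu>s_pos \<nu>_pos \<epsilon> eventually_at_right_less)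
  from eventually_happens'[OF trivial_limit_at_right_real this]
  obtain d :: real where d': "(\<forall>i x. \<bar>x - \<mu>s $ i\<bar> \<le> d \<longrightarrow> \<bar>ln (x / \<mu>s $ i)\<bar> \<le> \<epsilon>)
      \<and> (\<forall>j x. \<bar>x - \<nu> $ j\<bar> \<le> d \<longrightarrow> \<bar>ln (x / \<nu> $ j)\<bar> \<le> \<epsilon>) \<and> 0 < d" ..
  then have d: "0 < d" and d\<mu>: "\<And>i x. \<bar>x - \<mu>s $ i\<bar> \<le> d \<Longrightarrow> \<bar>ln (x / \<mu>s $ i)\<bar> \<le> \<epsilon>"
    and d\<nu>: "\<And>j x. \<bar>x - \<nu> $ j\<bar> \<le> d \<Longrightarrow> \<bar>ln (x / \<nu> $ j)\<bar> \<le> \<epsilon>"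
    by simp_all
  obtain Q where Q: "Q \<in> edge_simplex E" "marginal_X Q = \<mu>s" "marginal_Y Q = \<nu>"
    and Qvw: "\<And>i j. 0 < Q $ (i, j) \<Longrightarrow> v $ i + w $ j = 0"
    using certificate by metis
  note Qs = edge_simplexD[OF Q(1)]
  define r where "r p = - (v $ fst p + w $ snd p)" for p :: "'m \<times> 'n"
  define V where "V = (\<Sum>i\<in>UNIV. \<bar>v $ i\<bar>) + (\<Sum>j\<in>UNIV. \<bar>w $ j\<bar>)"
  \<comment> \<open>Pairs with \<open>r p = 0\<close> contribute \<open>0\<close>, since division by zero gives zero.\<close>
  define W where "W = (\<Sum>p\<in>UNIV. V / \<bar>r p\<bar>)"
  have V: "0 \<le> V" by (simp add: V_def sum_nonneg)
  then have W: "0 \<le> W" by (simp add: W_def sum_nonneg)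
  \<comment> \<open>One half of the tolerance \<open>d\<close> pays for the marginals of \<open>R\<close> (\<open>\<delta>\<close>) and for the edges with
    \<open>v\<^sub>i + w\<^sub>j < 0\<close> (\<open>\<delta> W\<close>), the other half for the pairs off \<open>E\<close>.\<close>
  define \<delta> where "\<delta> = d / (2 * (W + 1))"
  have \<delta>: "0 < \<delta>" using d W by (simp add: \<delta>_def)
  obtain \<phi> \<psi> where
    RX: "\<And>i. \<bar>marginal_X (scaled_kernel E (tensor \<mu> \<nu>) \<phi> \<psi>) $ i - \<mu>s $ i\<bar> \<le> \<delta>" and
    RY: "\<And>j. \<bar>marginal_Y (scaled_kernel E (tensor \<mu> \<nu>) \<phi> \<psi>) $ j - \<nu> $ j\<bar> \<le> \<delta>"
    using approximate_scaling[of Q E "tensor \<mu> \<nu>" \<delta>] Qs \<delta> \<mu>_pos \<nu>_pos unfolding Q by (auto simp: tensor_def)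
  define R where "R = scaled_kernel E (tensor \<mu> \<nu>) \<phi> \<psi>"
  have R_nonneg: "0 \<le> R $ p" for p
    using \<mu>_pos \<nu>_pos by (simp add: R_def scaled_kernel_def tensor_def less_imp_le)
  have Rr_nonneg: "0 \<le> R $ p * r p" for p
    using R_nonneg[of p] vw_le[of p] by (cases "p \<in> E") (auto simp: r_def R_def scaled_kernel_def)
  have "(\<Sum>p\<in>UNIV. R $ p * r p) \<le> \<delta> * V"
  proof -
    have "(\<Sum>p\<in>UNIV. Q $ p * r p) = 0"
    proof (rule sum.neutral, rule ballI)
      fix p
      show "Q $ p * r p = 0"
        using Qvw[of "fst p" "snd p"] Qs(1)[of p] by (cases "Q $ p = 0") (auto simp: r_def)
    qed
    moreover have *: "(\<Sum>p\<in>UNIV. P $ p * r p)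
      = - (\<Sum>i\<in>UNIV. marginal_X P $ i * v $ i) - (\<Sum>j\<in>UNIV. marginal_Y P $ j * w $ j)" for P
      using sum_mult_marginal_X[of P "\<lambda>i. v $ i"] sum_mult_marginal_Y[of P "\<lambda>j. w $ j"]
      by (simp add: r_def algebra_simps sum.distrib sum_negf sum_subtractf)
    ultimately have "(\<Sum>p\<in>UNIV. R $ p * r p)
      = - (\<Sum>i\<in>UNIV. (marginal_X R $ i - \<mu>s $ i) * v $ i) - (\<Sum>j\<in>UNIV. (marginal_Y R $ j - \<nu> $ j) * w $ j)"
      using *[of R] *[of Q] by (simp add: Q algebra_simps sum.distrib sum_subtractf)
    also have "\<dots> \<le> \<bar>\<Sum>i\<in>UNIV. (marginal_X R $ i - \<mu>s $ i) * v $ i\<bar> + \<bar>\<Sum>j\<in>UNIV. (marginal_Y R $ j - \<nu> $ j) * w $ j\<bar>"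
      by linarith
    also have "\<dots> \<le> (\<Sum>i\<in>UNIV. \<delta> * \<bar>v $ i\<bar>) + (\<Sum>j\<in>UNIV. \<delta> * \<bar>w $ j\<bar>)"
      using RX RY by (intro add_mono order.trans[OF sum_abs] sum_mono)
        (auto simp: abs_mult R_def intro!: mult_right_mono)
    also have "\<dots> = \<delta> * V" by (simp add: V_def sum_distrib_left distrib_left)
    finally show ?thesis .
  qed
  then have Rr: "R $ p * r p \<le> \<delta> * V" for p
    using member_le_sum[of p UNIV "\<lambda>p. R $ p * r p"] Rr_nonneg by force
  define N where "N = real CARD('m \<times> 'n)"
  have N: "0 < N" by (simp add: N_def)
  define M where "M p = max (excess 0 p) (excess T p)" for p
  have M_neg: "M p < 0" if "p \<notin> E" for p
    using excess_off_edge[OF that] T(2)[OF that] by (simp add: M_def)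
  have ev: "\<forall>\<^sub>F \<tau> in at_right 0. p \<notin> E \<longrightarrow>
      exp (M p / \<tau>) * (exp (\<phi> $ fst p + \<psi> $ snd p) * tensor \<mu> \<nu> $ p) \<le> d / (2 * N)" for p
  proof (cases "p \<in> E")
    case False
    have "((\<lambda>\<tau>. exp (M p / \<tau>) * (exp (\<phi> $ fst p + \<psi> $ snd p) * tensor \<mu> \<nu> $ p)) \<longlongrightarrow> 0) (at_right 0)"
      using tendsto_mult_left_zero[OF tendsto_exp_neg_divide[OF M_neg[OF False]]] .
    then have "\<forall>\<^sub>F \<tau> in at_right 0. exp (M p / \<tau>) * (exp (\<phi> $ fst p + \<psi> $ snd p) * tensor \<mu> \<nu> $ p) < d / (2 * N)"
      using d N by (intro order_tendstoD(2)) auto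
    then show ?thesis by (rule eventually_mono) simp
  qed simp
  then have "\<forall>\<^sub>F \<tau> in at_right 0. \<forall>p. p \<notin> E \<longrightarrow>
      exp (M p / \<tau>) * (exp (\<phi> $ fst p + \<psi> $ snd p) * tensor \<mu> \<nu> $ p) \<le> d / (2 * N)"
    by (rule eventually_all_finite)
  then have "\<forall>\<^sub>F \<tau> in at_right 0. \<forall>s\<in>{0..T}.
    (\<forall>i. \<bar>ln (marginal_X (gibbs \<tau> (f + s *\<^sub>R v + \<tau> *\<^sub>R \<phi>) (g + s *\<^sub>R w + \<tau> *\<^sub>R \<psi>)) $ i / \<mu>s $ i)\<bar> \<le> \<epsilon>) \<and>
    (\<forall>j. \<bar>ln (marginal_Y (gibbs \<tau> (f + s *\<^sub>R v + \<tau> *\<^sub>R \<phi>) (g + s *\<^sub>R w + \<tau> *\<^sub>R \<psi>)) $ j / \<nu> $ j)\<bar> \<le> \<epsilon>)"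
    using eventually_at_right_less[of 0]
  proof eventually_elim
    case (elim \<tau>)
    show ?case
    proof
      fix s assume s: "s \<in> {0..T}"
      define G where "G = gibbs \<tau> (f + s *\<^sub>R v + \<tau> *\<^sub>R \<phi>) (g + s *\<^sub>R w + \<tau> *\<^sub>R \<psi>)"
      have G: "G $ p = exp (excess s p / \<tau>) * (exp (\<phi> $ fst p + \<psi> $ snd p) * tensor \<mu> \<nu> $ p)" for p
        unfolding G_def by (rule gibbs_drift[OF elim(2)])
      have GR: "\<bar>G $ p - R $ p\<bar> \<le> \<delta> * (V / \<bar>r p\<bar>) + d / (2 * N)" for p
      proof (cases "p \<in> E")
        case True
        have Gp: "G $ p = exp (excess s p / \<tau>) * R $ p" using True by (simp add: G R_def scaled_kernel_def)
        have dN: "0 \<le> d / (2 * N)" using d N by simp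
        show ?thesis
        proof (cases "r p = 0")
          case True
          then have "excess s p = 0" using excess_edge[OF \<open>p \<in> E\<close>, of s] by (simp add: r_def)
          then show ?thesis using Gp dN True by simp
        next
          case False
          then have rp: "0 < r p" using vw_le[OF \<open>p \<in> E\<close>] by (simp add: r_def)
          have "excess s p \<le> 0"
            using excess_edge[OF \<open>p \<in> E\<close>, of s] rp s by (simp add: r_def mult_nonneg_nonpos)
          then have "exp (excess s p / \<tau>) \<le> 1" using elim(2) by (simp add: divide_nonpos_pos)
          then have "exp (excess s p / \<tau>) * R $ p \<le> 1 * R $ p" by (rule mult_right_mono[OF _ R_nonneg])
          moreover have "0 \<le> exp (excess s p / \<tau>) * R $ p" using R_nonneg by simp
          moreover have "R $ p \<le> \<delta> * (V / \<bar>r p\<bar>)" using Rr[of p] rp by (simp add: field_simps)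
          ultimately show ?thesis unfolding Gp using dN R_nonneg[of p] by linarith
        qed
      next
        case False
        have "exp (excess s p / \<tau>) \<le> exp (M p / \<tau>)"
          using excess_le_max[of s T p] s elim(2) by (simp add: M_def divide_right_mono)
        moreover have "0 \<le> exp (\<phi> $ fst p + \<psi> $ snd p) * tensor \<mu> \<nu> $ p"
          using \<mu>_pos \<nu>_pos by (simp add: tensor_def less_imp_le)
        ultimately have "G $ p \<le> d / (2 * N)"
          using elim(1) False unfolding G by (meson mult_right_mono order.trans)
        moreover have "R $ p = 0" using False by (simp add: R_def scaled_kernel_def)
        moreover have "0 < G $ p" by (simp add: G_def gibbs_pos)
        moreover have "0 \<le> \<delta> * (V / \<bar>r p\<bar>)" using \<delta> V by simp
        ultimately show ?thesis by linarith
      qed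
      have "(\<Sum>p\<in>UNIV. \<bar>G $ p - R $ p\<bar>) \<le> (\<Sum>p\<in>UNIV. \<delta> * (V / \<bar>r p\<bar>) + d / (2 * N))"
        by (rule sum_mono) (rule GR)
      also have "\<dots> = \<delta> * W + d / 2"
        using N by (simp only: sum.distrib W_def sum_distrib_left) (simp add: N_def)
      also have "\<dots> = d - \<delta>"
        using W by (simp add: \<delta>_def field_simps)
      finally have sum: "(\<Sum>p\<in>UNIV. \<bar>G $ p - R $ p\<bar>) \<le> d - \<delta>" .
      have "\<bar>marginal_X G $ i - \<mu>s $ i\<bar> \<le> d" for i
        using abs_marginal_diff_le(1)[of G i R] sum RX[of i, folded R_def] by linarith
      moreover have "\<bar>marginal_Y G $ j - \<nu> $ j\<bar> \<le> d" for j
        using abs_marginal_diff_le(2)[of G j R] sum RY[of j, folded R_def] by linarith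
      ultimately show "(\<forall>i. \<bar>ln (marginal_X (gibbs \<tau> (f + s *\<^sub>R v + \<tau> *\<^sub>R \<phi>) (g + s *\<^sub>R w + \<tau> *\<^sub>R \<psi>)) $ i / \<mu>s $ i)\<bar> \<le> \<epsilon>) \<and>
        (\<forall>j. \<bar>ln (marginal_Y (gibbs \<tau> (f + s *\<^sub>R v + \<tau> *\<^sub>R \<phi>) (g + s *\<^sub>R w + \<tau> *\<^sub>R \<psi>)) $ j / \<nu> $ j)\<bar> \<le> \<epsilon>)"
        using d\<mu> d\<nu> by (simp flip: G_def)
    qed
  qed
  then show ?thesis by (rule that)
qed

text \<open>Each of the two half steps adds a consistency error of at most \<open>\<tau> \<epsilon>\<close>, and neither amplifies the
  error already present.\<close>

lemma comparison_principle:
  fixes N n :: nat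
  assumes \<tau>: "0 < \<tau>"
    and marg: "\<And>n i. n < N \<Longrightarrow> \<bar>ln (marginal_X (gibbs \<tau> (f + (real n * \<tau>) *\<^sub>R v + \<tau> *\<^sub>R \<phi>) (g + (real n * \<tau>) *\<^sub>R w + \<tau> *\<^sub>R \<psi>)) $ i / \<mu>s $ i)\<bar> \<le> \<epsilon>"
      "\<And>n j. n < N \<Longrightarrow> \<bar>ln (marginal_Y (gibbs \<tau> (f + (real n * \<tau>) *\<^sub>R v + \<tau> *\<^sub>R \<phi>) (g + (real n * \<tau>) *\<^sub>R w + \<tau> *\<^sub>R \<psi>)) $ j / \<nu> $ j)\<bar> \<le> \<epsilon>"
    and init: "\<And>i. \<bar>row_potential \<tau> g0 k $ i - (f + \<tau> *\<^sub>R \<phi>) $ i\<bar> \<le> e"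
  shows "n \<le> N \<Longrightarrow> \<bar>row_potential \<tau> g0 (k + n) $ i - (f + (real n * \<tau>) *\<^sub>R v + \<tau> *\<^sub>R \<phi>) $ i\<bar> \<le> e + 2 * real n * \<tau> * \<epsilon>"
proof (induction n arbitrary: i)
  case 0
  then show ?case using init by simp
next
  case (Suc n)
  let ?f = "f + (n * \<tau>) *\<^sub>R v + \<tau> *\<^sub>R \<phi>" and ?g = "g + (n * \<tau>) *\<^sub>R w + \<tau> *\<^sub>R \<psi>"
  let ?F = "row_potential \<tau> g0 (k + n)"
  let ?e = "e + 2 * real n * \<tau> * \<epsilon>"
  have "\<bar>Gr \<tau> ?F $ j - ?g $ j\<bar> \<le> ?e + \<tau> * \<epsilon>" for j
  proof -
    have "\<bar>Gr \<tau> ?F $ j - Gr \<tau> ?f $ j\<bar> \<le> ?e"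
      using Suc by (intro g_reg_nonexpansive[OF \<tau>]) auto
    moreover have "\<bar>Gr \<tau> ?f $ j - ?g $ j\<bar> \<le> \<tau> * \<epsilon>"
      unfolding g_reg_eq[OF \<tau>, of ?f j ?g] using marg(2)[of n j] Suc.prems \<tau> by (simp add: abs_mult)
    ultimately show ?thesis by linarith
  qed
  then have "\<bar>Fr \<tau> (Gr \<tau> ?F) $ i - Fr \<tau> ?g $ i\<bar> \<le> ?e + \<tau> * \<epsilon>"
    by (intro f_reg_nonexpansive[OF \<tau>]) auto
  moreover have "\<bar>Fr \<tau> ?g $ i - (?f $ i + \<tau> * v $ i)\<bar> \<le> \<tau> * \<epsilon>"
  proof -
    let ?x = "marginal_X (gibbs \<tau> ?f ?g) $ i"
    have ln_x: "ln (?x / \<mu> $ i) = ln (?x / \<mu>s $ i) - v $ i"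
      using marginal_gibbs_pos(1)[of \<tau> ?f ?g i] \<mu>_pos[of i] \<mu>s_pos[of i] by (simp add: v_eq ln_div)
    have "Fr \<tau> ?g $ i - (?f $ i + \<tau> * v $ i) = - (\<tau> * ln (?x / \<mu>s $ i))"
      unfolding f_reg_eq[OF \<tau>, of ?g i ?f] ln_x right_diff_distrib by linarith
    then show ?thesis using marg(1)[of n i] Suc.prems \<tau> by (simp add: abs_mult)
  qed
  moreover have "row_potential \<tau> g0 (k + Suc n) $ i = Fr \<tau> (Gr \<tau> ?F) $ i" by simp
  moreover have "(f + (Suc n * \<tau>) *\<^sub>R v + \<tau> *\<^sub>R \<phi>) $ i = ?f $ i + \<tau> * v $ i" by (simp add: algebra_simps)
  moreover have "e + 2 * real (Suc n) * \<tau> * \<epsilon> = ?e + \<tau> * \<epsilon> + \<tau> * \<epsilon>" by (simp add: algebra_simps)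
  ultimately show ?case by linarith
qed

text \<open>With a consistency error of \<open>\<tau> \<epsilon>\<close> in each half step, the errors are \<open>\<epsilon>\<close> for the start and the corrector,
  \<open>2 (T + 1) \<epsilon>\<close> accumulated over the phase, \<open>\<epsilon>\<close> for rounding times to multiples of \<open>\<tau>\<close>, and
  \<open>\<epsilon> / 2\<close> for the corrector at the end.\<close>

lemma phase_convergence:
  assumes start: "((\<lambda>\<tau>. row_potential \<tau> g0 (nat \<lfloor>t0 / \<tau>\<rfloor>)) \<longlongrightarrow> f) (at_right 0)"
    and t0: "0 \<le> t0" and T: "0 \<le> T" "\<And>p. p \<notin> E \<Longrightarrow> excess T p < 0"
  shows "((\<lambda>\<tau>. row_potential \<tau> g0 (nat \<lfloor>(t0 + T) / \<tau>\<rfloor>)) \<longlongrightarrow> f + T *\<^sub>R v) (at_right 0)"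
proof (rule vec_tendstoI)
  fix i
  show "((\<lambda>\<tau>. row_potential \<tau> g0 (nat \<lfloor>(t0 + T) / \<tau>\<rfloor>) $ i) \<longlongrightarrow> (f + T *\<^sub>R v) $ i) (at_right 0)"
  proof (rule tendstoI)
    fix \<eta> :: real assume \<eta>: "0 < \<eta>"
    define \<epsilon> where "\<epsilon> = \<eta> / (2 * T + 6)"
    have \<epsilon>: "0 < \<epsilon>" using \<eta> T by (simp add: \<epsilon>_def)
    obtain \<phi> \<psi> where marg: "\<forall>\<^sub>F \<tau> in at_right 0. \<forall>s\<in>{0..T}.
      (\<forall>i. \<bar>ln (marginal_X (gibbs \<tau> (f + s *\<^sub>R v + \<tau> *\<^sub>R \<phi>) (g + s *\<^sub>R w + \<tau> *\<^sub>R \<psi>)) $ i / \<mu>s $ i)\<bar> \<le> \<epsilon>) \<and>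
      (\<forall>j. \<bar>ln (marginal_Y (gibbs \<tau> (f + s *\<^sub>R v + \<tau> *\<^sub>R \<phi>) (g + s *\<^sub>R w + \<tau> *\<^sub>R \<psi>)) $ j / \<nu> $ j)\<bar> \<le> \<epsilon>)"
      by (rule corrector_consistency[OF T \<epsilon>])
    have small: "\<forall>\<^sub>F \<tau> in at_right (0::real). \<tau> * \<bar>c\<bar> < x" if "0 < x" for c x :: real
    proof -
      have "((\<lambda>\<tau>::real. \<tau> * \<bar>c\<bar>) \<longlongrightarrow> 0 * \<bar>c\<bar>) (at_right 0)" by (intro tendsto_intros)
      then show ?thesis using that by (intro order_tendstoD(2)) auto
    qed
    have close: "\<forall>\<^sub>F \<tau> in at_right 0. \<forall>i. \<bar>row_potential \<tau> g0 (nat \<lfloor>t0 / \<tau>\<rfloor>) $ i - f $ i\<bar> < \<epsilon> / 2"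
      using tendstoD[OF tendsto_vec_nth[OF start], of "\<epsilon> / 2"] \<epsilon>
      by (intro eventually_all_finite) (auto simp: dist_real_def)
    have \<phi>_small: "\<forall>\<^sub>F \<tau> in at_right 0. \<forall>i. \<tau> * \<bar>\<phi> $ i\<bar> < \<epsilon> / 2"
      using \<epsilon> by (intro eventually_all_finite small) auto
    have "\<forall>\<^sub>F \<tau> in at_right 0. \<tau> * \<bar>v $ i\<bar> < \<epsilon>" "\<forall>\<^sub>F \<tau> in at_right (0::real). \<tau> * \<bar>1\<bar> < 1"
      using \<epsilon> by (intro small; simp)+
    then show "\<forall>\<^sub>F \<tau> in at_right 0. dist (row_potential \<tau> g0 (nat \<lfloor>(t0 + T) / \<tau>\<rfloor>) $ i) ((f + T *\<^sub>R v) $ i) < \<eta>"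
      using marg close \<phi>_small eventually_at_right_less[of 0]
    proof eventually_elim
      case (elim \<tau>)
      note \<tau> = elim(6)
      define k where "k = nat \<lfloor>t0 / \<tau>\<rfloor>"
      define K where "K = nat \<lfloor>(t0 + T) / \<tau>\<rfloor>"
      have k: "real k * \<tau> \<le> t0" "t0 < real k * \<tau> + \<tau>"
        using nat_floor_divide[OF t0 \<tau>] by (auto simp: k_def)
      have K: "real K * \<tau> \<le> t0 + T" "t0 + T < real K * \<tau> + \<tau>"
        using nat_floor_divide[of "t0 + T" \<tau>] t0 T \<tau> by (auto simp: K_def)
      have "k \<le> K" using T \<tau> by (auto simp: k_def K_def intro!: nat_mono floor_mono divide_right_mono)
      then obtain N where N: "K = k + N" using le_Suc_ex by blast
      have N\<tau>: "real N * \<tau> - T < \<tau>" "- \<tau> < real N * \<tau> - T"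
        using k K by (auto simp: N algebra_simps)
      have s: "real n * \<tau> \<in> {0..T}" if "n < N" for n
      proof -
        have "(real n + 1) * \<tau> \<le> real N * \<tau>" using that \<tau> by (intro mult_right_mono) auto
        then show ?thesis using N\<tau> \<tau> by (auto simp: algebra_simps)
      qed
      have init: "\<bar>row_potential \<tau> g0 k $ i - (f + \<tau> *\<^sub>R \<phi>) $ i\<bar> \<le> \<epsilon>" for i
      proof -
        have "\<bar>\<tau> * \<phi> $ i\<bar> < \<epsilon> / 2" using elim(5) \<tau> by (simp add: abs_mult)
        moreover have "(f + \<tau> *\<^sub>R \<phi>) $ i = f $ i + \<tau> * \<phi> $ i" by simp
        ultimately show ?thesis using elim(4)[rule_format, of i] unfolding k_def by linarith
      qed
      have "\<bar>row_potential \<tau> g0 (k + N) $ i - (f + (N * \<tau>) *\<^sub>R v + \<tau> *\<^sub>R \<phi>) $ i\<bar> \<le> \<epsilon> + 2 * real N * \<tau> * \<epsilon>"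
        by (rule comparison_principle[OF \<tau> _ _ init order_refl, where \<psi> = \<psi>]) (use elim(3) s in auto)
      moreover have "(2 * real N * \<tau>) * \<epsilon> \<le> (2 * (T + 1)) * \<epsilon>"
        using N\<tau> elim(2) \<epsilon> by (intro mult_right_mono) auto
      moreover have "\<bar>(real N * \<tau> - T) * v $ i\<bar> \<le> \<tau> * \<bar>v $ i\<bar>"
        using N\<tau> unfolding abs_mult by (intro mult_right_mono) auto
      moreover have "\<bar>\<tau> * \<phi> $ i\<bar> < \<epsilon> / 2" using elim(5) \<tau> by (simp add: abs_mult)
      moreover have "(f + (N * \<tau>) *\<^sub>R v + \<tau> *\<^sub>R \<phi>) $ i - (f + T *\<^sub>R v) $ i = (real N * \<tau> - T) * v $ i + \<tau> * \<phi> $ i"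
        by (simp add: algebra_simps)
      moreover have "\<epsilon> + 2 * (T + 1) * \<epsilon> + \<epsilon> + \<epsilon> / 2 < \<eta>"
      proof -
        have "\<eta> = \<epsilon> * (2 * T + 6)" using T by (simp add: \<epsilon>_def)
        then show ?thesis using \<epsilon> by (simp add: algebra_simps)
      qed
      ultimately have "\<bar>row_potential \<tau> g0 K $ i - (f + T *\<^sub>R v) $ i\<bar> < \<eta>"
        using elim(1) unfolding N by linarith
      then show ?case by (simp add: dist_real_def K_def)
    qed
  qed
qed

lemma tight: "p \<in> E \<Longrightarrow> C $ p = f $ fst p + g $ snd p"
  by (auto simp: E_def tight_edges_def)

text \<open>The support of an optimal coupling meets every row and column, and its edges stay tight
  throughout the phase.\<close>

lemma persistent_row: "\<exists>j. (i, j) \<in> E \<and> v $ i + w $ j = 0"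
proof -
  obtain Q where Q: "Q \<in> edge_simplex E" "marginal_X Q = \<mu>s"
    and Qvw: "\<And>i j. 0 < Q $ (i, j) \<Longrightarrow> v $ i + w $ j = 0"
    using certificate by metis
  have "0 < (\<Sum>j\<in>UNIV. Q $ (i, j))" using \<mu>s_pos[of i] by (simp add: marginal_X_def flip: Q(2))
  then obtain j where "0 < Q $ (i, j)" by (meson not_less sum_nonpos)
  then show ?thesis using Qvw edge_simplexD(2)[OF Q(1)] by (metis less_irrefl)
qed

lemma persistent_col: "\<exists>i. (i, j) \<in> E \<and> v $ i + w $ j = 0"
proof -
  obtain Q where Q: "Q \<in> edge_simplex E" "marginal_Y Q = \<nu>"
    and Qvw: "\<And>i j. 0 < Q $ (i, j) \<Longrightarrow> v $ i + w $ j = 0"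
    using certificate by metis
  have "0 < (\<Sum>i\<in>UNIV. Q $ (i, j))" using \<nu>_pos[of j] by (simp add: marginal_Y_def flip: Q(2))
  then obtain i where "0 < Q $ (i, j)" by (meson not_less sum_nonpos)
  then show ?thesis using Qvw edge_simplexD(2)[OF Q(1)] by (metis less_irrefl)
qed

text \<open>The sum of \<open>Q\<^sub>i\<^sub>j (v\<^sub>i + w\<^sub>j)\<close> depends only on the marginals of \<open>Q\<close>, so it vanishes for every optimal
  coupling as soon as it does for one; its terms have the same sign.\<close>

lemma support_persistent:
  assumes Q: "Q \<in> edge_simplex E" "marginal_X Q = \<mu>s" "marginal_Y Q = \<nu>" and pos: "0 < Q $ p"
  shows "v $ fst p + w $ snd p = 0"
proof -
  obtain R where R: "R \<in> edge_simplex E" "marginal_X R = \<mu>s" "marginal_Y R = \<nu>"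
    and Rvw: "\<And>i j. 0 < R $ (i, j) \<Longrightarrow> v $ i + w $ j = 0"
    using certificate by metis
  have split: "(\<Sum>p\<in>UNIV. P $ p * (v $ fst p + w $ snd p))
    = (\<Sum>i\<in>UNIV. marginal_X P $ i * v $ i) + (\<Sum>j\<in>UNIV. marginal_Y P $ j * w $ j)" for P
    by (simp add: distrib_left sum.distrib sum_mult_marginal_X[of P "\<lambda>i. v $ i"]
        sum_mult_marginal_Y[of P "\<lambda>j. w $ j"])
  have "(\<Sum>p\<in>UNIV. R $ p * (v $ fst p + w $ snd p)) = 0"
  proof (rule sum.neutral, rule ballI)
    fix p
    show "R $ p * (v $ fst p + w $ snd p) = 0"
      using Rvw[of "fst p" "snd p"] edge_simplexD(1)[OF R(1), of p] by (cases "R $ p = 0") auto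
  qed
  then have "(\<Sum>p\<in>UNIV. Q $ p * (v $ fst p + w $ snd p)) = 0"
    using split[of R] split[of Q] R Q by simp
  moreover have "Q $ p * (v $ fst p + w $ snd p) \<le> 0" for p
    using edge_simplexD(1,2)[OF Q(1), of p] vw_le[of p]
    by (cases "p \<in> E") (auto simp: mult_nonneg_nonpos)
  ultimately have "Q $ p * (v $ fst p + w $ snd p) = 0"
    using sum_nonneg_eq_0_iff[of UNIV "\<lambda>p. - (Q $ p * (v $ fst p + w $ snd p))"] by (cases p) (auto simp: sum_negf)
  then show ?thesis using pos by simp
qed

text \<open>At the end of a phase a new constraint becomes tight and the consistency estimate is no longer
  available. The uniform Lipschitz bound on the row potential bridges the last piece of time.\<close>

lemma phase_convergence_end:
  assumes start: "((\<lambda>\<tau>. row_potential \<tau> g0 (nat \<lfloor>t0 / \<tau>\<rfloor>)) \<longlongrightarrow> f) (at_right 0)"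
    and t0: "0 \<le> t0" and T: "0 \<le> T" "\<And>s p. 0 \<le> s \<Longrightarrow> s < T \<Longrightarrow> p \<notin> E \<Longrightarrow> excess s p < 0"
  shows "((\<lambda>\<tau>. row_potential \<tau> g0 (nat \<lfloor>(t0 + T) / \<tau>\<rfloor>)) \<longlongrightarrow> f + T *\<^sub>R v) (at_right 0)"
proof (cases "T = 0")
  case True
  then show ?thesis using start by simp
next
  case False
  show ?thesis
  proof (rule vec_tendstoI, rule tendstoI)
    fix i and \<eta> :: real assume \<eta>: "0 < \<eta>"
    define c where "c = speed + \<bar>v $ i\<bar> + 1"
    have c: "0 < c" using speed_ge(3) by (simp add: c_def)
    define \<delta> where "\<delta> = min T (\<eta> / (4 * c))"
    have \<delta>: "0 < \<delta>" "\<delta> \<le> T" "c * \<delta> \<le> \<eta> / 4"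
      using False T(1) \<eta> c by (auto simp: \<delta>_def min_def field_simps)
    define s where "s = T - \<delta>"
    have s: "0 \<le> s" "s < T" using \<delta> by (auto simp: s_def)
    have "((\<lambda>\<tau>. row_potential \<tau> g0 (nat \<lfloor>(t0 + s) / \<tau>\<rfloor>)) \<longlongrightarrow> f + s *\<^sub>R v) (at_right 0)"
      using T(2) s by (intro phase_convergence[OF start t0]) auto
    from tendstoD[OF tendsto_vec_nth[OF this], of "\<eta> / 4" i]
    have close: "\<forall>\<^sub>F \<tau> in at_right 0. \<bar>row_potential \<tau> g0 (nat \<lfloor>(t0 + s) / \<tau>\<rfloor>) $ i - (f + s *\<^sub>R v) $ i\<bar> < \<eta> / 4"
      using \<eta> by (simp add: dist_real_def)
    have "((\<lambda>\<tau>::real. speed * \<tau>) \<longlongrightarrow> speed * 0) (at_right 0)" by (intro tendsto_intros)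
    then have "\<forall>\<^sub>F \<tau> in at_right 0. speed * \<tau> < \<eta> / 4" using \<eta> by (intro order_tendstoD(2)) auto
    then show "\<forall>\<^sub>F \<tau> in at_right 0. dist (row_potential \<tau> g0 (nat \<lfloor>(t0 + T) / \<tau>\<rfloor>) $ i) ((f + T *\<^sub>R v) $ i) < \<eta>"
      using close eventually_at_right_less[of "0::real"]
    proof eventually_elim
      case (elim \<tau>)
      note \<tau> = elim(3)
      define k where "k = nat \<lfloor>(t0 + s) / \<tau>\<rfloor>"
      define K where "K = nat \<lfloor>(t0 + T) / \<tau>\<rfloor>"
      have k: "t0 + s < real k * \<tau> + \<tau>" unfolding k_def using t0 s \<tau> by (intro nat_floor_divide) auto
      have K: "real K * \<tau> \<le> t0 + T" unfolding K_def using t0 s \<tau> by (intro nat_floor_divide) auto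
      have "k \<le> K" using s \<tau> by (auto simp: k_def K_def intro!: nat_mono floor_mono divide_right_mono)
      then obtain n where n: "K = k + n" using le_Suc_ex by blast
      have "real n * \<tau> \<le> \<delta> + \<tau>" using k K by (simp add: n s_def algebra_simps)
      then have "speed * (real n * \<tau>) \<le> speed * (\<delta> + \<tau>)" using speed_ge(3) by (intro mult_left_mono)
      moreover have "\<bar>row_potential \<tau> g0 K $ i - row_potential \<tau> g0 k $ i\<bar> \<le> speed * (real n * \<tau>)"
        using row_potential_lipschitz[OF \<tau>, of g0 k n i] by (simp add: n algebra_simps)
      moreover have "(f + T *\<^sub>R v) $ i = (f + s *\<^sub>R v) $ i + \<delta> * v $ i" by (simp add: s_def algebra_simps)
      moreover have "\<bar>\<delta> * v $ i\<bar> = \<delta> * \<bar>v $ i\<bar>" using \<delta> by (simp add: abs_mult)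
      moreover have "c * \<delta> = speed * \<delta> + \<delta> * \<bar>v $ i\<bar> + \<delta>" by (simp add: c_def algebra_simps)
      moreover have "speed * (\<delta> + \<tau>) = speed * \<delta> + speed * \<tau>" by (simp add: algebra_simps)
      ultimately have "\<bar>row_potential \<tau> g0 K $ i - (f + T *\<^sub>R v) $ i\<bar> < \<eta>"
        using elim(1,2) \<delta>(1,3) unfolding k_def[symmetric] by linarith
      then show ?case by (simp add: dist_real_def K_def)
    qed
  qed
qed

text \<open>Feasibility at the closing time is the limit of feasibility before it, and the persistent edges
  cover all rows and columns.\<close>

lemma next_phase_valid:
  assumes T: "0 \<le> T" "\<And>s p. 0 \<le> s \<Longrightarrow> s < T \<Longrightarrow> p \<notin> E \<Longrightarrow> excess s p < 0"
  shows "sinkhorn_phase \<mu> \<nu> C (f + T *\<^sub>R v) (g + T *\<^sub>R w)"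
proof -
  have le: "excess T p \<le> 0" for p
  proof (cases "p \<in> E")
    case True
    then show ?thesis using vw_le[OF True] T(1) by (simp add: excess_edge mult_nonneg_nonpos)
  next
    case False
    show ?thesis
    proof (cases "T = 0")
      case True
      then show ?thesis using excess_off_edge[OF False] by simp
    next
      case T0: False
      have "((\<lambda>s. excess s p) \<longlongrightarrow> excess T p) (at_left T)"
        unfolding excess_def by (intro tendsto_intros)
      moreover have "\<forall>\<^sub>F s in at_left T. excess s p \<le> 0"
        using T T0 False by (intro eventually_at_leftI[of 0]) (auto simp: less_imp_le)
      ultimately show ?thesis by (intro tendsto_upperbound) auto
    qed
  qed
  have excess_eq: "(f + T *\<^sub>R v) $ i + (g + T *\<^sub>R w) $ j - C $ (i, j) = excess T (i, j)" for i j
    by (simp add: excess_def algebra_simps)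
  have tight: "(i, j) \<in> tight_edges C (f + T *\<^sub>R v) (g + T *\<^sub>R w)" if "(i, j) \<in> E" "v $ i + w $ j = 0" for i j
    using excess_edge[OF that(1), of T] that(2) excess_eq[of i j] by (simp add: tight_edges_def)
  show ?thesis
  proof unfold_locales
    show "(f + T *\<^sub>R v) $ i + (g + T *\<^sub>R w) $ j \<le> C $ (i, j)" for i j
      using le[of "(i, j)"] excess_eq[of i j] by simp
    show "\<exists>j. (i, j) \<in> tight_edges C (f + T *\<^sub>R v) (g + T *\<^sub>R w)" for i
      using persistent_row[of i] tight by blast
    show "\<exists>i. (i, j) \<in> tight_edges C (f + T *\<^sub>R v) (g + T *\<^sub>R w)" for j
      using persistent_col[of j] tight by blast
  qed
qed

end

section \<open>Plans during one phase\<close>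

text \<open>For couplings on \<open>E\<close> with common marginals the relative entropies with respect to \<open>K\<close> and to a
  diagonal scaling \<open>\<pi>\<close> of \<open>K\<close> differ by a constant. In the limit \<open>H(z|\<pi>)\<close> tends to zero while
  \<open>H(Q|\<pi>)\<close> stays above the squared Hellinger distance of \<open>Q\<close> and \<open>\<pi>\<close>. The scaling factors
  themselves may diverge, which is how \<open>z\<close> can vanish on part of \<open>E\<close>.\<close>

lemma product_form_limit_min_gap:
  fixes \<pi> :: "'x \<Rightarrow> real ^ ('m::finite \<times> 'n::finite)"
  assumes F: "F \<noteq> bot" and lim: "(\<pi> \<longlongrightarrow> z) F"
    and pos: "\<And>x p. 0 < \<pi> x $ p" and prob: "\<And>x. (\<Sum>p\<in>UNIV. \<pi> x $ p) = 1"
    and form: "\<And>x p. p \<in> E \<Longrightarrow> \<pi> x $ p = exp (a x $ fst p + b x $ snd p) * K $ p"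
    and K: "\<And>p. 0 < K $ p"
    and z: "z \<in> edge_simplex E" and Q: "Q \<in> edge_simplex E"
    and marg: "marginal_X Q = marginal_X z" "marginal_Y Q = marginal_Y z"
  shows "rel_entropy z K + (\<Sum>p\<in>UNIV. (sqrt (Q $ p) - sqrt (z $ p))\<^sup>2) \<le> rel_entropy Q K"
proof -
  note zs = edge_simplexD[OF z] and Qs = edge_simplexD[OF Q]
  have shift: "rel_entropy P (\<pi> x) = rel_entropy P K
      - (\<Sum>i\<in>UNIV. marginal_X P $ i * a x $ i) - (\<Sum>j\<in>UNIV. marginal_Y P $ j * b x $ j)"
    if P: "P \<in> edge_simplex E" for P x
  proof -
    have "rel_entropy P (\<pi> x) = (\<Sum>p\<in>UNIV. P $ p * ln (P $ p / K $ p) - P $ p * a x $ fst p - P $ p * b x $ snd p)"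
      unfolding rel_entropy_def
    proof (rule sum.cong[OF refl])
      fix p
      show "P $ p * ln (P $ p / \<pi> x $ p) = P $ p * ln (P $ p / K $ p) - P $ p * a x $ fst p - P $ p * b x $ snd p"
      proof (cases "P $ p = 0")
        case False
        then have "p \<in> E" "0 < P $ p"
          using edge_simplexD(2)[OF P] edge_simplexD(1)[OF P, of p] by fastforce+
        then have "ln (P $ p / \<pi> x $ p) = ln (P $ p / K $ p) - (a x $ fst p + b x $ snd p)"
          using K[of p] by (simp add: form ln_div ln_mult)
        then show ?thesis by (simp only: right_diff_distrib distrib_left diff_diff_add)
      qed simp
    qed
    then show ?thesis
      by (simp add: sum_subtractf rel_entropy_def sum_mult_marginal_X[of P "\<lambda>i. a x $ i"]
          sum_mult_marginal_Y[of P "\<lambda>j. b x $ j"])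
  qed
  have "(\<Sum>p\<in>UNIV. (sqrt (Q $ p) - sqrt (\<pi> x $ p))\<^sup>2) - rel_entropy z (\<pi> x)
      \<le> rel_entropy Q K - rel_entropy z K" for x
  proof -
    have "(\<Sum>p\<in>UNIV. (sqrt (Q $ p) - sqrt (\<pi> x $ p))\<^sup>2) \<le> rel_entropy Q (\<pi> x)"
      using Qs pos prob by (intro rel_entropy_ge_hellinger) auto
    then show ?thesis using shift[OF Q, of x] shift[OF z, of x] marg by simp
  qed
  moreover have "((\<lambda>x. (\<Sum>p\<in>UNIV. (sqrt (Q $ p) - sqrt (\<pi> x $ p))\<^sup>2) - rel_entropy z (\<pi> x))
      \<longlongrightarrow> (\<Sum>p\<in>UNIV. (sqrt (Q $ p) - sqrt (z $ p))\<^sup>2) - (\<Sum>p\<in>(UNIV :: ('m \<times> 'n) set). 0)) F"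
    unfolding rel_entropy_def
  proof (intro tendsto_diff tendsto_sum tendsto_power tendsto_const tendsto_real_sqrt tendsto_vec_nth[OF lim])
    fix p
    show "((\<lambda>x. z $ p * ln (z $ p / \<pi> x $ p)) \<longlongrightarrow> 0) F"
    proof (cases "z $ p = 0")
      case False
      have "((\<lambda>x. z $ p * ln (z $ p / \<pi> x $ p)) \<longlongrightarrow> z $ p * ln (z $ p / z $ p)) F"
        using False by (intro tendsto_intros tendsto_vec_nth[OF lim]) auto
      then show ?thesis using False by simp
    qed simp
  qed
  ultimately have "(\<Sum>p\<in>UNIV. (sqrt (Q $ p) - sqrt (z $ p))\<^sup>2) - 0 \<le> rel_entropy Q K - rel_entropy z K"
    using F by (intro tendsto_upperbound[OF _ always_eventually]) auto
  then show ?thesis by simp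
qed

text \<open>On tight edges the cost matrix is a sum of potentials, so the transport cost depends only on the
  marginals, and minimizing the entropic cost amounts to minimizing the relative entropy, whatever
  \<open>\<tau>\<close> is.\<close>

lemma arg_min_ent_cost:
  fixes \<mu> :: "real ^ 'm::finite" and \<nu> :: "real ^ 'n::finite"
  assumes tight: "\<And>p. p \<in> E \<Longrightarrow> C $ p = f $ fst p + g $ snd p" and z: "z \<in> edge_simplex E"
    and gap: "\<And>Q. Q \<in> edge_simplex E \<Longrightarrow> marginal_X Q = marginal_X z \<Longrightarrow> marginal_Y Q = marginal_Y z \<Longrightarrow>
      rel_entropy z (tensor \<mu> \<nu>) + (\<Sum>p\<in>UNIV. (sqrt (Q $ p) - sqrt (z $ p))\<^sup>2) \<le> rel_entropy Q (tensor \<mu> \<nu>)"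
    and \<tau>: "0 < \<tau>"
  shows "arg_min (ent_cost \<mu> \<nu> E C \<tau>)
    (\<lambda>Q. Q \<in> edge_simplex E \<and> marginal_X Q = marginal_X z \<and> marginal_Y Q = marginal_Y z) = z"
proof (rule arg_min_eqI)
  have cost: "ent_cost \<mu> \<nu> E C \<tau> P = (\<Sum>i\<in>UNIV. marginal_X P $ i * f $ i)
      + (\<Sum>j\<in>UNIV. marginal_Y P $ j * g $ j) + \<tau> * rel_entropy P (tensor \<mu> \<nu>)"
    if P: "P \<in> edge_simplex E" for P
  proof -
    have "(\<Sum>p\<in>E. C $ p * P $ p) = (\<Sum>p\<in>E. P $ p * f $ fst p + P $ p * g $ snd p)"
      by (rule sum.cong) (simp_all add: tight algebra_simps)
    also have "\<dots> = (\<Sum>p\<in>UNIV. P $ p * f $ fst p + P $ p * g $ snd p)"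
      using edge_simplexD(2)[OF P] by (intro sum.mono_neutral_left) auto
    finally show ?thesis
      by (simp add: ent_cost_def sum.distrib sum_mult_marginal_X[of P "\<lambda>i. f $ i"]
          sum_mult_marginal_Y[of P "\<lambda>j. g $ j"])
  qed
  show "z \<in> edge_simplex E \<and> marginal_X z = marginal_X z \<and> marginal_Y z = marginal_Y z"
    using z by simp
  fix Q assume Q: "Q \<in> edge_simplex E \<and> marginal_X Q = marginal_X z \<and> marginal_Y Q = marginal_Y z"
    and "Q \<noteq> z"
  then have "\<not> (\<Sum>p\<in>UNIV. (sqrt (Q $ p) - sqrt (z $ p))\<^sup>2) \<le> 0"
    using hellinger_zero_iff[of Q z] edge_simplexD(1)[OF z] edge_simplexD(1)[of Q E] by simp
  then have "rel_entropy z (tensor \<mu> \<nu>) < rel_entropy Q (tensor \<mu> \<nu>)"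
    using gap[of Q] Q by linarith
  then show "ent_cost \<mu> \<nu> E C \<tau> z < ent_cost \<mu> \<nu> E C \<tau> Q"
    using cost[OF z] cost[of Q] Q \<tau> by simp
qed

lemma tendsto_at_right_of_unique_cluster:
  fixes X :: "real \<Rightarrow> 'a::metric_space"
  assumes "compact K" and K: "\<And>\<tau>. 0 < \<tau> \<Longrightarrow> X \<tau> \<in> K"
    and cluster: "\<And>\<sigma> y. (\<And>n. 0 < \<sigma> n) \<Longrightarrow> \<sigma> \<longlonglongrightarrow> 0 \<Longrightarrow> (\<lambda>n. X (\<sigma> n)) \<longlonglongrightarrow> y \<Longrightarrow> y = L"
  shows "(X \<longlongrightarrow> L) (at_right 0)"
  unfolding tendsto_at_iff_sequentially
proof (intro allI impI)
  fix \<sigma> :: "nat \<Rightarrow> real"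
  assume "\<forall>n. \<sigma> n \<in> {0<..} - {0}" and \<sigma>: "\<sigma> \<longlonglongrightarrow> 0"
  then have pos: "0 < \<sigma> n" for n by auto
  show "(X \<circ> \<sigma>) \<longlonglongrightarrow> L"
  proof (rule tendstoI, rule ccontr)
    fix e :: real assume e: "0 < e" and "\<not> (\<forall>\<^sub>F n in sequentially. dist ((X \<circ> \<sigma>) n) L < e)"
    then obtain r :: "nat \<Rightarrow> nat" where r: "strict_mono r" "\<And>n. \<not> dist (X (\<sigma> (r n))) L < e"
      using not_eventually_sequentiallyD by (auto simp: o_def)
    obtain y q where q: "strict_mono (q :: nat \<Rightarrow> nat)" "((\<lambda>n. X (\<sigma> (r n))) \<circ> q) \<longlonglongrightarrow> y"
      using \<open>compact K\<close> K[OF pos] unfolding compact_def by meson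
    have "(\<lambda>n. \<sigma> (r (q n))) \<longlonglongrightarrow> 0"
      using LIMSEQ_subseq_LIMSEQ[OF \<sigma> strict_mono_o[OF r(1) q(1)]] by (simp add: o_def)
    then have "y = L" using q(2) pos by (intro cluster[of "\<lambda>n. \<sigma> (r (q n))"]) (auto simp: o_def)
    then have "\<forall>\<^sub>F n in sequentially. dist (X (\<sigma> (r (q n)))) L < e"
      using tendstoD[OF q(2) e] by (simp add: o_def)
    then show False using r(2) by (auto simp: eventually_sequentially)
  qed
qed

lemma tendsto_nat_floor_mult:
  fixes t :: real
  assumes "0 \<le> t"
  shows "((\<lambda>\<tau>. real (nat \<lfloor>t / \<tau>\<rfloor>) * \<tau>) \<longlongrightarrow> t) (at_right 0)"
proof (rule tendsto_sandwich)
  show "\<forall>\<^sub>F \<tau> in at_right 0. t - \<tau> \<le> real (nat \<lfloor>t / \<tau>\<rfloor>) * \<tau>"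
    using eventually_at_right_less[of "0::real"]
    by eventually_elim (use nat_floor_divide(2)[OF assms] in fastforce)
  show "\<forall>\<^sub>F \<tau> in at_right 0. real (nat \<lfloor>t / \<tau>\<rfloor>) * \<tau> \<le> t"
    using eventually_at_right_less[of "0::real"]
    by eventually_elim (use nat_floor_divide(1)[OF assms] in fastforce)
  have "((\<lambda>\<tau>. t - \<tau>) \<longlongrightarrow> t - 0) (at_right 0)" by (intro tendsto_intros)
  then show "((\<lambda>\<tau>. t - \<tau>) \<longlongrightarrow> t) (at_right 0)" by simp
qed simp

context sinkhorn_phase
begin

text \<open>The summand is \<open>\<Sum>\<mu>\<^sup>*\<^sub>i (ln (\<mu>\<^sub>i / X\<^sub>i) - v\<^sub>i)\<close> for the row marginal \<open>X\<close>, and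
  \<open>\<tau> ln (\<mu>\<^sub>i / X\<^sub>i)\<close> is the increment of the row potential, so the sum telescopes.\<close>

lemma sum_row_entropy:
  assumes \<tau>: "0 < \<tau>"
  shows "(\<Sum>l<n. rel_entropy \<mu>s (marginal_X (even_plan \<tau> g0 (k + l))))
    = (\<Sum>i\<in>UNIV. \<mu>s $ i * ((row_potential \<tau> g0 (k + n) $ i - row_potential \<tau> g0 k $ i) / \<tau> - n * v $ i))"
proof (induction n)
  case (Suc n)
  have "rel_entropy \<mu>s (marginal_X (even_plan \<tau> g0 (k + n)))
    = (\<Sum>i\<in>UNIV. \<mu>s $ i * ((row_potential \<tau> g0 (k + Suc n) $ i - row_potential \<tau> g0 (k + n) $ i) / \<tau> - v $ i))"
    unfolding rel_entropy_def
  proof (rule sum.cong[OF refl])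
    fix i
    let ?x = "marginal_X (even_plan \<tau> g0 (k + n)) $ i"
    have "0 < ?x" by (rule marginal_gibbs_pos)
    then have "ln (\<mu>s $ i / ?x) = - ln (?x / \<mu> $ i) - v $ i"
      using \<mu>_pos[of i] \<mu>s_pos[of i] by (simp add: v_eq ln_div)
    also have "- ln (?x / \<mu> $ i) = (row_potential \<tau> g0 (k + Suc n) $ i - row_potential \<tau> g0 (k + n) $ i) / \<tau>"
      using row_potential_Suc[OF \<tau>, of g0 "k + n" i] \<tau> by (simp del: row_potential.simps)
    finally show "\<mu>s $ i * ln (\<mu>s $ i / ?x) = \<mu>s $ i * ((row_potential \<tau> g0 (k + Suc n) $ i - row_potential \<tau> g0 (k + n) $ i) / \<tau> - v $ i)"
      by simp
  qed
  then show ?case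
    unfolding sum.lessThan_Suc Suc.IH
    by (simp only: flip: sum.distrib) (auto intro!: sum.cong simp: algebra_simps diff_divide_distrib simp del: row_potential.simps)
qed simp

lemma exists_close_row_marginal:
  assumes \<tau>: "0 < \<tau>" and n: "0 < n"
  shows "\<exists>l\<ge>k. l < k + n \<and> rel_entropy \<mu>s (marginal_X (even_plan \<tau> g0 l))
    \<le> (\<Sum>i\<in>UNIV. \<mu>s $ i * ((row_potential \<tau> g0 (k + n) $ i - row_potential \<tau> g0 k $ i) / (real n * \<tau>) - v $ i))"
    (is "\<exists>l\<ge>k. l < k + n \<and> ?h l \<le> ?A")
proof (rule ccontr)
  assume "\<not> ?thesis"
  then have "?A < ?h (k + l)" if "l < n" for l
    using that by (meson add_less_cancel_left le_add1 not_le)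
  then have "(\<Sum>l<n. ?A) < (\<Sum>l<n. ?h (k + l))" using n by (intro sum_strict_mono) auto
  also have "\<dots> = real n * ?A"
  proof -
    have e: "real n * (x * (d / (real n * \<tau>) - y)) = x * (d / \<tau> - real n * y)" for x d y
      using n \<tau> by (simp add: field_simps)
    show ?thesis unfolding sum_row_entropy[OF \<tau>] sum_distrib_left e ..
  qed
  finally show False by simp
qed

text \<open>Between the start of the phase and the time of interest the row potential moves by
  \<open>T v + o(1)\<close>, so the averaged divergence of \<open>\<mu>\<^sup>*\<close> from the row marginals tends to zero. Some step in
  between has a row marginal close to \<open>\<mu>\<^sup>*\<close>, and entropies do not increase afterwards.\<close>

lemma row_entropy_limit_bound:
  assumes start: "((\<lambda>\<tau>. row_potential \<tau> g0 (nat \<lfloor>t0 / \<tau>\<rfloor>)) \<longlongrightarrow> f) (at_right 0)"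
    and t0: "0 \<le> t0" and T: "0 < T" "\<And>p. p \<notin> E \<Longrightarrow> excess T p < 0"
  obtains B where "(B \<longlongrightarrow> rel_entropy \<mu>s \<mu>) (at_right 0)"
    "\<forall>\<^sub>F \<tau> in at_right 0. rel_entropy (marginal_X (even_plan \<tau> g0 (nat \<lfloor>(t0 + T) / \<tau>\<rfloor>))) \<mu> \<le> B \<tau>"
proof -
  define k where "k \<tau> = nat \<lfloor>t0 / \<tau>\<rfloor>" for \<tau>
  define K where "K \<tau> = nat \<lfloor>(t0 + T) / \<tau>\<rfloor>" for \<tau>
  define n where "n \<tau> = K \<tau> - k \<tau>" for \<tau>
  define A where "A \<tau> = (\<Sum>i\<in>UNIV. \<mu>s $ i *
    ((row_potential \<tau> g0 (K \<tau>) $ i - row_potential \<tau> g0 (k \<tau>) $ i) / (real (K \<tau>) * \<tau> - real (k \<tau>) * \<tau>) - v $ i))" for \<tau>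
  have "((\<lambda>\<tau>. row_potential \<tau> g0 (K \<tau>)) \<longlongrightarrow> f + T *\<^sub>R v) (at_right 0)"
    unfolding K_def using T by (intro phase_convergence[OF start t0]) auto
  then have "(A \<longlongrightarrow> (\<Sum>i\<in>UNIV. \<mu>s $ i * (((f + T *\<^sub>R v) $ i - f $ i) / ((t0 + T) - t0) - v $ i))) (at_right 0)"
    unfolding A_def k_def K_def using start t0 T(1)
    by (intro tendsto_intros tendsto_nat_floor_mult) auto
  then have A: "(A \<longlongrightarrow> 0) (at_right 0)" using T(1) by simp
  define good where "good \<tau> l \<longleftrightarrow> l \<le> K \<tau> \<and> rel_entropy \<mu>s (marginal_X (even_plan \<tau> g0 l)) \<le> A \<tau>" for \<tau> l
  define l where "l \<tau> = (SOME l. good \<tau> l)" for \<tau>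
  have "\<forall>\<^sub>F \<tau> in at_right (0::real). \<tau> < T" using T(1) by (simp add: eventually_at_right_field) (use T(1) in blast)
  then have good: "\<forall>\<^sub>F \<tau> in at_right 0. 0 < \<tau> \<and> good \<tau> (l \<tau>)"
    using eventually_at_right_less[of "0::real"]
  proof eventually_elim
    case (elim \<tau>)
    have "real (k \<tau>) * \<tau> < real (K \<tau>) * \<tau>"
    proof -
      have "t0 + T < real (K \<tau>) * \<tau> + \<tau>"
        unfolding K_def using t0 T(1) elim by (intro nat_floor_divide) auto
      then show ?thesis using nat_floor_divide(1)[OF t0 elim(2)] elim unfolding k_def by linarith
    qed
    then have kK: "k \<tau> < K \<tau>" using elim(2) by simp
    then have K_eq: "K \<tau> = k \<tau> + n \<tau>" and n: "0 < n \<tau>" by (auto simp: n_def)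
    have "\<exists>l\<ge>k \<tau>. l < k \<tau> + n \<tau> \<and> rel_entropy \<mu>s (marginal_X (even_plan \<tau> g0 l)) \<le> A \<tau>"
    proof -
      have "real (n \<tau>) * \<tau> = real (K \<tau>) * \<tau> - real (k \<tau>) * \<tau>" by (simp add: K_eq algebra_simps)
      then show ?thesis using exists_close_row_marginal[OF elim(2) n, of "k \<tau>" g0] by (simp add: A_def K_eq)
    qed
    then have "\<exists>l. good \<tau> l" unfolding good_def K_eq by (meson less_imp_le)
    then show ?case using elim(2) unfolding l_def by (auto intro: someI_ex)
  qed
  define X where "X \<tau> = marginal_X (even_plan \<tau> g0 (l \<tau>))" for \<tau>
  have Xpos: "0 < X \<tau> $ i" for \<tau> i unfolding X_def by (rule marginal_gibbs_pos)
  have "\<forall>\<^sub>F \<tau> in at_right 0. (\<Sum>i\<in>UNIV. (sqrt (\<mu>s $ i) - sqrt (X \<tau> $ i))\<^sup>2) \<le> A \<tau>"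
    using good
  proof eventually_elim
    case (elim \<tau>)
    have "X \<tau> \<in> prob_simplex" unfolding X_def using elim by (intro marginal_X_prob even_plan_prob) auto
    then have "(\<Sum>i\<in>UNIV. (sqrt (\<mu>s $ i) - sqrt (X \<tau> $ i))\<^sup>2) \<le> rel_entropy \<mu>s (X \<tau>)"
      using \<mu>s_prob Xpos by (intro rel_entropy_ge_hellinger) (auto simp: prob_simplex_def)
    then show ?case using elim by (simp add: good_def X_def)
  qed
  then have X: "(X \<longlongrightarrow> \<mu>s) (at_right 0)"
    using Xpos \<mu>s_pos A by (intro tendsto_of_hellinger[where A = A]) (auto simp: less_imp_le)
  have "((\<lambda>\<tau>. rel_entropy (X \<tau>) \<mu>) \<longlongrightarrow> rel_entropy \<mu>s \<mu>) (at_right 0)"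
    by (rule continuous_on_tendsto_compose[OF continuous_on_rel_entropy[OF \<mu>_pos] X])
      (use Xpos \<mu>s_pos in \<open>auto simp: less_imp_le\<close>)
  moreover have "\<forall>\<^sub>F \<tau> in at_right 0. rel_entropy (marginal_X (even_plan \<tau> g0 (K \<tau>))) \<mu> \<le> rel_entropy (X \<tau>) \<mu>"
    using good by eventually_elim (auto simp: X_def good_def intro: row_entropy_antimono)
  ultimately show ?thesis unfolding K_def by (rule that)
qed

text \<open>Column \<open>j\<close> contains a persistent edge \<open>(k, j)\<close>. The entry there is at most \<open>1\<close>, and the ratio of the
  two entries involves the row potentials only, whose limit is known.\<close>

lemma off_edge_vanishes:
  assumes start: "((\<lambda>\<tau>. row_potential \<tau> g0 (nat \<lfloor>t0 / \<tau>\<rfloor>)) \<longlongrightarrow> f) (at_right 0)"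
    and t0: "0 \<le> t0" and T: "0 \<le> T" "\<And>p. p \<notin> E \<Longrightarrow> excess T p < 0" and p: "(i, j) \<notin> E"
  shows "((\<lambda>\<tau>. even_plan \<tau> g0 (nat \<lfloor>(t0 + T) / \<tau>\<rfloor>) $ (i, j)) \<longlongrightarrow> 0) (at_right 0)"
proof -
  obtain k where k: "(k, j) \<in> E" "v $ k + w $ j = 0" using persistent_col by blast
  define F where "F \<tau> = row_potential \<tau> g0 (nat \<lfloor>(t0 + T) / \<tau>\<rfloor>)" for \<tau>
  have lim: "(F \<longlongrightarrow> f + T *\<^sub>R v) (at_right 0)"
    unfolding F_def by (rule phase_convergence[OF start t0 T])
  define c where "c \<tau> = F \<tau> $ i - F \<tau> $ k + C $ (k, j) - C $ (i, j)" for \<tau>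
  have "(c \<longlongrightarrow> (f + T *\<^sub>R v) $ i - (f + T *\<^sub>R v) $ k + C $ (k, j) - C $ (i, j)) (at_right 0)"
    unfolding c_def by (intro tendsto_intros lim)
  also have "(f + T *\<^sub>R v) $ i - (f + T *\<^sub>R v) $ k + C $ (k, j) - C $ (i, j) = excess T (i, j)"
  proof -
    have "w $ j = - v $ k" using k(2) by simp
    then show ?thesis using tight[OF k(1)] by (simp add: excess_def algebra_simps)
  qed
  finally have "\<forall>\<^sub>F \<tau> in at_right 0. c \<tau> < excess T (i, j) / 2"
    using T(2)[OF p] by (intro order_tendstoD(2)) auto
  then have "\<forall>\<^sub>F \<tau> in at_right 0. norm (gibbs \<tau> (F \<tau>) (Gr \<tau> (F \<tau>)) $ (i, j))
      \<le> exp (excess T (i, j) / 2 / \<tau>) * (\<mu> $ i / \<mu> $ k)"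
    using eventually_at_right_less[of "0::real"]
  proof eventually_elim
    case (elim \<tau>)
    let ?G = "gibbs \<tau> (F \<tau>) (Gr \<tau> (F \<tau>))"
    have "(- C $ (i, j) + F \<tau> $ i + Gr \<tau> (F \<tau>) $ j) / \<tau>
      = c \<tau> / \<tau> + (- C $ (k, j) + F \<tau> $ k + Gr \<tau> (F \<tau>) $ j) / \<tau>"
      using elim(2) by (simp add: c_def field_simps)
    then have "?G $ (i, j) = exp (c \<tau> / \<tau>) * (\<mu> $ i / \<mu> $ k) * ?G $ (k, j)"
      using \<mu>_pos[of k] by (simp add: gibbs_def exp_add)
    also have "\<dots> \<le> exp (c \<tau> / \<tau>) * (\<mu> $ i / \<mu> $ k) * 1"
      using even_plan_prob[OF elim(2)] \<mu>_pos[of k] \<mu>_pos[of i]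
      by (intro mult_left_mono prob_component_le_1) (auto simp: F_def less_imp_le)
    also have "\<dots> \<le> exp (excess T (i, j) / 2 / \<tau>) * (\<mu> $ i / \<mu> $ k)"
    proof -
      have "exp (c \<tau> / \<tau>) \<le> exp (excess T (i, j) / 2 / \<tau>)"
        using elim by (simp only: exp_le_cancel_iff) (intro divide_right_mono; simp)
      then show ?thesis
        unfolding mult_1_right using \<mu>_pos[of k] \<mu>_pos[of i] by (intro mult_right_mono) auto
    qed
    finally show ?case using gibbs_pos[of \<tau> "F \<tau>" "Gr \<tau> (F \<tau>)" "(i, j)"] by simp
  qed
  moreover have "((\<lambda>\<tau>. exp (excess T (i, j) / 2 / \<tau>) * (\<mu> $ i / \<mu> $ k)) \<longlongrightarrow> 0) (at_right 0)"
    using T(2)[OF p] by (intro tendsto_mult_left_zero tendsto_exp_neg_divide) simp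
  ultimately show ?thesis unfolding F_def by (rule Lim_null_comparison)
qed

lemma gibbs_on_edges:
  assumes "p \<in> E"
  shows "gibbs \<tau> f' g' $ p = exp ((\<chi> i. (f' $ i - f $ i) / \<tau>) $ fst p + (\<chi> j. (g' $ j - g $ j) / \<tau>) $ snd p) * tensor \<mu> \<nu> $ p"
  by (simp add: gibbs_def tensor_def tight[OF assms] diff_divide_distrib add_divide_distrib)

text \<open>The first conclusion leaves a single candidate for the cluster points of the even plans. The
  right-hand sides do not depend on \<open>\<tau>\<close>, which settles the limits that define \<open>Q\<^sup>*\<^sub>0\<close> and \<open>P\<^sup>*\<^sub>0\<close>.\<close>

lemma cluster_plan_eq_stars:
  assumes start: "((\<lambda>\<tau>. row_potential \<tau> g0 (nat \<lfloor>t0 / \<tau>\<rfloor>)) \<longlongrightarrow> f) (at_right 0)"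
    and t0: "0 \<le> t0" and T: "0 < T" "\<And>p. p \<notin> E \<Longrightarrow> excess T p < 0"
    and \<sigma>: "\<And>n. 0 < \<sigma> n" "\<sigma> \<longlonglongrightarrow> 0"
    and y: "(\<lambda>n. even_plan (\<sigma> n) g0 (nat \<lfloor>(t0 + T) / \<sigma> n\<rfloor>)) \<longlonglongrightarrow> y"
  shows "0 < \<tau> \<Longrightarrow> Q_star \<mu> \<nu> E C \<tau> = y"
    and "0 < \<tau> \<Longrightarrow> P_star \<mu> \<nu> E C \<tau> = (\<chi> p. y $ p * (\<mu> $ fst p / \<mu>s $ fst p))"
    and "marginal_X y = \<mu>s"
proof -
  define K where "K \<tau> = nat \<lfloor>(t0 + T) / \<tau>\<rfloor>" for \<tau> :: real
  define \<pi> where "\<pi> = (\<lambda>n. even_plan (\<sigma> n) g0 (K (\<sigma> n)))"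
  have \<pi>: "\<pi> \<longlonglongrightarrow> y" using y by (simp add: \<pi>_def K_def)
  have \<pi>pos: "0 < \<pi> n $ p" for n p by (simp add: \<pi>_def gibbs_pos)
  have \<pi>prob: "\<pi> n \<in> prob_simplex" for n unfolding \<pi>_def by (rule even_plan_prob[OF \<sigma>(1)])
  have \<sigma>_right: "filterlim \<sigma> (at_right 0) sequentially"
    using \<sigma> by (simp add: filterlim_at less_imp_neq[symmetric])
  have y_prob: "y \<in> prob_simplex"
    by (rule closed_sequentially[OF compact_imp_closed[OF compact_prob_simplex] \<pi>prob \<pi>])
  have "y $ (i, j) = 0" if "(i, j) \<notin> E" for i j
    using tendsto_vec_nth[OF \<pi>, of "(i, j)"]
      filterlim_compose[OF off_edge_vanishes[OF start t0 less_imp_le[OF T(1)] T(2) that] \<sigma>_right]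
    unfolding \<pi>_def K_def by (intro LIMSEQ_unique)
  then have yE: "y \<in> edge_simplex E" using y_prob by (auto simp: edge_simplex_def)
  have tend_X: "(\<lambda>n. marginal_X (\<pi> n)) \<longlonglongrightarrow> marginal_X y"
    using \<pi> unfolding marginal_X_def by (intro tendsto_intros)
  have "(\<lambda>n. marginal_Y (\<pi> n)) \<longlonglongrightarrow> marginal_Y y"
    using \<pi> unfolding marginal_Y_def by (intro tendsto_intros)
  then have yY: "marginal_Y y = \<nu>"
    unfolding \<pi>_def marginal_Y_gibbs_g_reg[OF \<sigma>(1)] by (simp add: LIMSEQ_const_iff)
  obtain B where B: "(B \<longlongrightarrow> rel_entropy \<mu>s \<mu>) (at_right 0)"
    "\<forall>\<^sub>F \<tau> in at_right 0. rel_entropy (marginal_X (even_plan \<tau> g0 (K \<tau>))) \<mu> \<le> B \<tau>"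
    using row_entropy_limit_bound[OF start t0 T] unfolding K_def .
  have X_nonneg: "0 \<le> marginal_X (\<pi> n) $ i" "0 \<le> marginal_X y $ i" for n i
    using marginal_X_prob[OF \<pi>prob, of n] marginal_X_prob[OF y_prob] unfolding prob_simplex_def by blast+
  have "(\<lambda>n. rel_entropy (marginal_X (\<pi> n)) \<mu>) \<longlonglongrightarrow> rel_entropy (marginal_X y) \<mu>"
    by (rule continuous_on_tendsto_compose[OF continuous_on_rel_entropy[OF \<mu>_pos] tend_X])
      (simp_all add: X_nonneg)
  moreover have "(\<lambda>n. B (\<sigma> n)) \<longlonglongrightarrow> rel_entropy \<mu>s \<mu>" by (rule filterlim_compose[OF B(1) \<sigma>_right])
  moreover have "\<forall>\<^sub>F n in sequentially. rel_entropy (marginal_X (\<pi> n)) \<mu> \<le> B (\<sigma> n)"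
    unfolding \<pi>_def using eventually_compose_filterlim[OF B(2) \<sigma>_right] .
  ultimately have "rel_entropy (marginal_X y) \<mu> \<le> rel_entropy \<mu>s \<mu>"
    by (intro tendsto_le[OF trivial_limit_sequentially])
  then have "(\<Sum>i\<in>UNIV. (sqrt (marginal_X y $ i) - sqrt (\<mu>s $ i))\<^sup>2) \<le> 0"
    using \<mu>s_gap[OF yE yY] by linarith
  then show yX: "marginal_X y = \<mu>s"
    using hellinger_zero_iff[of "marginal_X y" \<mu>s] marginal_X_prob[OF y_prob] \<mu>s_prob
    by (simp add: prob_simplex_def)
  show "Q_star \<mu> \<nu> E C \<tau> = y" if "0 < \<tau>"
  proof -
    have "rel_entropy y (tensor \<mu> \<nu>) + (\<Sum>p\<in>UNIV. (sqrt (Q $ p) - sqrt (y $ p))\<^sup>2) \<le> rel_entropy Q (tensor \<mu> \<nu>)"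
      if "Q \<in> edge_simplex E" "marginal_X Q = marginal_X y" "marginal_Y Q = marginal_Y y" for Q
      by (rule product_form_limit_min_gap[OF trivial_limit_sequentially \<pi> \<pi>pos _ _ _ yE that,
            where a = "\<lambda>n. \<chi> i. (row_potential (\<sigma> n) g0 (K (\<sigma> n)) $ i - f $ i) / \<sigma> n"
              and b = "\<lambda>n. \<chi> j. (Gr (\<sigma> n) (row_potential (\<sigma> n) g0 (K (\<sigma> n))) $ j - g $ j) / \<sigma> n"])
        (use \<pi>prob \<mu>_pos \<nu>_pos in \<open>auto simp: \<pi>_def gibbs_on_edges prob_simplex_def tensor_def\<close>)
    from arg_min_ent_cost[OF tight yE this that] show ?thesis
      unfolding yX yY Q_star_def \<mu>s_def .
  qed
  define z where "z = (\<chi> p. y $ p * (\<mu> $ fst p / \<mu>s $ fst p))"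
  define \<rho> where "\<rho> = (\<lambda>n. odd_plan (\<sigma> n) g0 (K (\<sigma> n)))"
  have "(\<lambda>n. \<rho> n $ p) \<longlonglongrightarrow> z $ p" for p
  proof -
    have "\<rho> n $ p = \<pi> n $ p * (\<mu> $ fst p / marginal_X (\<pi> n) $ fst p)" for n
      unfolding \<rho>_def \<pi>_def using odd_plan_eq[OF \<sigma>(1), of n g0 _ "fst p" "snd p"] by simp
    moreover have "(\<lambda>n. \<pi> n $ p * (\<mu> $ fst p / marginal_X (\<pi> n) $ fst p)) \<longlonglongrightarrow> y $ p * (\<mu> $ fst p / \<mu>s $ fst p)"
      using \<mu>s_pos[of "fst p"] \<pi> tend_X unfolding yX by (intro tendsto_intros) auto
    ultimately show ?thesis by (simp add: z_def)
  qed
  then have \<rho>: "\<rho> \<longlonglongrightarrow> z" by (rule vec_tendstoI)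
  have \<rho>pos: "0 < \<rho> n $ p" for n p by (simp add: \<rho>_def gibbs_pos)
  have \<rho>prob: "\<rho> n \<in> prob_simplex" for n unfolding \<rho>_def by (rule odd_plan_prob[OF \<sigma>(1)])
  have zE: "z \<in> edge_simplex E"
    using closed_sequentially[OF compact_imp_closed[OF compact_prob_simplex] \<rho>prob \<rho>] edge_simplexD(2)[OF yE]
    by (simp add: edge_simplex_def z_def)
  have zX: "marginal_X z = \<mu>"
  proof -
    have "(\<lambda>n. marginal_X (\<rho> n)) \<longlonglongrightarrow> marginal_X z"
      using \<rho> unfolding marginal_X_def by (intro tendsto_intros)
    then show ?thesis
      unfolding \<rho>_def row_potential.simps marginal_X_gibbs_f_reg[OF \<sigma>(1)] by (simp add: LIMSEQ_const_iff)
  qed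
  have z_eq: "z $ p = y $ p * exp (- w $ snd p)" for p
  proof (cases "y $ p = 0")
    case False
    then have "0 < y $ p" using edge_simplexD(1)[OF yE, of p] by simp
    then have "- w $ snd p = v $ fst p" using support_persistent[OF yE yX yY] by fastforce
    then show ?thesis using \<mu>_pos \<mu>s_pos by (simp add: z_def v_eq)
  qed (simp add: z_def)
  have zY: "marginal_Y z = \<nu>s"
    using yY by (auto simp: vec_eq_iff marginal_Y_def z_eq \<nu>s_eq simp flip: sum_distrib_right)
  show "P_star \<mu> \<nu> E C \<tau> = (\<chi> p. y $ p * (\<mu> $ fst p / \<mu>s $ fst p))" if "0 < \<tau>"
  proof -
    have "rel_entropy z (tensor \<mu> \<nu>) + (\<Sum>p\<in>UNIV. (sqrt (Q $ p) - sqrt (z $ p))\<^sup>2) \<le> rel_entropy Q (tensor \<mu> \<nu>)"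
      if "Q \<in> edge_simplex E" "marginal_X Q = marginal_X z" "marginal_Y Q = marginal_Y z" for Q
      by (rule product_form_limit_min_gap[OF trivial_limit_sequentially \<rho> \<rho>pos _ _ _ zE that,
            where a = "\<lambda>n. \<chi> i. (row_potential (\<sigma> n) g0 (Suc (K (\<sigma> n))) $ i - f $ i) / \<sigma> n"
              and b = "\<lambda>n. \<chi> j. (Gr (\<sigma> n) (row_potential (\<sigma> n) g0 (K (\<sigma> n))) $ j - g $ j) / \<sigma> n"])
        (use \<rho>prob \<mu>_pos \<nu>_pos in \<open>auto simp: \<rho>_def gibbs_on_edges prob_simplex_def tensor_def\<close>)
    from arg_min_ent_cost[OF tight zE this that] show ?thesis
      unfolding zX zY P_star_def \<nu>s_def z_def[symmetric] .
  qed
qed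

text \<open>The even plans lie in a compact set and have a single cluster point, so they converge; the odd plans
  follow by rescaling rows.\<close>

lemma phase_limit:
  assumes start: "((\<lambda>\<tau>. row_potential \<tau> g0 (nat \<lfloor>t0 / \<tau>\<rfloor>)) \<longlongrightarrow> f) (at_right 0)"
    and t0: "0 \<le> t0" and T: "0 < T" "\<And>p. p \<notin> E \<Longrightarrow> excess T p < 0"
  shows "((\<lambda>\<tau>. (even_plan \<tau> g0 (nat \<lfloor>(t0 + T) / \<tau>\<rfloor>), odd_plan \<tau> g0 (nat \<lfloor>(t0 + T) / \<tau>\<rfloor>)))
    \<longlongrightarrow> (Q_star_zero \<mu> \<nu> E C, P_star_zero \<mu> \<nu> E C)) (at_right 0)"
proof -
  define K where "K \<tau> = nat \<lfloor>(t0 + T) / \<tau>\<rfloor>" for \<tau> :: real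
  define y where "y = Q_star \<mu> \<nu> E C 1"
  have lp: "0 < \<tau> \<Longrightarrow> Q_star \<mu> \<nu> E C \<tau> = x"
    "0 < \<tau> \<Longrightarrow> P_star \<mu> \<nu> E C \<tau> = (\<chi> p. x $ p * (\<mu> $ fst p / \<mu>s $ fst p))"
    "marginal_X x = \<mu>s"
    if "\<And>n. 0 < \<sigma> n" "\<sigma> \<longlonglongrightarrow> 0" "(\<lambda>n. even_plan (\<sigma> n) g0 (K (\<sigma> n))) \<longlonglongrightarrow> x" for \<sigma> x \<tau>
  proof -
    note * = cluster_plan_eq_stars[OF start t0 T(1) _ that(1,2) that(3)[unfolded K_def]]
    show "Q_star \<mu> \<nu> E C \<tau> = x" if "0 < \<tau>" by (rule *(1)[OF _ that]) (fact T(2))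
    show "P_star \<mu> \<nu> E C \<tau> = (\<chi> p. x $ p * (\<mu> $ fst p / \<mu>s $ fst p))" if "0 < \<tau>"
      by (rule *(2)[OF _ that]) (fact T(2))
    show "marginal_X x = \<mu>s" by (rule *(3)) (fact T(2))
  qed
  have lim: "((\<lambda>\<tau>. even_plan \<tau> g0 (K \<tau>)) \<longlongrightarrow> y) (at_right 0)"
  proof (rule tendsto_at_right_of_unique_cluster[OF compact_prob_simplex even_plan_prob])
    fix \<sigma> :: "nat \<Rightarrow> real" and x
    assume "\<And>n. 0 < \<sigma> n" "\<sigma> \<longlonglongrightarrow> 0" "(\<lambda>n. even_plan (\<sigma> n) g0 (K (\<sigma> n))) \<longlonglongrightarrow> x"
    then show "x = y" using lp(1)[of \<sigma> x 1] by (simp add: y_def)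
  qed
  define \<sigma> :: "nat \<Rightarrow> real" where "\<sigma> = (\<lambda>n. inverse (real (Suc n)))"
  have \<sigma>: "\<And>n. 0 < \<sigma> n" "\<sigma> \<longlonglongrightarrow> 0" using LIMSEQ_inverse_real_of_nat unfolding \<sigma>_def by simp_all
  then have "filterlim \<sigma> (at_right 0) sequentially"
    by (simp add: filterlim_at less_imp_neq[symmetric])
  then have y: "(\<lambda>n. even_plan (\<sigma> n) g0 (K (\<sigma> n))) \<longlonglongrightarrow> y"
    by (rule filterlim_compose[OF lim])
  define z where "z = (\<chi> p. y $ p * (\<mu> $ fst p / \<mu>s $ fst p))"
  have Q: "Q_star \<mu> \<nu> E C \<tau> = y" and P: "P_star \<mu> \<nu> E C \<tau> = z" if "0 < \<tau>" for \<tau>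
    using lp(1,2)[OF \<sigma> y that] by (auto simp: z_def)
  have yX: "marginal_X y = \<mu>s" by (rule lp(3)[OF \<sigma> y])
  have "(Q_star \<mu> \<nu> E C \<longlongrightarrow> y) (at_right 0)"
    by (rule Lim_transform_eventually[OF tendsto_const])
      (use eventually_at_right_less[of "0::real"] in eventually_elim, simp add: Q)
  then have Q0: "Q_star_zero \<mu> \<nu> E C = y" unfolding Q_star_zero_def by (intro tendsto_Lim) auto
  have "(P_star \<mu> \<nu> E C \<longlongrightarrow> z) (at_right 0)"
    by (rule Lim_transform_eventually[OF tendsto_const])
      (use eventually_at_right_less[of "0::real"] in eventually_elim, simp add: P)
  then have P0: "P_star_zero \<mu> \<nu> E C = z" unfolding P_star_zero_def by (intro tendsto_Lim) auto
  have "((\<lambda>\<tau>. odd_plan \<tau> g0 (K \<tau>)) \<longlongrightarrow> z) (at_right 0)"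
  proof (rule vec_tendstoI)
    fix p
    have "((\<lambda>\<tau>. marginal_X (even_plan \<tau> g0 (K \<tau>))) \<longlongrightarrow> \<mu>s) (at_right 0)"
      unfolding yX[symmetric] using lim unfolding marginal_X_def by (intro tendsto_intros)
    then have "((\<lambda>\<tau>. even_plan \<tau> g0 (K \<tau>) $ p * (\<mu> $ fst p / marginal_X (even_plan \<tau> g0 (K \<tau>)) $ fst p))
        \<longlongrightarrow> y $ p * (\<mu> $ fst p / \<mu>s $ fst p)) (at_right 0)"
      using \<mu>s_pos[of "fst p"] lim by (intro tendsto_intros) auto
    moreover have "\<forall>\<^sub>F \<tau> in at_right 0. even_plan \<tau> g0 (K \<tau>) $ p * (\<mu> $ fst p / marginal_X (even_plan \<tau> g0 (K \<tau>)) $ fst p)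
        = odd_plan \<tau> g0 (K \<tau>) $ p"
      using eventually_at_right_less[of "0::real"]
    proof eventually_elim
      case (elim \<tau>)
      show ?case using odd_plan_eq[OF elim, of g0 "K \<tau>" "fst p" "snd p"] by simp
    qed
    ultimately show "((\<lambda>\<tau>. odd_plan \<tau> g0 (K \<tau>) $ p) \<longlongrightarrow> z $ p) (at_right 0)"
      unfolding z_def vec_lambda_beta by (rule Lim_transform_eventually)
  qed
  then show ?thesis unfolding Q0 P0 using lim unfolding K_def by (intro tendsto_Pair)
qed

end

section \<open>Chaining the phases\<close>

text \<open>If the constraint \<open>p\<close> were violated or tight at \<open>t\<close>, then \<open>t\<close> would belong to the set whose infimum
  ends the phase.\<close>

lemma before_phase_end:
  assumes t: "phase_time s \<le> t" "ereal t < phase_end \<mu> \<nu> C s" and p: "p \<notin> phase_edges s"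
  shows "phase_f s $ fst p + phase_g s $ snd p - C $ p
    + (t - phase_time s) * (v_star \<mu> \<nu> (phase_edges s) $ fst p + w_star \<mu> \<nu> (phase_edges s) $ snd p) < 0"
proof (rule ccontr)
  let ?v = "v_star \<mu> \<nu> (phase_edges s)" and ?w = "w_star \<mu> \<nu> (phase_edges s)"
  let ?h = "\<lambda>(i, j). ereal (phase_f s $ i + phase_g s $ j + (t - phase_time s) * (?v $ i + ?w $ j) - C $ (i, j))"
  assume "\<not> ?thesis"
  then have "0 \<le> ?h p" by (cases p) (simp add: zero_ereal_def algebra_simps)
  also have "\<dots> \<le> (SUP q\<in>- phase_edges s. ?h q)" using p by (intro SUP_upper) auto
  finally have "phase_end \<mu> \<nu> C s \<le> ereal t"
    unfolding phase_end_def Let_def using t(1) by (intro Inf_lower imageI) auto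
  then show False using t(2) by simp
qed

lemma phase_end_ge: "ereal (phase_time s) \<le> phase_end \<mu> \<nu> C s"
  unfolding phase_end_def Let_def by (intro Inf_greatest) auto

context sinkhorn
begin

text \<open>A row \<open>i\<close> attains the minimum defining \<open>f\<^sub>0[g\<^sup>0]\<^sub>i\<close> at some \<open>j\<close>; replacing \<open>g\<^sup>0\<close> by the larger
  \<open>g\<^sub>0[f\<^sub>0[g\<^sup>0]]\<close> cannot break feasibility, so the constraint \<open>(i, j)\<close> is tight.\<close>

lemma initial_phase_valid: "sinkhorn_phase \<mu> \<nu> C (f_zero C g0) (g_zero C (f_zero C g0))"
proof -
  define f where "f = f_zero C g0"
  define g where "g = g_zero C f"
  have f_le: "f $ i \<le> C $ (i, j) - g0 $ j" for i j
    unfolding f_def f_zero_def by (auto intro!: Min_le)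
  have g_le: "g $ j \<le> C $ (i, j) - f $ i" for i j
    unfolding g_def g_zero_def by (auto intro!: Min_le)
  have f_att: "\<exists>j. f $ i = C $ (i, j) - g0 $ j" for i
    using Min_in[of "range (\<lambda>j. C $ (i, j) - g0 $ j)"] by (simp add: f_def f_zero_def image_iff)
  have g_att: "\<exists>i. g $ j = C $ (i, j) - f $ i" for j
    using Min_in[of "range (\<lambda>i. C $ (i, j) - f $ i)"] by (simp add: g_def g_zero_def image_iff)
  have g0_le: "g0 $ j \<le> g $ j" for j
    using g_att[of j] f_le[of _ j] by (metis add.commute le_diff_eq)
  show ?thesis
    unfolding f_def[symmetric] g_def[symmetric]
  proof unfold_locales
    show "f $ i + g $ j \<le> C $ (i, j)" for i j using g_le[of j i] by simp
    show "\<exists>j. (i, j) \<in> tight_edges C f g" for i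
    proof -
      obtain j where "f $ i = C $ (i, j) - g0 $ j" using f_att by blast
      then show ?thesis
        using g0_le[of j] g_le[of j i] by (intro exI[of _ j]) (simp add: tight_edges_def)
    qed
    show "\<exists>i. (i, j) \<in> tight_edges C f g" for j
    proof -
      obtain i where "g $ j = C $ (i, j) - f $ i" using g_att by blast
      then show ?thesis by (intro exI[of _ i]) (simp add: tight_edges_def)
    qed
  qed
qed

text \<open>The convergence of the row potential at the starting time of a phase is part of the invariant, as it
  is the initial condition for the analysis of that phase.\<close>

lemma cold_phase_invariant:
  assumes "cold_phase \<mu> \<nu> C (f_zero C g0) (g_zero C (f_zero C g0)) l = Some s"
  shows "0 \<le> phase_time s \<and> phase_edges s = tight_edges C (phase_f s) (phase_g s)
    \<and> sinkhorn_phase \<mu> \<nu> C (phase_f s) (phase_g s)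
    \<and> ((\<lambda>\<tau>. row_potential \<tau> g0 (nat \<lfloor>phase_time s / \<tau>\<rfloor>)) \<longlongrightarrow> phase_f s) (at_right 0)"
  using assms
proof (induction l arbitrary: s)
  case 0
  then show ?case using initial_phase_valid row_potential_0_tendsto by auto
next
  case (Suc l)
  then obtain r where r: "cold_phase \<mu> \<nu> C (f_zero C g0) (g_zero C (f_zero C g0)) l = Some r"
    and fin: "phase_end \<mu> \<nu> C r \<noteq> \<infinity>" and s: "s = next_phase \<mu> \<nu> C r"
    by (auto split: option.splits if_splits)
  note IH = Suc.IH[OF r]
  interpret sinkhorn_phase \<mu> \<nu> C "phase_f r" "phase_g r" using IH by simp
  have E: "E = phase_edges r" using IH by (simp add: E_def)
  obtain t where t: "phase_end \<mu> \<nu> C r = ereal t"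
    using fin phase_end_ge[of r \<mu> \<nu> C] by (cases "phase_end \<mu> \<nu> C r") auto
  have ge: "phase_time r \<le> t" using phase_end_ge[of r \<mu> \<nu> C] t by simp
  define T where "T = t - phase_time r"
  have T0: "0 \<le> T" using ge by (simp add: T_def)
  have neg: "excess x p < 0" if "0 \<le> x" "x < T" "p \<notin> E" for x p
    using before_phase_end[of r "phase_time r + x" \<mu> \<nu> C p] that
    by (simp add: t T_def E excess_def v_def w_def)
  have s_eq: "s = \<lparr>phase_time = t, phase_f = phase_f r + T *\<^sub>R v, phase_g = phase_g r + T *\<^sub>R w,
    phase_edges = tight_edges C (phase_f r + T *\<^sub>R v) (phase_g r + T *\<^sub>R w)\<rparr>"
    by (simp add: s next_phase_def t Let_def T_def v_def w_def E)
  have "((\<lambda>\<tau>. row_potential \<tau> g0 (nat \<lfloor>(phase_time r + T) / \<tau>\<rfloor>)) \<longlongrightarrow> phase_f r + T *\<^sub>R v) (at_right 0)"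
    using IH T0 neg by (intro phase_convergence_end) auto
  then show ?case
    using next_phase_valid[OF T0 neg] IH ge by (simp add: s_eq T_def)
qed

end

theorem theorem5p1:
  fixes \<mu> f0 :: "real ^ 'm::finite" and \<nu> g0 :: "real ^ 'n::finite"
    and C :: "real ^ ('m \<times> 'n)"
  assumes "\<mu> \<in> prob_simplex" and "\<forall>i. 0 < \<mu> $ i"
    and "\<nu> \<in> prob_simplex" and "\<forall>j. 0 < \<nu> $ j"
  shows "\<forall>l s t. cold_phase \<mu> \<nu> C (f_zero C g0) (g_zero C (f_zero C g0)) l = Some s
      \<and> phase_time s < t \<and> ereal t < phase_end \<mu> \<nu> C s
    \<longrightarrow> ((\<lambda>\<tau>. (sinkhorn_primal \<mu> \<nu> C \<tau> f0 g0 (2 * nat \<lfloor>t / \<tau>\<rfloor> + 2),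
               sinkhorn_primal \<mu> \<nu> C \<tau> f0 g0 (2 * nat \<lfloor>t / \<tau>\<rfloor> + 3)))
          \<longlongrightarrow> (Q_star_zero \<mu> \<nu> (phase_edges s) C, P_star_zero \<mu> \<nu> (phase_edges s) C))
         (at_right 0)"
proof (intro allI impI, elim conjE)
  fix l s t
  assume s: "cold_phase \<mu> \<nu> C (f_zero C g0) (g_zero C (f_zero C g0)) l = Some s"
    and t: "phase_time s < t" "ereal t < phase_end \<mu> \<nu> C s"
  interpret sinkhorn \<mu> \<nu> C using assms by unfold_locales auto
  note inv = cold_phase_invariant[OF s]
  interpret sinkhorn_phase \<mu> \<nu> C "phase_f s" "phase_g s" using inv by simp
  have E: "E = phase_edges s" using inv by (simp add: E_def)
  have neg: "excess (t - phase_time s) p < 0" if "p \<notin> E" for p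
    using before_phase_end[of s t \<mu> \<nu> C p] t that by (simp add: E excess_def v_def w_def)
  have t_eq: "phase_time s + (t - phase_time s) = t" by simp
  have "((\<lambda>\<tau>. (even_plan \<tau> g0 (nat \<lfloor>t / \<tau>\<rfloor>), odd_plan \<tau> g0 (nat \<lfloor>t / \<tau>\<rfloor>)))
    \<longlongrightarrow> (Q_star_zero \<mu> \<nu> E C, P_star_zero \<mu> \<nu> E C)) (at_right 0)"
    by (rule phase_limit[of g0 "phase_time s" "t - phase_time s", unfolded t_eq]) (use inv t neg in auto)
  then show "((\<lambda>\<tau>. (sinkhorn_primal \<mu> \<nu> C \<tau> f0 g0 (2 * nat \<lfloor>t / \<tau>\<rfloor> + 2),
               sinkhorn_primal \<mu> \<nu> C \<tau> f0 g0 (2 * nat \<lfloor>t / \<tau>\<rfloor> + 3)))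
          \<longlongrightarrow> (Q_star_zero \<mu> \<nu> (phase_edges s) C, P_star_zero \<mu> \<nu> (phase_edges s) C))
         (at_right 0)"
    unfolding sinkhorn_primal_even sinkhorn_primal_odd E .
qed

end
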